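(* Let $H$ be a Hopf algebra and let $\pi:L\to H$ be a relative Rota-Baxter operator on $H$ with respect to $(L,\rightharpoonup)$. For $a,b\in L$ define $$a\circ_\pi b=a_1(\pi(a_2)\rightharpoonup b),\qquad T_\pi(a)=S_H(\pi(a_1))\rightharpoonup S_L(a_2),$$ and denote $L_{[\pi]}=(L,\circ_\pi,1_L,\Delta_L,\varepsilon_L,T_\pi)$. Define $\leftharpoonup:H\otimes L\to H$ by $$x\leftharpoonup a=S_H(\pi(x_1\rightharpoonup a_1))\,x_2\,\pi(a_2),\qquad\forall a\in L,\ x\in H.$$ Then $L_{[\pi]}$ is an ordinary Hopf algebra, and $(H,L_{[\pi]},\rightharpoonup,\leftharpoonup)$ is a matched pair of Hopf algebras such that $L_{[\pi]}\bowtie H$ is a double cross product with a projection $\theta=\mu_H(\pi\otimes\mathrm{id}_H)$ onto $H$; that is, $\theta:L_{[\pi]}\bowtie H\to H$, $a\otimes x\mapsto\pi(a)x$, is a Hopf algebra homomorphism with $\theta(1_L\otimes x)=x$ for all $x\in H$.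
   Context: Everything is over a fixed arbitrary field $\mathbf{k}$; Sweedler notation $\Delta(x)=x_1\otimes x_2$, $\Delta^{(2)}(x)=x_1\otimes x_2\otimes x_3$; $S_H$ is the antipode and $\mu_H$ the multiplication of $H$. A (left-left) Yetter-Drinfeld module over $H$ is a left $H$-module $(M,\cdot)$ that is also a left $H$-comodule with coaction $\rho(m)=m_{-1}\otimes m_0\in H\otimes M$, such that $\rho(x\cdot m)=x_1m_{-1}S_H(x_3)\otimes(x_2\cdot m_0)$. Morphisms are $H$-linear and $H$-colinear maps; ${}^H_H\mathcal{YD}$ is the resulting category. Tensor products carry $x\cdot(m\otimes n)=(x_1\cdot m)\otimes(x_2\cdot n)$ and $\rho(m\otimes n)=m_{-1}n_{-1}\otimes(m_0\otimes n_0)$; the (pre-)braiding is $c_{M,N}(m\otimes n)=(m_{-1}\cdot n)\otimes m_0$. A (braided) Hopf algebra $L$ in ${}^H_H\mathcal{YD}$ is an object that is a unital algebra and a counital coalgebra whose structure maps (product, unit, coproduct, counit, antipode) are morphisms in ${}^H_H\mathcal{YD}$, with $\varepsilon_L$ an algebra map, $\Delta_L(1)=1\otimes 1$, $\Delta_L(ab)=a_1((a_2)_{-1}\cdot b_1)\otimes(a_2)_0b_2$, and with antipode $S_L$ the convolution inverse of $\mathrm{id}_L$. Relative Rota-Baxter operator: let $H$ be a Hopf algebra, $L$ a Hopf algebra in ${}^H_H\mathcal{YD}$ with respect to an $H$-action $\rightharpoonup$ and the $H$-coaction $\mathrm{Coad}_\pi:L\to H\otimes L$, $a\mapsto\pi(a_1)S_H(\pi(a_3))\otimes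 a_2$, where $\pi:L\to H$ is a coalgebra homomorphism such that $\pi(a)\pi(b)=\pi(a_1(\pi(a_2)\rightharpoonup b))$ for all $a,b\in L$. Then $\pi$ is called a (Yetter-Drinfeld) relative Rota-Baxter operator on $H$ with respect to $(L,\rightharpoonup)$. A matched pair of Hopf algebras $(H,K,\rightharpoonup,\leftharpoonup)$ consists of Hopf algebras $H,K$, a left $H$-module coalgebra action $\rightharpoonup:H\otimes K\to K$ on $K$ and a right $K$-module coalgebra action $\leftharpoonup:H\otimes K\to H$ on $H$ (so both maps are module actions and coalgebra maps) such that for all $x,y\in H$, $a,b\in K$: $x\rightharpoonup ab=(x_1\rightharpoonup a_1)((x_2\leftharpoonup a_2)\rightharpoonup b)$; $x\rightharpoonup 1_K=\varepsilon_H(x)1_K$; $xy\leftharpoonup a=(x\leftharpoonup(y_1\rightharpoonup a_1))(y_2\leftharpoonup a_2)$; $1_H\leftharpoonup a=\varepsilon_K(a)1_H$; $(x_1\rightharpoonup a_1)\otimes(x_2\leftharpoonup a_2)=(x_2\rightharpoonup a_2)\otimes(x_1\leftharpoonup a_1)$. The double cross product $K\bowtie H$ is the Hopf algebra on $K\otimes H$ with product $(a\otimes x)(b\otimes y)=a(x_1\rightharpoonup b_1)\otimes(x_2\leftharpoonup b_2)y$, unit $1_K\otimes 1_H$, the tensor product coalgebra structure, and antipode $a\otimes x\mapsto (1\otimes S_H(x))(S_K(a)\otimes 1)$. *)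

theory Defs
  imports Complex_Main "HOL-Library.Function_Algebras"
begin

section \<open>Vector spaces and tensor products\<close>

text \<open>
  A vector space over the field \<open>'k\<close> is a subspace of a library vector space
  \<^locale>\<open>vector_space\<close>. Explicit carriers are needed because a tensor product is the span
  of the pure tensors inside a larger type; \<open>carrier V = UNIV\<close> is the case of a whole type.
  Structure maps are only meaningful on carriers.
\<close>

record ('k, 'v) vspace =
  carrier :: "'v set"
  scale :: "'k \<Rightarrow> 'v \<Rightarrow> 'v"

definition is_vspace :: "('k::field, 'v::ab_group_add, 'm) vspace_scheme \<Rightarrow> bool" where
  "is_vspace V \<longleftrightarrow> vector_space (scale V) \<and> module.subspace (scale V) (carrier V)"

definition field_space :: "('k::field, 'k) vspace" where
  "field_space = \<lparr>carrier = UNIV, scale = (*)\<rparr>"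

definition lin :: "('k::field, 'v::ab_group_add, 'm) vspace_scheme \<Rightarrow>
    ('k, 'w::ab_group_add, 'n) vspace_scheme \<Rightarrow> ('v \<Rightarrow> 'w) \<Rightarrow> bool" where
  "lin V W f \<longleftrightarrow>
     (\<forall>v\<in>carrier V. f v \<in> carrier W) \<and>
     (\<forall>v\<in>carrier V. \<forall>v'\<in>carrier V. f (v + v') = f v + f v') \<and>
     (\<forall>c. \<forall>v\<in>carrier V. f (scale V c v) = scale W c (f v))"

definition bilin :: "('k::field, 'v::ab_group_add, 'm) vspace_scheme \<Rightarrow>
    ('k, 'w::ab_group_add, 'n) vspace_scheme \<Rightarrow> ('k, 'u::ab_group_add, 'p) vspace_scheme \<Rightarrow>
    ('v \<Rightarrow> 'w \<Rightarrow> 'u) \<Rightarrow> bool" where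
  "bilin V W U f \<longleftrightarrow>
     (\<forall>v\<in>carrier V. lin W U (\<lambda>w. f v w)) \<and> (\<forall>w\<in>carrier W. lin V U (\<lambda>v. f v w))"

text \<open>
  Over a field, \<open>V \<otimes> W\<close> embeds canonically into the dual of the space of bilinear forms on
  \<open>V \<times> W\<close>, with \<open>v \<otimes> w\<close> acting as evaluation at \<open>(v, w)\<close>. We take this as the model of
  the tensor product: all finite sums of pure tensors. The universal property is proved below
  (\<open>tlift_sum\<close>, \<open>lin_tlift\<close>, \<open>tlift_tens\<close>, \<open>tlift_unique\<close>).
\<close>

type_synonym ('k, 'v, 'w) tensor = "('v \<Rightarrow> 'w \<Rightarrow> 'k) \<Rightarrow> 'k"

definition tens :: "('k::field, 'v::ab_group_add, 'm) vspace_scheme \<Rightarrow>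
    ('k, 'w::ab_group_add, 'n) vspace_scheme \<Rightarrow> 'v \<Rightarrow> 'w \<Rightarrow> ('k, 'v, 'w) tensor" where
  "tens V W v w = (\<lambda>B. if bilin V W field_space B then B v w else 0)"

definition tensor_space :: "('k::field, 'v::ab_group_add, 'm) vspace_scheme \<Rightarrow>
    ('k, 'w::ab_group_add, 'n) vspace_scheme \<Rightarrow> ('k, ('k, 'v, 'w) tensor) vspace" where
  "tensor_space V W =
     \<lparr>carrier = {\<Sum>(v, w)\<leftarrow>ps. tens V W v w | ps. set ps \<subseteq> carrier V \<times> carrier W},
      scale = (\<lambda>c t B. c * t B)\<rparr>"

text \<open>
  The linear map on \<open>V \<otimes> W\<close> induced by a bilinear map \<open>f\<close>. With \<open>t = \<Sum> v\<^sub>i \<otimes> w\<^sub>i\<close>,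
  \<open>tlift V W f t\<close> is \<open>\<Sum> f v\<^sub>i w\<^sub>i\<close>; it is meaningful only if \<open>f\<close> is bilinear on the carriers.
\<close>

definition tlift :: "('k::field, 'v::ab_group_add, 'm) vspace_scheme \<Rightarrow>
    ('k, 'w::ab_group_add, 'n) vspace_scheme \<Rightarrow> ('v \<Rightarrow> 'w \<Rightarrow> 'u::ab_group_add) \<Rightarrow>
    ('k, 'v, 'w) tensor \<Rightarrow> 'u" where
  "tlift V W f t = (THE u. \<exists>ps. set ps \<subseteq> carrier V \<times> carrier W \<and>
     t = (\<Sum>(v, w)\<leftarrow>ps. tens V W v w) \<and> u = (\<Sum>(v, w)\<leftarrow>ps. f v w))"

lemma lin_zero:
  assumes "is_vspace V" "lin V W f" shows "f 0 = 0"
proof -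
  interpret vector_space "scale V" using assms(1) by (simp add: is_vspace_def)
  have "0 \<in> carrier V" using assms(1) by (auto simp: is_vspace_def subspace_def)
  then have "f (0 + 0) = f 0 + f 0" using assms(2) unfolding lin_def by blast
  then show ?thesis by simp
qed

lemma is_vspace_sum:
  assumes "is_vspace V" "set vs \<subseteq> carrier V" shows "sum_list vs \<in> carrier V"
proof -
  interpret vector_space "scale V" using assms(1) by (simp add: is_vspace_def)
  have "subspace (carrier V)" using assms(1) by (simp add: is_vspace_def)
  then show ?thesis using assms(2) by (induction vs) (auto simp: subspace_def)
qed

lemma lin_sum_list:
  assumes "is_vspace V" "lin V W f" "set vs \<subseteq> carrier V"
  shows "f (sum_list vs) = (\<Sum>v\<leftarrow>vs. f v)"
  using assms(3)
proof (induction vs)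
  case Nil then show ?case using lin_zero[OF assms(1,2)] by simp
next
  case (Cons a vs)
  then have "f (a + sum_list vs) = f a + f (sum_list vs)"
    using assms(2) is_vspace_sum[OF assms(1), of vs] unfolding lin_def by auto
  then show ?case using Cons by simp
qed

lemma lin_separates:
  fixes V :: "('k::field, 'v::ab_group_add, 'm) vspace_scheme"
  assumes "is_vspace V" "v \<noteq> 0"
  shows "\<exists>\<phi>. lin V field_space \<phi> \<and> \<phi> v \<noteq> 0"
proof -
  interpret p: vector_space_pair "scale V" "(*) :: 'k \<Rightarrow> 'k \<Rightarrow> 'k"
    using assms(1) unfolding is_vspace_def vector_space_pair_def
    by (auto intro!: vector_space.intro simp: algebra_simps)
  have "p.vs1.independent {v}" using assms(2) by (simp add: p.vs1.independent_insert)
  from p.linear_independent_extend[OF this, of "\<lambda>_. 1"] obtain g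
    where g: "Vector_Spaces.linear (scale V) (*) g" "g v = 1" by auto
  then have "lin V field_space g"
    unfolding lin_def field_space_def by (auto simp: p.linear_add p.linear_scale)
  with g(2) show ?thesis by (intro exI[of _ g]) simp
qed

lemma bilin_compose:
  assumes "bilin V W U f" "lin U X \<phi>" shows "bilin V W X (\<lambda>v w. \<phi> (f v w))"
  using assms unfolding bilin_def lin_def by auto

lemma tens_sum_apply:
  "bilin V W field_space B \<Longrightarrow> (\<Sum>(v, w)\<leftarrow>ps. tens V W v w) B = (\<Sum>(v, w)\<leftarrow>ps. B v w)"
  by (induction ps) (auto simp: tens_def)

lemma bilin_sum_carrier:
  assumes "is_vspace U" "bilin V W U f" "set ps \<subseteq> carrier V \<times> carrier W"
  shows "(\<Sum>(v, w)\<leftarrow>ps. f v w) \<in> carrier U"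
  by (rule is_vspace_sum[OF assms(1)]) (use assms in \<open>fastforce simp: bilin_def lin_def\<close>)

lemma tlift_form:
  assumes U: "is_vspace U" and f: "bilin V W U f" and ps: "set ps \<subseteq> carrier V \<times> carrier W"
    and \<phi>: "lin U field_space \<phi>"
  shows "\<phi> (\<Sum>(v, w)\<leftarrow>ps. f v w) = (\<Sum>(v, w)\<leftarrow>ps. tens V W v w) (\<lambda>v w. \<phi> (f v w))"
proof -
  have "set (map (\<lambda>(v, w). f v w) ps) \<subseteq> carrier U"
    using f ps by (fastforce simp: bilin_def lin_def)
  from lin_sum_list[OF U \<phi> this]
  have "\<phi> (\<Sum>(v, w)\<leftarrow>ps. f v w) = (\<Sum>(v, w)\<leftarrow>ps. \<phi> (f v w))"
    by (simp add: comp_def case_prod_unfold)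
  then show ?thesis by (simp add: tens_sum_apply[OF bilin_compose[OF f \<phi>]])
qed

lemma tlift_sum:
  assumes U: "is_vspace U" and f: "bilin V W U f" and ps: "set ps \<subseteq> carrier V \<times> carrier W"
  shows "tlift V W f (\<Sum>(v, w)\<leftarrow>ps. tens V W v w) = (\<Sum>(v, w)\<leftarrow>ps. f v w)"
  unfolding tlift_def
proof (rule the_equality)
  fix u assume "\<exists>qs. set qs \<subseteq> carrier V \<times> carrier W \<and>
    (\<Sum>(v, w)\<leftarrow>ps. tens V W v w) = (\<Sum>(v, w)\<leftarrow>qs. tens V W v w) \<and> u = (\<Sum>(v, w)\<leftarrow>qs. f v w)"
  then obtain qs where qs: "set qs \<subseteq> carrier V \<times> carrier W"
    and eq: "(\<Sum>(v, w)\<leftarrow>ps. tens V W v w) = (\<Sum>(v, w)\<leftarrow>qs. tens V W v w)"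
    and u: "u = (\<Sum>(v, w)\<leftarrow>qs. f v w)" by blast
  let ?p = "\<Sum>(v, w)\<leftarrow>ps. f v w"
  interpret U: vector_space "scale U" using U by (simp add: is_vspace_def)
  have sub: "U.subspace (carrier U)" using U by (simp add: is_vspace_def)
  have p: "?p \<in> carrier U" and uU: "u \<in> carrier U"
    using bilin_sum_carrier[OF U f] ps qs u by auto
  show "u = ?p"
  proof (rule ccontr)
    assume "u \<noteq> ?p"
    then obtain \<phi> where \<phi>: "lin U field_space \<phi>" and nz: "\<phi> (u - ?p) \<noteq> 0"
      using lin_separates[OF U, of "u - ?p"] by auto
    have "\<phi> ((u - ?p) + ?p) = \<phi> (u - ?p) + \<phi> ?p"
      using \<phi> p U.subspace_diff[OF sub uU p] unfolding lin_def by blast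
    moreover have "\<phi> u = \<phi> ?p"
      unfolding u using tlift_form[OF U f qs \<phi>] tlift_form[OF U f ps \<phi>] eq by simp
    ultimately show False using nz by simp
  qed
qed (use ps in blast)

lemma tens_in_tensor_space [intro]:
  "v \<in> carrier V \<Longrightarrow> w \<in> carrier W \<Longrightarrow> tens V W v w \<in> carrier (tensor_space V W)"
  unfolding tensor_space_def by (auto intro!: exI[of _ "[(v, w)]"])

lemma scale_tens_sum:
  assumes ps: "set ps \<subseteq> carrier V \<times> carrier W"
  shows "(\<lambda>B. c * (\<Sum>(v, w)\<leftarrow>ps. tens V W v w) B) =
    (\<Sum>(v, w)\<leftarrow>map (\<lambda>(v, w). (scale V c v, w)) ps. tens V W v w)"
proof -
  have "tens V W (scale V c v) w B = c * tens V W v w B"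
    if "v \<in> carrier V" "w \<in> carrier W" for v w B
    using that by (auto simp: tens_def bilin_def lin_def field_space_def)
  then show ?thesis using ps
    by (induction ps) (fastforce simp: fun_eq_iff algebra_simps)+
qed

lemma scaled_pairs:
  assumes "is_vspace V" "set ps \<subseteq> carrier V \<times> carrier W"
  shows "set (map (\<lambda>(v, w). (scale V c v, w)) ps) \<subseteq> carrier V \<times> carrier W"
proof -
  interpret vector_space "scale V" using assms(1) by (simp add: is_vspace_def)
  have "subspace (carrier V)" using assms(1) by (simp add: is_vspace_def)
  then show ?thesis using assms(2) by (auto simp: subspace_def)
qed

lemma is_vspace_tensor_space:
  assumes "is_vspace V" shows "is_vspace (tensor_space V W)"
proof -
  let ?s = "scale (tensor_space V W)"
  interpret vector_space ?s
    by unfold_locales (auto simp: tensor_space_def fun_eq_iff algebra_simps)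
  have "subspace (carrier (tensor_space V W))"
    unfolding subspace_def
  proof (intro conjI ballI allI)
    show "0 \<in> carrier (tensor_space V W)"
      unfolding tensor_space_def by (auto intro!: exI[of _ "[]"])
  next
    fix s t assume "s \<in> carrier (tensor_space V W)" "t \<in> carrier (tensor_space V W)"
    then obtain ps qs where "set (ps @ qs) \<subseteq> carrier V \<times> carrier W"
      "s = (\<Sum>(v, w)\<leftarrow>ps. tens V W v w)" "t = (\<Sum>(v, w)\<leftarrow>qs. tens V W v w)"
      unfolding tensor_space_def by auto
    moreover from this have "s + t = (\<Sum>(v, w)\<leftarrow>ps @ qs. tens V W v w)" by simp
    ultimately show "s + t \<in> carrier (tensor_space V W)"
      unfolding tensor_space_def by (simp del: set_append map_append sum_list_append) blast
  next
    fix c t assume "t \<in> carrier (tensor_space V W)"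
    then obtain ps where ps: "set ps \<subseteq> carrier V \<times> carrier W"
      and t: "t = (\<Sum>(v, w)\<leftarrow>ps. tens V W v w)"
      unfolding tensor_space_def by auto
    have "?s c t = (\<Sum>(v, w)\<leftarrow>map (\<lambda>(v, w). (scale V c v, w)) ps. tens V W v w)"
      using scale_tens_sum[OF ps, of c] t by (simp add: tensor_space_def)
    with scaled_pairs[OF assms ps, of c] show "?s c t \<in> carrier (tensor_space V W)"
      unfolding tensor_space_def by (simp del: set_map map_map) blast
  qed
  then show ?thesis unfolding is_vspace_def using vector_space_axioms by simp
qed

lemma bilin_tens: "bilin V W (tensor_space V W) (tens V W)"
  unfolding bilin_def lin_def
  by (auto intro!: tens_in_tensor_space simp: fun_eq_iff)
    (auto simp: tens_def tensor_space_def bilin_def lin_def field_space_def)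

lemma tlift_tens:
  assumes "is_vspace U" "bilin V W U f" "v \<in> carrier V" "w \<in> carrier W"
  shows "tlift V W f (tens V W v w) = f v w"
  using tlift_sum[OF assms(1,2), of "[(v, w)]"] assms(3,4) by simp

lemma lin_tlift:
  assumes V: "is_vspace V" and U: "is_vspace U" and f: "bilin V W U f"
  shows "lin (tensor_space V W) U (tlift V W f)"
  unfolding lin_def
proof (intro conjI ballI allI)
  fix t assume "t \<in> carrier (tensor_space V W)"
  then show "tlift V W f t \<in> carrier U"
    unfolding tensor_space_def using tlift_sum[OF U f] bilin_sum_carrier[OF U f] by auto
next
  fix s t assume "s \<in> carrier (tensor_space V W)" "t \<in> carrier (tensor_space V W)"
  then obtain ps qs where ps: "set ps \<subseteq> carrier V \<times> carrier W" and qs: "set qs \<subseteq> carrier V \<times> carrier W"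
    and st: "s = (\<Sum>(v, w)\<leftarrow>ps. tens V W v w)" "t = (\<Sum>(v, w)\<leftarrow>qs. tens V W v w)"
    unfolding tensor_space_def by auto
  have "set (ps @ qs) \<subseteq> carrier V \<times> carrier W" using ps qs by simp
  from tlift_sum[OF U f this] show "tlift V W f (s + t) = tlift V W f s + tlift V W f t"
    unfolding st tlift_sum[OF U f ps] tlift_sum[OF U f qs] by simp
next
  fix c t assume "t \<in> carrier (tensor_space V W)"
  then obtain ps where ps: "set ps \<subseteq> carrier V \<times> carrier W"
    and t: "t = (\<Sum>(v, w)\<leftarrow>ps. tens V W v w)"
    unfolding tensor_space_def by auto
  interpret U: vector_space "scale U" using U by (simp add: is_vspace_def)
  have "tlift V W f (scale (tensor_space V W) c t) =
      (\<Sum>(v, w)\<leftarrow>map (\<lambda>(v, w). (scale V c v, w)) ps. f v w)"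
    using scale_tens_sum[OF ps, of c] t tlift_sum[OF U f scaled_pairs[OF V ps, of c]]
    by (simp add: tensor_space_def)
  also have "\<dots> = scale U c (\<Sum>(v, w)\<leftarrow>ps. f v w)"
    using ps f by (induction ps) (auto simp: U.scale_right_distrib bilin_def lin_def)
  finally show "tlift V W f (scale (tensor_space V W) c t) = scale U c (tlift V W f t)"
    unfolding t tlift_sum[OF U f ps] .
qed

lemma tlift_unique:
  assumes V: "is_vspace V" and U: "is_vspace U" and f: "bilin V W U f"
    and g: "lin (tensor_space V W) U g"
    and gf: "\<And>v w. v \<in> carrier V \<Longrightarrow> w \<in> carrier W \<Longrightarrow> g (tens V W v w) = f v w"
    and t: "t \<in> carrier (tensor_space V W)"
  shows "g t = tlift V W f t"
proof -
  obtain ps where ps: "set ps \<subseteq> carrier V \<times> carrier W"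
    and t: "t = (\<Sum>(v, w)\<leftarrow>ps. tens V W v w)"
    using t unfolding tensor_space_def by auto
  have "set (map (\<lambda>(v, w). tens V W v w) ps) \<subseteq> carrier (tensor_space V W)"
    using ps by auto
  from lin_sum_list[OF is_vspace_tensor_space[OF V] g this]
  have "g t = (\<Sum>(v, w)\<leftarrow>ps. g (tens V W v w))" by (simp add: t comp_def case_prod_unfold)
  also have "\<dots> = (\<Sum>(v, w)\<leftarrow>ps. f v w)"
    using ps gf by (intro arg_cong[where f = sum_list] map_cong) auto
  finally show ?thesis by (simp add: t tlift_sum[OF U f ps])
qed


section \<open>Hopf algebras\<close>

record ('k, 'v) coalg = "('k, 'v) vspace" +
  comult :: "'v \<Rightarrow> ('k, 'v, 'v) tensor"
  counit :: "'v \<Rightarrow> 'k"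

record ('k, 'v) halg = "('k, 'v) coalg" +
  mult :: "'v \<Rightarrow> 'v \<Rightarrow> 'v"
  one :: "'v"
  antipode :: "'v \<Rightarrow> 'v"

text \<open>
  Sweedler notation: \<open>sw C f c\<close> is \<open>f(c\<^sub>1, c\<^sub>2)\<close>, and \<open>sw3 C f c\<close> is \<open>f(c\<^sub>1, c\<^sub>2, c\<^sub>3)\<close>
  with respect to the iterated coproduct \<open>(\<Delta> \<otimes> id) \<Delta>\<close>.
\<close>

definition sw :: "('k::field, 'v::ab_group_add, 'm) coalg_scheme \<Rightarrow>
    ('v \<Rightarrow> 'v \<Rightarrow> 'u::ab_group_add) \<Rightarrow> 'v \<Rightarrow> 'u" where
  "sw C f c = tlift C C f (comult C c)"

definition sw3 :: "('k::field, 'v::ab_group_add, 'm) coalg_scheme \<Rightarrow>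
    ('v \<Rightarrow> 'v \<Rightarrow> 'v \<Rightarrow> 'u::ab_group_add) \<Rightarrow> 'v \<Rightarrow> 'u" where
  "sw3 C f c = sw C (\<lambda>d c3. sw C (\<lambda>c1 c2. f c1 c2 c3) d) c"

definition is_coalgebra :: "('k::field, 'v::ab_group_add, 'm) coalg_scheme \<Rightarrow> bool" where
  "is_coalgebra C \<longleftrightarrow>
     is_vspace C \<and>
     lin C (tensor_space C C) (comult C) \<and>
     lin C field_space (counit C) \<and>
     (\<forall>c\<in>carrier C.
        sw3 C (\<lambda>c1 c2 c3. tens C (tensor_space C C) c1 (tens C C c2 c3)) c
          = sw C (\<lambda>c1 c2. tens C (tensor_space C C) c1 (comult C c2)) c) \<and>
     (\<forall>c\<in>carrier C. sw C (\<lambda>c1 c2. scale C (counit C c1) c2) c = c) \<and>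
     (\<forall>c\<in>carrier C. sw C (\<lambda>c1 c2. scale C (counit C c2) c1) c = c)"

definition coalgebra_hom :: "('k::field, 'v::ab_group_add, 'm) coalg_scheme \<Rightarrow>
    ('k, 'w::ab_group_add, 'n) coalg_scheme \<Rightarrow> ('v \<Rightarrow> 'w) \<Rightarrow> bool" where
  "coalgebra_hom C D f \<longleftrightarrow>
     lin C D f \<and>
     (\<forall>c\<in>carrier C. comult D (f c) = sw C (\<lambda>c1 c2. tens D D (f c1) (f c2)) c) \<and>
     (\<forall>c\<in>carrier C. counit D (f c) = counit C c)"

definition tensor_coalgebra :: "('k::field, 'v::ab_group_add, 'm) coalg_scheme \<Rightarrow>
    ('k, 'w::ab_group_add, 'n) coalg_scheme \<Rightarrow> ('k, ('k, 'v, 'w) tensor) coalg" where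
  "tensor_coalgebra C D =
     \<lparr>carrier = carrier (tensor_space C D),
      scale = scale (tensor_space C D),
      comult = tlift C D (\<lambda>c d.
        sw C (\<lambda>c1 c2. sw D (\<lambda>d1 d2.
          tens (tensor_space C D) (tensor_space C D) (tens C D c1 d1) (tens C D c2 d2)) d) c),
      counit = tlift C D (\<lambda>c d. counit C c * counit D d)\<rparr>"

definition is_algebra :: "('k::field, 'v::ab_group_add, 'm) halg_scheme \<Rightarrow> bool" where
  "is_algebra A \<longleftrightarrow>
     is_vspace A \<and>
     bilin A A A (mult A) \<and>
     one A \<in> carrier A \<and>
     (\<forall>a\<in>carrier A. \<forall>b\<in>carrier A. \<forall>c\<in>carrier A.
        mult A (mult A a b) c = mult A a (mult A b c)) \<and>
     (\<forall>a\<in>carrier A. mult A (one A) a = a \<and> mult A a (one A) = a)"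

text \<open>The counit, as a map to the ground field, is an algebra map.\<close>

definition counit_alg_map :: "('k::field, 'v::ab_group_add, 'm) halg_scheme \<Rightarrow> bool" where
  "counit_alg_map A \<longleftrightarrow>
     counit A (one A) = 1 \<and>
     (\<forall>a\<in>carrier A. \<forall>b\<in>carrier A. counit A (mult A a b) = counit A a * counit A b)"

definition is_bialgebra :: "('k::field, 'v::ab_group_add, 'm) halg_scheme \<Rightarrow> bool" where
  "is_bialgebra A \<longleftrightarrow>
     is_algebra A \<and> is_coalgebra A \<and> counit_alg_map A \<and>
     comult A (one A) = tens A A (one A) (one A) \<and>
     (\<forall>a\<in>carrier A. \<forall>b\<in>carrier A.
        comult A (mult A a b) =
          sw A (\<lambda>a1 a2. sw A (\<lambda>b1 b2. tens A A (mult A a1 b1) (mult A a2 b2)) b) a)"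

definition antipode_law :: "('k::field, 'v::ab_group_add, 'm) halg_scheme \<Rightarrow> bool" where
  "antipode_law A \<longleftrightarrow>
     lin A A (antipode A) \<and>
     (\<forall>a\<in>carrier A. sw A (\<lambda>a1 a2. mult A (antipode A a1) a2) a = scale A (counit A a) (one A)) \<and>
     (\<forall>a\<in>carrier A. sw A (\<lambda>a1 a2. mult A a1 (antipode A a2)) a = scale A (counit A a) (one A))"

definition is_hopf_algebra :: "('k::field, 'v::ab_group_add, 'm) halg_scheme \<Rightarrow> bool" where
  "is_hopf_algebra A \<longleftrightarrow> is_bialgebra A \<and> antipode_law A"

definition hopf_hom :: "('k::field, 'v::ab_group_add, 'm) halg_scheme \<Rightarrow>
    ('k, 'w::ab_group_add, 'n) halg_scheme \<Rightarrow> ('v \<Rightarrow> 'w) \<Rightarrow> bool" where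
  "hopf_hom A B f \<longleftrightarrow>
     is_hopf_algebra A \<and> is_hopf_algebra B \<and>
     coalgebra_hom A B f \<and>
     f (one A) = one B \<and>
     (\<forall>a\<in>carrier A. \<forall>b\<in>carrier A. f (mult A a b) = mult B (f a) (f b)) \<and>
     (\<forall>a\<in>carrier A. f (antipode A a) = antipode B (f a))"


section \<open>Yetter-Drinfeld modules\<close>

definition left_module :: "('k::field, 'h::ab_group_add, 'm) halg_scheme \<Rightarrow>
    ('k, 'v::ab_group_add, 'n) vspace_scheme \<Rightarrow> ('h \<Rightarrow> 'v \<Rightarrow> 'v) \<Rightarrow> bool" where
  "left_module H V act \<longleftrightarrow>
     is_vspace V \<and> bilin H V V act \<and>
     (\<forall>v\<in>carrier V. act (one H) v = v) \<and>
     (\<forall>x\<in>carrier H. \<forall>y\<in>carrier H. \<forall>v\<in>carrier V. act (mult H x y) v = act x (act y v))"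

definition right_module :: "('k::field, 'h::ab_group_add, 'm) halg_scheme \<Rightarrow>
    ('k, 'v::ab_group_add, 'n) vspace_scheme \<Rightarrow> ('v \<Rightarrow> 'h \<Rightarrow> 'v) \<Rightarrow> bool" where
  "right_module H V act \<longleftrightarrow>
     is_vspace V \<and> bilin V H V act \<and>
     (\<forall>v\<in>carrier V. act v (one H) = v) \<and>
     (\<forall>x\<in>carrier H. \<forall>y\<in>carrier H. \<forall>v\<in>carrier V. act v (mult H x y) = act (act v x) y)"

definition left_comodule :: "('k::field, 'h::ab_group_add, 'm) coalg_scheme \<Rightarrow>
    ('k, 'v::ab_group_add, 'n) vspace_scheme \<Rightarrow> ('v \<Rightarrow> ('k, 'h, 'v) tensor) \<Rightarrow> bool" where
  "left_comodule H V \<rho> \<longleftrightarrow>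
     is_vspace V \<and> lin V (tensor_space H V) \<rho> \<and>
     (\<forall>v\<in>carrier V.
        tlift H V (\<lambda>h v0. sw H (\<lambda>h1 h2. tens H (tensor_space H V) h1 (tens H V h2 v0)) h) (\<rho> v)
          = tlift H V (\<lambda>h v0. tens H (tensor_space H V) h (\<rho> v0)) (\<rho> v)) \<and>
     (\<forall>v\<in>carrier V. tlift H V (\<lambda>h v0. scale V (counit H h) v0) (\<rho> v) = v)"

record ('k, 'h, 'v) yd = "('k, 'v) vspace" +
  act :: "'h \<Rightarrow> 'v \<Rightarrow> 'v"
  coact :: "'v \<Rightarrow> ('k, 'h, 'v) tensor"

definition is_yd :: "('k::field, 'h::ab_group_add, 'm) halg_scheme \<Rightarrow>
    ('k, 'h, 'v::ab_group_add) yd \<Rightarrow> bool" where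
  "is_yd H M \<longleftrightarrow>
     left_module H M (act M) \<and> left_comodule H M (coact M) \<and>
     (\<forall>x\<in>carrier H. \<forall>m\<in>carrier M.
        coact M (act M x m) =
          sw3 H (\<lambda>x1 x2 x3. tlift H M (\<lambda>m1 m0.
            tens H M (mult H (mult H x1 m1) (antipode H x3)) (act M x2 m0)) (coact M m)) x)"

definition yd_hom :: "('k::field, 'h::ab_group_add, 'm) halg_scheme \<Rightarrow>
    ('k, 'h, 'v::ab_group_add) yd \<Rightarrow> ('k, 'h, 'w::ab_group_add) yd \<Rightarrow> ('v \<Rightarrow> 'w) \<Rightarrow> bool" where
  "yd_hom H M N f \<longleftrightarrow>
     lin M N f \<and>
     (\<forall>x\<in>carrier H. \<forall>m\<in>carrier M. f (act M x m) = act N x (f m)) \<and>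
     (\<forall>m\<in>carrier M. coact N (f m) = tlift H M (\<lambda>m1 m0. tens H N m1 (f m0)) (coact M m))"

definition yd_tensor :: "('k::field, 'h::ab_group_add, 'm) halg_scheme \<Rightarrow>
    ('k, 'h, 'v::ab_group_add) yd \<Rightarrow> ('k, 'h, 'w::ab_group_add) yd \<Rightarrow>
    ('k, 'h, ('k, 'v, 'w) tensor) yd" where
  "yd_tensor H M N =
     \<lparr>carrier = carrier (tensor_space M N),
      scale = scale (tensor_space M N),
      act = (\<lambda>x. tlift M N (\<lambda>m n. sw H (\<lambda>x1 x2. tens M N (act M x1 m) (act N x2 n)) x)),
      coact = tlift M N (\<lambda>m n.
        tlift H M (\<lambda>m1 m0. tlift H N (\<lambda>n1 n0.
          tens H (tensor_space M N) (mult H m1 n1) (tens M N m0 n0)) (coact N n)) (coact M m))\<rparr>"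

text \<open>The unit object: the ground field with trivial action and coaction.\<close>

definition yd_unit :: "('k::field, 'h::ab_group_add, 'm) halg_scheme \<Rightarrow> ('k, 'h, 'k) yd" where
  "yd_unit H =
     \<lparr>carrier = carrier field_space,
      scale = scale field_space,
      act = (\<lambda>x c. counit H x * c),
      coact = (\<lambda>c. tens H field_space (one H) c)\<rparr>"

definition yd_of :: "('k, 'v, 'n) vspace_scheme \<Rightarrow> ('h \<Rightarrow> 'v \<Rightarrow> 'v) \<Rightarrow>
    ('v \<Rightarrow> ('k, 'h, 'v) tensor) \<Rightarrow> ('k, 'h, 'v) yd" where
  "yd_of V a \<rho> = \<lparr>carrier = carrier V, scale = scale V, act = a, coact = \<rho>\<rparr>"

text \<open>
  Hopf algebras in the category of Yetter-Drinfeld modules over \<open>H\<close>. The braided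
  multiplicativity of \<open>\<Delta>\<close> reads \<open>\<Delta>(ab) = a\<^sub>1((a\<^sub>2)\<^sub>-\<^sub>1 \<cdot> b\<^sub>1) \<otimes> (a\<^sub>2)\<^sub>0 b\<^sub>2\<close>.
\<close>

definition is_yd_hopf_algebra :: "('k::field, 'h::ab_group_add, 'm) halg_scheme \<Rightarrow>
    ('k, 'l::ab_group_add, 'n) halg_scheme \<Rightarrow> ('h \<Rightarrow> 'l \<Rightarrow> 'l) \<Rightarrow>
    ('l \<Rightarrow> ('k, 'h, 'l) tensor) \<Rightarrow> bool" where
  "is_yd_hopf_algebra H L a \<rho> \<longleftrightarrow>
     (let M = yd_of L a \<rho> in
       is_yd H M \<and> is_algebra L \<and> is_coalgebra L \<and>
       yd_hom H (yd_tensor H M M) M (tlift L L (mult L)) \<and>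
       yd_hom H (yd_unit H) M (\<lambda>c. scale L c (one L)) \<and>
       yd_hom H M (yd_tensor H M M) (comult L) \<and>
       yd_hom H M (yd_unit H) (counit L) \<and>
       yd_hom H M M (antipode L) \<and>
       counit_alg_map L \<and>
       comult L (one L) = tens L L (one L) (one L) \<and>
       (\<forall>p\<in>carrier L. \<forall>q\<in>carrier L.
          comult L (mult L p q) =
            sw L (\<lambda>p1 p2. sw L (\<lambda>q1 q2. tlift H L (\<lambda>h p20.
              tens L L (mult L p1 (a h q1)) (mult L p20 q2)) (\<rho> p2)) q) p) \<and>
       antipode_law L)"


section \<open>Relative Rota-Baxter operators\<close>

definition coad :: "('k::field, 'h::ab_group_add, 'm) halg_scheme \<Rightarrow>
    ('k, 'l::ab_group_add, 'n) halg_scheme \<Rightarrow> ('l \<Rightarrow> 'h) \<Rightarrow> 'l \<Rightarrow> ('k, 'h, 'l) tensor" where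
  "coad H L \<pi> =
     sw3 L (\<lambda>a1 a2 a3. tens H L (mult H (\<pi> a1) (antipode H (\<pi> a3))) a2)"

definition rb_mult :: "('k::field, 'l::ab_group_add, 'n) halg_scheme \<Rightarrow>
    ('h \<Rightarrow> 'l \<Rightarrow> 'l) \<Rightarrow> ('l \<Rightarrow> 'h) \<Rightarrow> 'l \<Rightarrow> 'l \<Rightarrow> 'l" where
  "rb_mult L la \<pi> a b = sw L (\<lambda>a1 a2. mult L a1 (la (\<pi> a2) b)) a"

definition relative_rota_baxter :: "('k::field, 'h::ab_group_add, 'm) halg_scheme \<Rightarrow>
    ('k, 'l::ab_group_add, 'n) halg_scheme \<Rightarrow> ('h \<Rightarrow> 'l \<Rightarrow> 'l) \<Rightarrow> ('l \<Rightarrow> 'h) \<Rightarrow> bool" where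
  "relative_rota_baxter H L la \<pi> \<longleftrightarrow>
     is_hopf_algebra H \<and>
     is_yd_hopf_algebra H L la (coad H L \<pi>) \<and>
     coalgebra_hom L H \<pi> \<and>
     (\<forall>a\<in>carrier L. \<forall>b\<in>carrier L.
        mult H (\<pi> a) (\<pi> b) = \<pi> (sw L (\<lambda>a1 a2. mult L a1 (la (\<pi> a2) b)) a))"

definition rb_antipode :: "('k::field, 'h::ab_group_add, 'm) halg_scheme \<Rightarrow>
    ('k, 'l::ab_group_add, 'n) halg_scheme \<Rightarrow> ('h \<Rightarrow> 'l \<Rightarrow> 'l) \<Rightarrow> ('l \<Rightarrow> 'h) \<Rightarrow> 'l \<Rightarrow> 'l" where
  "rb_antipode H L la \<pi> a = sw L (\<lambda>a1 a2. la (antipode H (\<pi> a1)) (antipode L a2)) a"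

definition rb_hopf :: "('k::field, 'h::ab_group_add, 'm) halg_scheme \<Rightarrow>
    ('k, 'l::ab_group_add, 'n) halg_scheme \<Rightarrow> ('h \<Rightarrow> 'l \<Rightarrow> 'l) \<Rightarrow> ('l \<Rightarrow> 'h) \<Rightarrow>
    ('k, 'l, 'n) halg_scheme" where
  "rb_hopf H L la \<pi> = L\<lparr>mult := rb_mult L la \<pi>, antipode := rb_antipode H L la \<pi>\<rparr>"

definition rb_ract :: "('k::field, 'h::ab_group_add, 'm) halg_scheme \<Rightarrow>
    ('k, 'l::ab_group_add, 'n) halg_scheme \<Rightarrow> ('h \<Rightarrow> 'l \<Rightarrow> 'l) \<Rightarrow> ('l \<Rightarrow> 'h) \<Rightarrow> 'h \<Rightarrow> 'l \<Rightarrow> 'h" where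
  "rb_ract H L la \<pi> x a =
     sw H (\<lambda>x1 x2. sw L (\<lambda>a1 a2.
       mult H (mult H (antipode H (\<pi> (la x1 a1))) x2) (\<pi> a2)) a) x"


section \<open>Matched pairs and double cross products\<close>

text \<open>\<open>la x a\<close> is \<open>x \<rightharpoonup> a\<close> and \<open>ra x a\<close> is \<open>x \<leftharpoonup> a\<close>.\<close>

definition matched_pair :: "('k::field, 'h::ab_group_add, 'm) halg_scheme \<Rightarrow>
    ('k, 'l::ab_group_add, 'n) halg_scheme \<Rightarrow> ('h \<Rightarrow> 'l \<Rightarrow> 'l) \<Rightarrow> ('h \<Rightarrow> 'l \<Rightarrow> 'h) \<Rightarrow> bool" where
  "matched_pair H K la ra \<longleftrightarrow>
     is_hopf_algebra H \<and> is_hopf_algebra K \<and>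
     left_module H K la \<and> coalgebra_hom (tensor_coalgebra H K) K (tlift H K la) \<and>
     right_module K H ra \<and> coalgebra_hom (tensor_coalgebra H K) H (tlift H K ra) \<and>
     (\<forall>x\<in>carrier H. \<forall>a\<in>carrier K. \<forall>b\<in>carrier K.
        la x (mult K a b) =
          sw H (\<lambda>x1 x2. sw K (\<lambda>a1 a2. mult K (la x1 a1) (la (ra x2 a2) b)) a) x) \<and>
     (\<forall>x\<in>carrier H. la x (one K) = scale K (counit H x) (one K)) \<and>
     (\<forall>x\<in>carrier H. \<forall>y\<in>carrier H. \<forall>a\<in>carrier K.
        ra (mult H x y) a =
          sw H (\<lambda>y1 y2. sw K (\<lambda>a1 a2. mult H (ra x (la y1 a1)) (ra y2 a2)) a) y) \<and>
     (\<forall>a\<in>carrier K. ra (one H) a = scale H (counit K a) (one H)) \<and>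
     (\<forall>x\<in>carrier H. \<forall>a\<in>carrier K.
        sw H (\<lambda>x1 x2. sw K (\<lambda>a1 a2. tens K H (la x1 a1) (ra x2 a2)) a) x =
        sw H (\<lambda>x1 x2. sw K (\<lambda>a1 a2. tens K H (la x2 a2) (ra x1 a1)) a) x)"

definition dcp_mult :: "('k::field, 'h::ab_group_add, 'm) halg_scheme \<Rightarrow>
    ('k, 'l::ab_group_add, 'n) halg_scheme \<Rightarrow> ('h \<Rightarrow> 'l \<Rightarrow> 'l) \<Rightarrow> ('h \<Rightarrow> 'l \<Rightarrow> 'h) \<Rightarrow>
    ('k, 'l, 'h) tensor \<Rightarrow> ('k, 'l, 'h) tensor \<Rightarrow> ('k, 'l, 'h) tensor" where
  "dcp_mult H K la ra s t =
     tlift K H (\<lambda>a x. tlift K H (\<lambda>b y.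
       sw H (\<lambda>x1 x2. sw K (\<lambda>b1 b2.
         tens K H (mult K a (la x1 b1)) (mult H (ra x2 b2) y)) b) x) t) s"

text \<open>The double cross product \<open>K \<bowtie> H\<close>, with underlying space \<open>K \<otimes> H\<close>.\<close>

definition double_cross_product :: "('k::field, 'h::ab_group_add, 'm) halg_scheme \<Rightarrow>
    ('k, 'l::ab_group_add, 'n) halg_scheme \<Rightarrow> ('h \<Rightarrow> 'l \<Rightarrow> 'l) \<Rightarrow> ('h \<Rightarrow> 'l \<Rightarrow> 'h) \<Rightarrow>
    ('k, ('k, 'l, 'h) tensor) halg" where
  "double_cross_product H K la ra =
     \<lparr>carrier = carrier (tensor_space K H),
      scale = scale (tensor_space K H),
      comult = comult (tensor_coalgebra K H),
      counit = counit (tensor_coalgebra K H),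
      mult = dcp_mult H K la ra,
      one = tens K H (one K) (one H),
      antipode = tlift K H (\<lambda>a x.
        dcp_mult H K la ra (tens K H (one K) (antipode H x)) (tens K H (antipode K a) (one H)))\<rparr>"

end

theory Submission
  imports Defs
begin

text \<open>
  Write \<open>X = H \<otimes> L\<close>, and let \<open>A, P, Q : X \<rightarrow> L, H, H\<close> be the coalgebra maps sending \<open>x \<otimes> a\<close> to
  \<open>x \<rightharpoonup> a\<close>, \<open>\<pi>(x \<rightharpoonup> a)\<close> and \<open>x \<pi>(a)\<close>. The right action is the convolution quotient
  \<open>R = P\<^sup>-\<^sup>1 * Q\<close>, that is, \<open>P * R = Q\<close>; most axioms of a matched pair follow from this factorisation.
  The Yetter-Drinfeld condition on \<open>x \<rightharpoonup> a\<close> says \<open>P * A * P\<^sup>-\<^sup>1 = Q * A * Q\<^sup>-\<^sup>1\<close> in the convolution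
  algebra \<open>Hom(X, H \<otimes> L)\<close>, so \<open>R\<close> and \<open>A\<close> commute under convolution. This is the compatibility
  axiom, and comparing \<open>\<Delta>P * \<Delta>R = \<Delta>Q\<close> with \<open>P\<^sub>1 * R\<^sub>1 * P\<^sub>2 * R\<^sub>2 = P\<^sub>1 * P\<^sub>2 * R\<^sub>1 * R\<^sub>2\<close> in
  \<open>Hom(X, H \<otimes> H)\<close> it also shows that \<open>R\<close> is a coalgebra map. The product \<open>\<circ>\<^sub>\<pi>\<close> is comultiplicative
  because the factor \<open>S(\<pi>(a\<^sub>4))\<close> of the coaction cancels against \<open>\<pi>(a\<^sub>5)\<close>.
\<close>

section \<open>Linear and multilinear maps\<close>

text \<open>The right action has no freedom: multiplicativity of \<theta> on the product of 1
  \<otimes> x and a \<otimes> 1 is the equation \<open>P * R = Q\<close>, and \<open>P\<close> is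
  convolution invertible as a coalgebra map into a Hopf algebra. There are two obstacles. As
  \<open>H\<close> need not be cocommutative, a convolution quotient of coalgebra maps is in general
  not a coalgebra map; the Yetter-Drinfeld condition repairs this. And \<open>L\<close> is not an
  ordinary bialgebra, its coproduct being multiplicative only up to the braiding; here it helps that
  the coaction is built from \<pi> itself. Most Sweedler identities are stated for arbitrary maps
  that are linear in each leg. This linearity is the side condition under which \<open>tlift\<close>
  is meaningful, and the simplifier rules on linearity and membership exist to discharge it. The
  double cross product is treated for an arbitrary matched pair, because its being a Hopf algebra is
  part of \<open>hopf_hom\<close>.\<close>

lemma is_vspace_add: "is_vspace V \<Longrightarrow> a \<in> carrier V \<Longrightarrow> b \<in> carrier V \<Longrightarrow> a + b \<in> carrier V"
  using module.subspace_add[of "scale V"] by (auto simp: is_vspace_def vector_space_def module_def module.subspace_def)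

lemma is_vspace_scale [simp]: "is_vspace V \<Longrightarrow> a \<in> carrier V \<Longrightarrow> scale V c a \<in> carrier V"
  by (auto simp: is_vspace_def vector_space_def module_def module.subspace_def)

lemma is_vspace_zero: "is_vspace V \<Longrightarrow> 0 \<in> carrier V"
  by (auto simp: is_vspace_def vector_space_def module_def module.subspace_def)

lemma vs_scale_scale: "is_vspace V \<Longrightarrow> scale V c (scale V d a) = scale V (c * d) a"
  by (simp add: is_vspace_def vector_space.vector_space_assms)

lemma vs_scale_one: "is_vspace V \<Longrightarrow> scale V 1 a = a"
  by (simp add: is_vspace_def vector_space.vector_space_assms)

lemma vs_scale_add_right: "is_vspace V \<Longrightarrow> scale V c (a + b) = scale V c a + scale V c b"
  by (simp add: is_vspace_def vector_space.vector_space_assms)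

lemma vs_scale_add_left: "is_vspace V \<Longrightarrow> scale V (c + d) a = scale V c a + scale V d a"
  by (simp add: is_vspace_def vector_space.vector_space_assms)

lemma is_vspace_tensor [simp]: "is_vspace V \<Longrightarrow> is_vspace (tensor_space V W)"
  by (rule is_vspace_tensor_space)

lemma is_vspace_field [simp]: "is_vspace (field_space :: ('k::field, 'k) vspace)"
proof -
  interpret vector_space "(*) :: 'k \<Rightarrow> 'k \<Rightarrow> 'k" by unfold_locales (auto simp: algebra_simps)
  show ?thesis unfolding is_vspace_def field_space_def
    using vector_space_axioms subspace_UNIV by simp
qed

lemma lin_mem: "lin V W f \<Longrightarrow> v \<in> carrier V \<Longrightarrow> f v \<in> carrier W"
  by (simp add: lin_def)

lemma lin_scale: "lin V W f \<Longrightarrow> v \<in> carrier V \<Longrightarrow> f (scale V c v) = scale W c (f v)"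
  by (simp add: lin_def)

lemma bilinI:
  "(\<And>w. w \<in> carrier W \<Longrightarrow> lin V U (\<lambda>v. f v w)) \<Longrightarrow>
   (\<And>v. v \<in> carrier V \<Longrightarrow> lin W U (\<lambda>w. f v w)) \<Longrightarrow> bilin V W U f"
  by (simp add: bilin_def)

lemma bilinD1: "bilin V W U f \<Longrightarrow> w \<in> carrier W \<Longrightarrow> lin V U (\<lambda>v. f v w)"
  by (simp add: bilin_def)

lemma bilinD2: "bilin V W U f \<Longrightarrow> v \<in> carrier V \<Longrightarrow> lin W U (\<lambda>w. f v w)"
  by (simp add: bilin_def)

lemma bilin_mem: "bilin V W U f \<Longrightarrow> v \<in> carrier V \<Longrightarrow> w \<in> carrier W \<Longrightarrow> f v w \<in> carrier U"
  by (simp add: bilin_def lin_def)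

lemma lin_comp: "lin V W g \<Longrightarrow> lin W U f \<Longrightarrow> lin V U (\<lambda>v. f (g v))"
  by (simp add: lin_def)

lemma lin_bilin1: "bilin A B U m \<Longrightarrow> lin V A g \<Longrightarrow> b \<in> carrier B \<Longrightarrow> lin V U (\<lambda>v. m (g v) b)"
  by (simp add: lin_def bilin_def)

lemma lin_bilin2: "bilin A B U m \<Longrightarrow> lin V B g \<Longrightarrow> a \<in> carrier A \<Longrightarrow> lin V U (\<lambda>v. m a (g v))"
  by (simp add: lin_def bilin_def)

lemma lin_cong:
  "(\<And>v. v \<in> carrier V \<Longrightarrow> f v = g v) \<Longrightarrow> is_vspace V \<Longrightarrow> lin V U f \<longleftrightarrow> lin V U g"
  by (auto simp: lin_def is_vspace_add is_vspace_scale)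

lemma lin_ident [simp]: "lin V V (\<lambda>v. v)"
  by (simp add: lin_def)

lemma lin_scaled [simp]:
  "is_vspace U \<Longrightarrow> lin V U f \<Longrightarrow> lin V U (\<lambda>v. scale U c (f v))"
  by (simp add: lin_def vs_scale_add_right vs_scale_scale mult.commute is_vspace_scale)

lemma lin_scalar [simp]:
  "is_vspace U \<Longrightarrow> lin V field_space f \<Longrightarrow> u \<in> carrier U \<Longrightarrow> lin V U (\<lambda>v. scale U (f v) u)"
  by (simp add: lin_def vs_scale_add_left vs_scale_scale is_vspace_scale field_space_def)

lemma lin_times1 [simp]:
  "lin V field_space f \<Longrightarrow> lin V field_space (\<lambda>v. f v * c)"
  by (simp add: lin_def field_space_def algebra_simps)

lemma lin_times2 [simp]:
  "lin V field_space f \<Longrightarrow> lin V field_space (\<lambda>v. c * f v)"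
  by (simp add: lin_def field_space_def algebra_simps)

lemma carrier_field [simp]: "c \<in> carrier field_space"
  by (simp add: field_space_def)

lemma scale_field [simp]: "scale field_space c d = c * d"
  by (simp add: field_space_def)

lemma tens_mem [simp]:
  "v \<in> carrier V \<Longrightarrow> w \<in> carrier W \<Longrightarrow> tens V W v w \<in> carrier (tensor_space V W)"
  by (rule tens_in_tensor_space)

lemma lin_tens1 [simp]:
  "lin U V g \<Longrightarrow> w \<in> carrier W \<Longrightarrow> lin U (tensor_space V W) (\<lambda>u. tens V W (g u) w)"
  by (rule lin_bilin1[OF bilin_tens])

lemma lin_tens2 [simp]:
  "lin U W g \<Longrightarrow> v \<in> carrier V \<Longrightarrow> lin U (tensor_space V W) (\<lambda>u. tens V W v (g u))"
  by (rule lin_bilin2[OF bilin_tens])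

lemma scale_tens1:
  "v \<in> carrier V \<Longrightarrow> w \<in> carrier W \<Longrightarrow>
   tens V W (scale V c v) w = scale (tensor_space V W) c (tens V W v w)"
  using lin_scale[OF bilinD1[OF bilin_tens]] by blast

lemma scale_tens2:
  "v \<in> carrier V \<Longrightarrow> w \<in> carrier W \<Longrightarrow>
   tens V W v (scale W c w) = scale (tensor_space V W) c (tens V W v w)"
  using lin_scale[OF bilinD2[OF bilin_tens]] by blast

lemma tensor_obtain:
  assumes "t \<in> carrier (tensor_space V W)"
  obtains ps where "set ps \<subseteq> carrier V \<times> carrier W" "t = (\<Sum>(v, w)\<leftarrow>ps. tens V W v w)"
  using assms unfolding tensor_space_def by auto

lemma tensor_ext:
  assumes "is_vspace V" "is_vspace U"
    "lin (tensor_space V W) U f" "lin (tensor_space V W) U g"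
    "\<And>v w. v \<in> carrier V \<Longrightarrow> w \<in> carrier W \<Longrightarrow> f (tens V W v w) = g (tens V W v w)"
    "t \<in> carrier (tensor_space V W)"
  shows "f t = g t"
proof -
  have b: "bilin V W U (\<lambda>v w. g (tens V W v w))"
    by (rule bilin_compose[OF bilin_tens assms(4)])
  show ?thesis
    using tlift_unique[OF assms(1,2) b assms(3,5,6)] tlift_unique[OF assms(1,2) b assms(4) _ assms(6)]
    by simp
qed

text \<open>No bilinearity is required: both definite descriptions range over lists of pairs from
  the carriers, where \<open>f\<close> and \<open>g\<close> agree, so they are the same description.
  Sweedler bodies can thus be rewritten before their linearity is known.\<close>

lemma tlift_cong:
  assumes "\<And>v w. v \<in> carrier V \<Longrightarrow> w \<in> carrier W \<Longrightarrow> f v w = g v w"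
  shows "tlift V W f t = tlift V W g t"
proof -
  have "(\<Sum>(v, w)\<leftarrow>ps. f v w) = (\<Sum>(v, w)\<leftarrow>ps. g v w)"
    if "set ps \<subseteq> carrier V \<times> carrier W" for ps
    using that assms by (intro arg_cong[where f = sum_list] map_cong) auto
  then show ?thesis unfolding tlift_def
    by (intro arg_cong[where f = The] ext ex_cong conj_cong) auto
qed

lemma tlift_mem:
  assumes "is_vspace V" "is_vspace U" "bilin V W U f" "t \<in> carrier (tensor_space V W)"
  shows "tlift V W f t \<in> carrier U"
  using lin_tlift[OF assms(1-3)] assms(4) by (rule lin_mem)

text \<open>A decomposition of \<open>t\<close> into pure tensors can be chosen once for all
  \<open>z\<close>; it turns the lift into a finite sum of maps that are linear in
  \<open>z\<close>.\<close>

lemma lin_tlift_param: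
  assumes V: "is_vspace V" and U: "is_vspace U"
    and f: "\<And>z. z \<in> carrier Z \<Longrightarrow> bilin V W U (f z)"
    and l: "\<And>v w. v \<in> carrier V \<Longrightarrow> w \<in> carrier W \<Longrightarrow> lin Z U (\<lambda>z. f z v w)"
    and Z: "is_vspace Z" and t: "t \<in> carrier (tensor_space V W)"
  shows "lin Z U (\<lambda>z. tlift V W (f z) t)"
proof -
  obtain ps where ps: "set ps \<subseteq> carrier V \<times> carrier W" and te: "t = (\<Sum>(v, w)\<leftarrow>ps. tens V W v w)"
    using t by (rule tensor_obtain)
  have e: "tlift V W (f z) t = (\<Sum>(v, w)\<leftarrow>ps. f z v w)" if "z \<in> carrier Z" for z
    unfolding te by (rule tlift_sum[OF U f[OF that] ps])
  have "lin Z U (\<lambda>z. \<Sum>(v, w)\<leftarrow>ps. f z v w)"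
    using ps
  proof (induction ps)
    case Nil
    have "scale U c 0 = 0" for c 
      using vs_scale_add_right[OF U, of c 0 0] by simp
    then show ?case by (simp add: lin_def is_vspace_zero[OF U])
  next
    case (Cons p ps)
    then show ?case using l[of "fst p" "snd p"]
      by (auto simp: lin_def is_vspace_add[OF U] vs_scale_add_right[OF U] algebra_simps)
  qed
  then show ?thesis  by (subst lin_cong[OF _ Z]) (simp_all add: e)
qed

section \<open>Sweedler notation\<close>

lemma coalg_vspace [simp]: "is_coalgebra C \<Longrightarrow> is_vspace C"
  unfolding is_coalgebra_def by blast

lemma alg_vspace [simp]: "is_algebra A \<Longrightarrow> is_vspace A"
  unfolding is_algebra_def by blast

lemma coalg_lin_comult: "is_coalgebra C \<Longrightarrow> lin C (tensor_space C C) (comult C)"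
  unfolding is_coalgebra_def by blast

lemma comult_mem: "is_coalgebra C \<Longrightarrow> c \<in> carrier C \<Longrightarrow> comult C c \<in> carrier (tensor_space C C)"
  unfolding is_coalgebra_def by (blast intro: lin_mem)

lemma mult_mem [simp]:
  "is_algebra A \<Longrightarrow> a \<in> carrier A \<Longrightarrow> b \<in> carrier A \<Longrightarrow> mult A a b \<in> carrier A"
  unfolding is_algebra_def by (blast intro: bilin_mem)

lemma one_mem [simp]: "is_algebra A \<Longrightarrow> one A \<in> carrier A"
  by (simp add: is_algebra_def)

lemma mult_one [simp]:
  "is_algebra A \<Longrightarrow> a \<in> carrier A \<Longrightarrow> mult A (one A) a = a"
  "is_algebra A \<Longrightarrow> a \<in> carrier A \<Longrightarrow> mult A a (one A) = a"
  by (auto simp only: is_algebra_def)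

lemma mult_assoc [simp]:
  "is_algebra A \<Longrightarrow> a \<in> carrier A \<Longrightarrow> b \<in> carrier A \<Longrightarrow> c \<in> carrier A \<Longrightarrow>
   mult A (mult A a b) c = mult A a (mult A b c)"
  by (auto simp only: is_algebra_def)

lemma bilin_mult: "is_algebra A \<Longrightarrow> bilin A A A (mult A)"
  by (auto simp only: is_algebra_def)

lemma lin_mult1 [simp]:
  "is_algebra A \<Longrightarrow> lin V A g \<Longrightarrow> b \<in> carrier A \<Longrightarrow> lin V A (\<lambda>v. mult A (g v) b)"
  by (rule lin_bilin1[OF bilin_mult])

lemma lin_mult2 [simp]:
  "is_algebra A \<Longrightarrow> lin V A g \<Longrightarrow> a \<in> carrier A \<Longrightarrow> lin V A (\<lambda>v. mult A a (g v))"
  by (rule lin_bilin2[OF bilin_mult])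

lemma mult_scale1 [simp]:
  "is_algebra A \<Longrightarrow> a \<in> carrier A \<Longrightarrow> b \<in> carrier A \<Longrightarrow>
    mult A (scale A c a) b = scale A c (mult A a b)"
  using lin_scale[OF bilinD1[OF bilin_mult]] by blast

lemma mult_scale2 [simp]:
  "is_algebra A \<Longrightarrow> a \<in> carrier A \<Longrightarrow> b \<in> carrier A \<Longrightarrow>
    mult A a (scale A c b) = scale A c (mult A a b)"
  using lin_scale[OF bilinD2[OF bilin_mult]] by blast

lemma lin_counit [simp]:
  "is_coalgebra C \<Longrightarrow> lin V C g \<Longrightarrow> lin V field_space (\<lambda>v. counit C (g v))"
  unfolding is_coalgebra_def by (blast intro: lin_comp)

lemma sw_cong:
  assumes "C = C'" "c = c'" "\<And>u v. u \<in> carrier C' \<Longrightarrow> v \<in> carrier C' \<Longrightarrow> f u v = g u v"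
  shows "sw C f c = sw C' g c'"
  unfolding sw_def using assms tlift_cong[of C' C' f g] by simp

text \<open>
  The simplifier does not normalise the assumptions introduced by a congruence rule; the premise
  \<open>carrier C' = S\<close> replaces the carrier of a tensor coalgebra by that of the tensor space.
\<close>

lemma sw_cong_simp [cong]:
  assumes "C = C'" "c = c'" "carrier C' = S" "\<And>u v. u \<in> S \<Longrightarrow> v \<in> S \<Longrightarrow> f u v = g u v"
  shows "sw C f c = sw C' g c'"
  using assms by (intro sw_cong) auto

lemma sw_mem [simp]:
  assumes "is_coalgebra C" "is_vspace U"
    "\<And>v. v \<in> carrier C \<Longrightarrow> lin C U (\<lambda>u. f u v)" "\<And>u. u \<in> carrier C \<Longrightarrow> lin C U (f u)"
    "c \<in> carrier C"
  shows "sw C f c \<in> carrier U"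
  unfolding sw_def
  by (rule tlift_mem) (auto intro!: bilinI simp: assms comult_mem coalg_vspace)

text \<open>A leg of an outer coproduct may occur in the argument of an inner one or in its body.
  This rule and \<open>lin_sw_body\<close> cover the two cases, so linearity of nested Sweedler sums
  can be left to the simplifier.\<close>

lemma lin_sw_arg [simp]:
  assumes "is_coalgebra C" "is_vspace U"
    "\<And>v. v \<in> carrier C \<Longrightarrow> lin C U (\<lambda>u. f u v)" "\<And>u. u \<in> carrier C \<Longrightarrow> lin C U (f u)"
    "lin V C g"
  shows "lin V U (\<lambda>z. sw C f (g z))"
  unfolding sw_def
proof (rule lin_comp[OF assms(5)], rule lin_comp[OF _ lin_tlift])
  show "lin C (tensor_space C C) (comult C)" using assms(1) by (rule coalg_lin_comult)
qed (auto intro!: bilinI simp: assms coalg_vspace)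

lemma lin_sw_body [simp]:
  assumes "is_coalgebra C" "is_vspace U" "is_vspace V"
    "\<And>z v. z \<in> carrier V \<Longrightarrow> v \<in> carrier C \<Longrightarrow> lin C U (\<lambda>u. F z u v)"
    "\<And>z u. z \<in> carrier V \<Longrightarrow> u \<in> carrier C \<Longrightarrow> lin C U (F z u)"
    "\<And>u v. u \<in> carrier C \<Longrightarrow> v \<in> carrier C \<Longrightarrow> lin V U (\<lambda>z. F z u v)"
    "c \<in> carrier C"
  shows "lin V U (\<lambda>z. sw C (F z) c)"
  unfolding sw_def
  by (rule lin_tlift_param) (auto intro!: bilinI simp: assms coalg_vspace comult_mem)

lemma sw_obtain:
  assumes "is_coalgebra C" "c \<in> carrier C"
  obtains ps where "set ps \<subseteq> carrier C \<times> carrier C" "comult C c = (\<Sum>(u, v)\<leftarrow>ps. tens C C u v)"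
  using comult_mem[OF assms] by (rule tensor_obtain)

lemma sw_sum:
  assumes "comult C c = (\<Sum>(u, v)\<leftarrow>ps. tens C C u v)" "set ps \<subseteq> carrier C \<times> carrier C"
    "is_vspace U"
    "\<And>v. v \<in> carrier C \<Longrightarrow> lin C U (\<lambda>u. f u v)" "\<And>u. u \<in> carrier C \<Longrightarrow> lin C U (f u)"
  shows "sw C f c = (\<Sum>(u, v)\<leftarrow>ps. f u v)"
  unfolding sw_def assms(1) by (rule tlift_sum[OF assms(3)]) (auto intro!: bilinI simp: assms)

lemma lin_sw:
  assumes C: "is_coalgebra C" and U: "is_vspace U"
    and f: "\<And>v. v \<in> carrier C \<Longrightarrow> lin C U (\<lambda>u. f u v)" "\<And>u. u \<in> carrier C \<Longrightarrow> lin C U (f u)"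
    and c: "c \<in> carrier C" and g: "lin U W g" and W: "is_vspace W"
  shows "g (sw C f c) = sw C (\<lambda>u v. g (f u v)) c"
proof -
  obtain ps where ps: "set ps \<subseteq> carrier C \<times> carrier C" "comult C c = (\<Sum>(u, v)\<leftarrow>ps. tens C C u v)"
    using C c by (rule sw_obtain)
  have m: "set (map (\<lambda>(u, v). f u v) ps) \<subseteq> carrier U"
    using ps(1) lin_mem[OF f(2)] by auto
  have "g (sw C f c) = g (\<Sum>(u, v)\<leftarrow>ps. f u v)" by (simp add: sw_sum[OF ps(2,1) U f])
  also have "\<dots> = (\<Sum>(u, v)\<leftarrow>ps. g (f u v))"
    using lin_sum_list[OF U g m] by (simp add: comp_def case_prod_unfold)
  also have "\<dots> = sw C (\<lambda>u v. g (f u v)) c"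
    by (rule sw_sum[OF ps(2,1) W, symmetric]) (auto intro!: lin_comp[OF _ g] f)
  finally show ?thesis .
qed

text \<open>Choosing finite lists of pure tensors for both coproducts reduces this to interchanging
  two finite sums. Multilinearity of \<open>f\<close> is what allows \<open>sw\<close> to be
  evaluated on a chosen list.\<close>

lemma sw_swap:
  assumes C: "is_coalgebra C" and D: "is_coalgebra D" and U: "is_vspace U"
    and c: "c \<in> carrier C" and d: "d \<in> carrier D"
    and f: "\<And>v p q. v \<in> carrier C \<Longrightarrow> p \<in> carrier D \<Longrightarrow> q \<in> carrier D \<Longrightarrow> lin C U (\<lambda>u. f u v p q)"
      "\<And>u p q. u \<in> carrier C \<Longrightarrow> p \<in> carrier D \<Longrightarrow> q \<in> carrier D \<Longrightarrow> lin C U (\<lambda>v. f u v p q)"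
      "\<And>u v q. u \<in> carrier C \<Longrightarrow> v \<in> carrier C \<Longrightarrow> q \<in> carrier D \<Longrightarrow> lin D U (\<lambda>p. f u v p q)"
      "\<And>u v p. u \<in> carrier C \<Longrightarrow> v \<in> carrier C \<Longrightarrow> p \<in> carrier D \<Longrightarrow> lin D U (f u v p)"
  shows "sw C (\<lambda>u v. sw D (\<lambda>p q. f u v p q) d) c = sw D (\<lambda>p q. sw C (\<lambda>u v. f u v p q) c) d"
proof -
  obtain ps where ps: "set ps \<subseteq> carrier C \<times> carrier C" "comult C c = (\<Sum>(u, v)\<leftarrow>ps. tens C C u v)"
    using C c by (rule sw_obtain)
  have 1: "sw C g c = (\<Sum>(u, v)\<leftarrow>ps. g u v)"
    if "\<And>v. v \<in> carrier C \<Longrightarrow> lin C U (\<lambda>u. g u v)" "\<And>u. u \<in> carrier C \<Longrightarrow> lin C U (g u)" for g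
    using ps that by (intro sw_sum[OF _ _ U]) auto
  have 2: "sw C (\<lambda>u v. sw D (\<lambda>p q. f u v p q) d) c = (\<Sum>(u, v)\<leftarrow>ps. sw D (\<lambda>p q. f u v p q) d)"
    by (rule 1) (auto intro!: lin_sw_body simp: assms coalg_vspace)
  obtain qs where qs: "set qs \<subseteq> carrier D \<times> carrier D" "comult D d = (\<Sum>(u, v)\<leftarrow>qs. tens D D u v)"
    using D d by (rule sw_obtain)
  have 3: "sw D g d = (\<Sum>(u, v)\<leftarrow>qs. g u v)"
    if "\<And>v. v \<in> carrier D \<Longrightarrow> lin D U (\<lambda>u. g u v)" "\<And>u. u \<in> carrier D \<Longrightarrow> lin D U (g u)" for g
    using qs that by (intro sw_sum[OF _ _ U]) auto
  have 4: "sw D (\<lambda>p q. sw C (\<lambda>u v. f u v p q) c) d = (\<Sum>(p, q)\<leftarrow>qs. sw C (\<lambda>u v. f u v p q) c)"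
    by (rule 3) (auto intro!: lin_sw_body simp: assms coalg_vspace)
  have 5: "(\<Sum>(u, v)\<leftarrow>ps. sw D (\<lambda>p q. f u v p q) d) = (\<Sum>(u, v)\<leftarrow>ps. \<Sum>(p, q)\<leftarrow>qs. f u v p q)"
    using ps(1) f by (intro arg_cong[where f = sum_list] map_cong) (auto intro!: 3)
  have 6: "(\<Sum>(p, q)\<leftarrow>qs. sw C (\<lambda>u v. f u v p q) c) = (\<Sum>(p, q)\<leftarrow>qs. \<Sum>(u, v)\<leftarrow>ps. f u v p q)"
    using qs(1) f by (intro arg_cong[where f = sum_list] map_cong) (auto intro!: 1)
  have 7: "(\<Sum>(u, v)\<leftarrow>ps. \<Sum>(p, q)\<leftarrow>qs. f u v p q) = (\<Sum>(p, q)\<leftarrow>qs. \<Sum>(u, v)\<leftarrow>ps. f u v p q)"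
  proof (induction ps)
    case (Cons a ps)
    then show ?case by (cases a) (simp add: case_prod_unfold sum_list_addf)
  qed (simp add: case_prod_unfold)
  show ?thesis unfolding 2 4 5 6 7 ..
qed

text \<open>\<open>is_coalgebra\<close> states coassociativity in C \<otimes> (C \<otimes> C), the
  universal case; the linear map \<open>g\<close> induced by the trilinear \<open>f\<close> carries
  it to any target.\<close>

lemma sw_coassoc:
  assumes C: "is_coalgebra C" and U: "is_vspace U" and c: "c \<in> carrier C"
    and f: "\<And>v w. v \<in> carrier C \<Longrightarrow> w \<in> carrier C \<Longrightarrow> lin C U (\<lambda>u. f u v w)"
      "\<And>u w. u \<in> carrier C \<Longrightarrow> w \<in> carrier C \<Longrightarrow> lin C U (\<lambda>v. f u v w)"
      "\<And>u v. u \<in> carrier C \<Longrightarrow> v \<in> carrier C \<Longrightarrow> lin C U (f u v)"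
  shows "sw C (\<lambda>d w. sw C (\<lambda>u v. f u v w) d) c = sw C (\<lambda>u d. sw C (f u) d) c"
proof -
  let ?T = "tensor_space C C" and ?TT = "tensor_space C (tensor_space C C)"
  define g where "g = tlift C ?T (\<lambda>u. tlift C C (f u))"
  have V: "is_vspace C" using C by (rule coalg_vspace)
  have lc: "lin C ?T (comult C)" using C by (rule coalg_lin_comult)
  have b: "bilin C C U (f u)" if "u \<in> carrier C" for u using that f by (auto intro!: bilinI)
  have b2: "bilin C ?T U (\<lambda>u. tlift C C (f u))"
    by (rule bilinI) (auto intro!: lin_tlift_param lin_tlift b f V U)
  have g: "lin ?TT U g" unfolding g_def by (rule lin_tlift[OF V U b2])
  have ge: "g (tens C ?T u t) = tlift C C (f u) t" if "u \<in> carrier C" "t \<in> carrier ?T" for u t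
    unfolding g_def by (rule tlift_tens[OF U b2 that])
  have ge2: "g (tens C ?T u (tens C C v w)) = f u v w"
    if "u \<in> carrier C" "v \<in> carrier C" "w \<in> carrier C" for u v w
    using that by (simp add: ge tlift_tens[OF U b])
  have "sw3 C (\<lambda>c1 c2 c3. tens C ?T c1 (tens C C c2 c3)) c = sw C (\<lambda>c1 c2. tens C ?T c1 (comult C c2)) c"
    using C c unfolding is_coalgebra_def by blast
  then have "g (sw3 C (\<lambda>c1 c2 c3. tens C ?T c1 (tens C C c2 c3)) c) =
     g (sw C (\<lambda>c1 c2. tens C ?T c1 (comult C c2)) c)" by simp
  moreover have "g (sw3 C (\<lambda>c1 c2 c3. tens C ?T c1 (tens C C c2 c3)) c) =
      sw C (\<lambda>d w. g (sw C (\<lambda>u v. tens C ?T u (tens C C v w)) d)) c"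
    unfolding sw3_def by (rule lin_sw[OF C _ _ _ c g U]) (auto simp: C V)
  moreover have "\<dots> = sw C (\<lambda>d w. sw C (\<lambda>u v. g (tens C ?T u (tens C C v w))) d) c"
    by (rule sw_cong, simp, simp, rule lin_sw[OF C _ _ _ _ g U]) (auto simp: C V)
  moreover have "\<dots> = sw C (\<lambda>d w. sw C (\<lambda>u v. f u v w) d) c"
    by (simp add: ge2)
  moreover have "g (sw C (\<lambda>c1 c2. tens C ?T c1 (comult C c2)) c) =
      sw C (\<lambda>u d. g (tens C ?T u (comult C d))) c"
    by (rule lin_sw[OF C _ _ _ c g U]) (auto simp: C V lc comult_mem)
  moreover have "\<dots> = sw C (\<lambda>u d. sw C (f u) d) c"
    by (simp add: ge comult_mem[OF C] sw_def)
  ultimately show ?thesis by simp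
qed

lemma sw_counit1:
  assumes C: "is_coalgebra C" and U: "is_vspace U" and c: "c \<in> carrier C" and f: "lin C U f"
  shows "sw C (\<lambda>u v. scale U (counit C u) (f v)) c = f c"
proof -
  have "f c = f (sw C (\<lambda>u v. scale C (counit C u) v) c)" using C c unfolding is_coalgebra_def by simp
  also have "\<dots> = sw C (\<lambda>u v. f (scale C (counit C u) v)) c"
    by (rule lin_sw[OF C _ _ _ c f U]) (auto simp: C coalg_vspace[OF C])
  also have "\<dots> = sw C (\<lambda>u v. scale U (counit C u) (f v)) c"
    by (simp add: lin_scale[OF f])
  finally show ?thesis ..
qed

lemma sw_counit2:
  assumes C: "is_coalgebra C" and U: "is_vspace U" and c: "c \<in> carrier C" and f: "lin C U f"
  shows "sw C (\<lambda>u v. scale U (counit C v) (f u)) c = f c"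
proof -
  have "f c = f (sw C (\<lambda>u v. scale C (counit C v) u) c)" using C c unfolding is_coalgebra_def by simp
  also have "\<dots> = sw C (\<lambda>u v. f (scale C (counit C v) u)) c"
    by (rule lin_sw[OF C _ _ _ c f U]) (auto simp: C coalg_vspace[OF C])
  also have "\<dots> = sw C (\<lambda>u v. scale U (counit C v) (f u)) c"
    by (simp add: lin_scale[OF f])
  finally show ?thesis ..
qed

lemma sw_coalgebra_hom:
  assumes h: "coalgebra_hom C D h" and C: "is_coalgebra C" and D: "is_coalgebra D"
    and U: "is_vspace U" and c: "c \<in> carrier C"
    and f: "\<And>v. v \<in> carrier D \<Longrightarrow> lin D U (\<lambda>u. f u v)" "\<And>u. u \<in> carrier D \<Longrightarrow> lin D U (f u)"
  shows "sw D f (h c) = sw C (\<lambda>u v. f (h u) (h v)) c"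
proof -
  have V: "is_vspace C" "is_vspace D" using C D by (simp_all add: coalg_vspace)
  have b: "bilin D D U f" by (auto intro!: bilinI f)
  have hl: "lin C D h" using h by (simp add: coalgebra_hom_def)
  have "sw D f (h c) = tlift D D f (sw C (\<lambda>u v. tens D D (h u) (h v)) c)"
    unfolding sw_def[of D] using h c by (simp add: coalgebra_hom_def)
  also have "\<dots> = sw C (\<lambda>u v. tlift D D f (tens D D (h u) (h v))) c"
    by (rule lin_sw[OF C _ _ _ c lin_tlift[OF V(2) U b] U]) (auto simp: V hl lin_mem[OF hl])
  also have "\<dots> = sw C (\<lambda>u v. f (h u) (h v)) c"
    by (simp add: tlift_tens[OF U b] lin_mem[OF hl])
  finally show ?thesis .
qed

section \<open>Tensor products of coalgebras\<close>

lemma tensor_coalgebra_sel [simp]: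
  "carrier (tensor_coalgebra C D) = carrier (tensor_space C D)"
  "scale (tensor_coalgebra C D) = scale (tensor_space C D)"
  by (simp_all add: tensor_coalgebra_def)

text \<open>\<open>lin\<close>, \<open>tens\<close>, \<open>tlift\<close> and
  \<open>tensor_space\<close> see a record only through its carrier and scalar multiplication. With
  this rule and the similar ones below, a tensor coalgebra, a tensor algebra or a modified Hopf
  algebra is replaced by its underlying space, even where the record types differ.\<close>

lemma lin_struct:
  assumes "carrier V = carrier V'" "scale V = scale V'"
  shows "lin V W = lin V' W" "lin U V = lin U V'"
  using assms by (simp_all add: fun_eq_iff lin_def)

lemma tens_struct:
  assumes "carrier V = carrier V'" "scale V = scale V'"
  shows "tens V W = tens V' W" "tens U V = tens U V'"
  using assms by (simp_all add: fun_eq_iff tens_def bilin_def lin_struct[OF assms])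

lemma tensor_space_struct:
  assumes "carrier V = carrier V'" "scale V = scale V'"
  shows "tensor_space V W = tensor_space V' W" "tensor_space U V = tensor_space U V'"
  using assms by (simp_all add: tensor_space_def tens_struct[OF assms])

lemma tlift_struct:
  assumes "carrier V = carrier V'" "scale V = scale V'"
  shows "tlift V W = tlift V' W" "tlift U V = tlift U V'"
  using assms by (simp_all add: fun_eq_iff tlift_def tens_struct[OF assms])

lemma is_vspace_struct:
  assumes "carrier V = carrier V'" "scale V = scale V'"
  shows "is_vspace V = is_vspace V'"
  using assms by (simp add: is_vspace_def)

lemmas struct = lin_struct tens_struct tensor_space_struct tlift_struct is_vspace_struct

lemmas tensor_coalgebra_struct [simp] = struct[OF tensor_coalgebra_sel]

text \<open>This is coassociativity of C \<otimes> D written with separate legs. An interchange of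
  the inner sums separates the legs of \<open>c\<close> from those of \<open>d\<close>;
  coassociativity then applies in \<open>D\<close> and in \<open>C\<close>, and a second interchange
  restores the order.\<close>

lemma sw2_coassoc:
  assumes C: "is_coalgebra C" and D: "is_coalgebra D" and U: "is_vspace U"
    and c: "c \<in> carrier C" and d: "d \<in> carrier D"
    and l: "\<And>d1 c2 d2 c3 d3. d1 \<in> carrier D \<Longrightarrow> c2 \<in> carrier C \<Longrightarrow> d2 \<in> carrier D \<Longrightarrow> c3 \<in> carrier C \<Longrightarrow> d3 \<in> carrier D \<Longrightarrow>
       lin C U (\<lambda>c1. G c1 d1 c2 d2 c3 d3)"
      "\<And>c1 c2 d2 c3 d3. c1 \<in> carrier C \<Longrightarrow> c2 \<in> carrier C \<Longrightarrow> d2 \<in> carrier D \<Longrightarrow> c3 \<in> carrier C \<Longrightarrow> d3 \<in> carrier D \<Longrightarrow>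
       lin D U (\<lambda>d1. G c1 d1 c2 d2 c3 d3)"
      "\<And>c1 d1 d2 c3 d3. c1 \<in> carrier C \<Longrightarrow> d1 \<in> carrier D \<Longrightarrow> d2 \<in> carrier D \<Longrightarrow> c3 \<in> carrier C \<Longrightarrow> d3 \<in> carrier D \<Longrightarrow>
       lin C U (\<lambda>c2. G c1 d1 c2 d2 c3 d3)"
      "\<And>c1 d1 c2 c3 d3. c1 \<in> carrier C \<Longrightarrow> d1 \<in> carrier D \<Longrightarrow> c2 \<in> carrier C \<Longrightarrow> c3 \<in> carrier C \<Longrightarrow> d3 \<in> carrier D \<Longrightarrow>
       lin D U (\<lambda>d2. G c1 d1 c2 d2 c3 d3)"
      "\<And>c1 d1 c2 d2 d3. c1 \<in> carrier C \<Longrightarrow> d1 \<in> carrier D \<Longrightarrow> c2 \<in> carrier C \<Longrightarrow> d2 \<in> carrier D \<Longrightarrow> d3 \<in> carrier D \<Longrightarrow>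
       lin C U (\<lambda>c3. G c1 d1 c2 d2 c3 d3)"
      "\<And>c1 d1 c2 d2 c3. c1 \<in> carrier C \<Longrightarrow> d1 \<in> carrier D \<Longrightarrow> c2 \<in> carrier C \<Longrightarrow> d2 \<in> carrier D \<Longrightarrow> c3 \<in> carrier C \<Longrightarrow>
       lin D U (\<lambda>d3. G c1 d1 c2 d2 c3 d3)"
  shows "sw C (\<lambda>c' c3. sw D (\<lambda>d' d3. sw C (\<lambda>c1 c2. sw D (\<lambda>d1 d2. G c1 d1 c2 d2 c3 d3) d') c') d) c =
    sw C (\<lambda>c1 c'. sw D (\<lambda>d1 d'. sw C (\<lambda>c2 c3. sw D (\<lambda>d2 d3. G c1 d1 c2 d2 c3 d3) d') c') d) c"
    (is "?l = ?r")
proof -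
  note [simp] = C D U l
  have "?l = sw C (\<lambda>c' c3. sw C (\<lambda>c1 c2. sw D (\<lambda>d' d3. sw D (\<lambda>d1 d2. G c1 d1 c2 d2 c3 d3) d') d) c') c"
    by (rule sw_cong, simp, simp, rule sw_swap[OF D C U]) (simp_all add: d)
  also have "\<dots> = sw C (\<lambda>c' c3. sw C (\<lambda>c1 c2. sw D (\<lambda>d1 d'. sw D (\<lambda>d2 d3. G c1 d1 c2 d2 c3 d3) d') d) c') c"
    by (rule sw_cong, simp, simp, rule sw_cong, simp, simp, rule sw_coassoc[OF D U d]) (simp_all add: d)
  also have "\<dots> = sw C (\<lambda>c1 c'. sw C (\<lambda>c2 c3. sw D (\<lambda>d1 d'. sw D (\<lambda>d2 d3. G c1 d1 c2 d2 c3 d3) d') d) c') c"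
    by (rule sw_coassoc[OF C U c]) (simp_all add: d)
  also have "\<dots> = ?r"
    by (rule sw_cong, simp, simp, rule sw_swap[OF C D U]) (simp_all add: d)
  finally show ?thesis .
qed

lemma tensor_comult_tens:
  assumes C: "is_coalgebra C" and D: "is_coalgebra D" and c: "c \<in> carrier C" and d: "d \<in> carrier D"
  defines "T \<equiv> tensor_space C D"
  shows "comult (tensor_coalgebra C D) (tens C D c d) =
    sw C (\<lambda>c1 c2. sw D (\<lambda>d1 d2. tens T T (tens C D c1 d1) (tens C D c2 d2)) d) c"
  unfolding tensor_coalgebra_def T_def
  by (simp, rule tlift_tens[of "tensor_space (tensor_space C D) (tensor_space C D)"])
     (auto intro!: bilinI simp: C D c d)

lemma lin_tensor_comult:
  assumes C: "is_coalgebra C" and D: "is_coalgebra D"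
  defines "T \<equiv> tensor_space C D"
  shows "lin T (tensor_space T T) (comult (tensor_coalgebra C D))"
  unfolding tensor_coalgebra_def T_def
  by (simp, rule lin_tlift) (auto intro!: bilinI simp: C D)

lemma tensor_counit_tens [simp]:
  assumes "is_coalgebra C" "is_coalgebra D" "c \<in> carrier C" "d \<in> carrier D"
  shows "counit (tensor_coalgebra C D) (tens C D c d) = counit C c * counit D d"
  unfolding tensor_coalgebra_def
  by (simp, rule tlift_tens[of field_space]) (auto intro!: bilinI simp: assms)

lemma lin_tensor_counit:
  assumes "is_coalgebra C" "is_coalgebra D"
  shows "lin (tensor_space C D) field_space (counit (tensor_coalgebra C D))"
  unfolding tensor_coalgebra_def
  by (simp, rule lin_tlift) (auto intro!: bilinI simp: assms)

lemma sw_tensor: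
  assumes C: "is_coalgebra C" and D: "is_coalgebra D" and U: "is_vspace U"
    and c: "c \<in> carrier C" and d: "d \<in> carrier D"
    and f: "\<And>v. v \<in> carrier (tensor_space C D) \<Longrightarrow> lin (tensor_space C D) U (\<lambda>u. f u v)"
      "\<And>u. u \<in> carrier (tensor_space C D) \<Longrightarrow> lin (tensor_space C D) U (f u)"
  shows "sw (tensor_coalgebra C D) f (tens C D c d) =
    sw C (\<lambda>c1 c2. sw D (\<lambda>d1 d2. f (tens C D c1 d1) (tens C D c2 d2)) d) c"
proof -
  let ?T = "tensor_space C D"
  have b: "bilin ?T ?T U f" by (auto intro!: bilinI f)
  have l: "lin (tensor_space ?T ?T) U (tlift ?T ?T f)" by (rule lin_tlift) (auto simp: b C U)
  have "sw (tensor_coalgebra C D) f (tens C D c d) = tlift ?T ?T f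
    (sw C (\<lambda>c1 c2. sw D (\<lambda>d1 d2. tens ?T ?T (tens C D c1 d1) (tens C D c2 d2)) d) c)"
    by (simp add: sw_def[of "tensor_coalgebra C D"] tensor_comult_tens[OF C D c d])
  also have "\<dots> = sw C (\<lambda>c1 c2. tlift ?T ?T f (sw D (\<lambda>d1 d2. tens ?T ?T (tens C D c1 d1) (tens C D c2 d2)) d)) c"
    by (rule lin_sw[OF C _ _ _ c l U]) (auto simp: C D d)
  also have "\<dots> = sw C (\<lambda>c1 c2. sw D (\<lambda>d1 d2. tlift ?T ?T f (tens ?T ?T (tens C D c1 d1) (tens C D c2 d2))) d) c"
    by (rule sw_cong, simp, simp, rule lin_sw[OF D _ _ _ d l U]) (auto simp: C D d)
  also have "\<dots> = sw C (\<lambda>c1 c2. sw D (\<lambda>d1 d2. f (tens C D c1 d1) (tens C D c2 d2)) d) c"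
    by (simp add: tlift_tens[OF U b])
  finally show ?thesis .
qed

lemma is_coalgebra_tensor [simp]:
  assumes C: "is_coalgebra C" and D: "is_coalgebra D"
  shows "is_coalgebra (tensor_coalgebra C D)"
proof -
  let ?X = "tensor_coalgebra C D" and ?T = "tensor_space C D"
  let ?TT = "tensor_space ?T (tensor_space ?T ?T)"
  note [simp] = C D
  have V: "is_vspace ?T" by simp
  have lc: "lin ?T (tensor_space ?T ?T) (comult ?X)" by (rule lin_tensor_comult[OF C D])
  \<comment> \<open>The general linearity rules for \<open>sw\<close> presuppose a coalgebra, which
    \<open>?X\<close> is only about to become; here they are derived from linearity of its
    coproduct.\<close>
  have lsw: "lin ?T U (sw ?X f)" if U: "is_vspace U"
    and f: "\<And>v. v \<in> carrier ?T \<Longrightarrow> lin ?T U (\<lambda>u. f u v)" "\<And>u. u \<in> carrier ?T \<Longrightarrow> lin ?T U (f u)"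
    for U :: "('a, 'z::ab_group_add) vspace" and f
    unfolding sw_def tensor_coalgebra_struct
    by (rule lin_comp[OF lc lin_tlift]) (auto intro!: bilinI simp: U f)
  have lsb: "lin ?T U (\<lambda>z. sw ?X (F z) c)"
    if U: "is_vspace U" and c: "c \<in> carrier ?T"
    and f: "\<And>z v. z \<in> carrier ?T \<Longrightarrow> v \<in> carrier ?T \<Longrightarrow> lin ?T U (\<lambda>u. F z u v)"
    "\<And>z u. z \<in> carrier ?T \<Longrightarrow> u \<in> carrier ?T \<Longrightarrow> lin ?T U (F z u)"
    "\<And>u v. u \<in> carrier ?T \<Longrightarrow> v \<in> carrier ?T \<Longrightarrow> lin ?T U (\<lambda>z. F z u v)"
    for U :: "('a, 'z::ab_group_add) vspace" and F c
    unfolding sw_def tensor_coalgebra_struct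
    by (rule lin_tlift_param) (auto intro!: bilinI lin_mem[OF lc] simp: U f c)
  have 1: "sw3 ?X (\<lambda>c1 c2 c3. tens ?X (tensor_space ?X ?X) c1 (tens ?X ?X c2 c3)) t
          = sw ?X (\<lambda>c1 c2. tens ?X (tensor_space ?X ?X) c1 (comult ?X c2)) t" if t: "t \<in> carrier ?T" for t
    unfolding tensor_coalgebra_struct sw3_def
  proof (rule tensor_ext[where t = t and U = ?TT and V = C and W = D
      and f = "sw ?X (\<lambda>d c3. sw ?X (\<lambda>c1 c2. tens ?T (tensor_space ?T ?T) c1 (tens ?T ?T c2 c3)) d)"
      and g = "sw ?X (\<lambda>c1 c2. tens ?T (tensor_space ?T ?T) c1 (comult ?X c2))"])
    show "lin ?T ?TT (sw ?X (\<lambda>d c3. sw ?X (\<lambda>c1 c2. tens ?T (tensor_space ?T ?T) c1 (tens ?T ?T c2 c3)) d))"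
      by (intro lsw lsb) auto
    show "lin ?T ?TT (sw ?X (\<lambda>c1 c2. tens ?T (tensor_space ?T ?T) c1 (comult ?X c2)))"
      by (intro lsw) (auto simp: lc lin_mem[OF lc])
    fix c d assume c: "c \<in> carrier C" and d: "d \<in> carrier D"
    note [simp] = c d
    have "sw ?X (\<lambda>d c3. sw ?X (\<lambda>c1 c2. tens ?T (tensor_space ?T ?T) c1 (tens ?T ?T c2 c3)) d) (tens C D c d)
      = sw C (\<lambda>c' c3. sw D (\<lambda>d' d3. sw ?X (\<lambda>c1 c2. tens ?T (tensor_space ?T ?T) c1 (tens ?T ?T c2 (tens C D c3 d3))) (tens C D c' d')) d) c"
      by (rule sw_tensor[OF C D _ c d, of ?TT]) (auto intro!: lsw lsb)
    also have "\<dots> = sw C (\<lambda>c' c3. sw D (\<lambda>d' d3. sw C (\<lambda>c1 c2. sw D (\<lambda>d1 d2.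
       tens ?T (tensor_space ?T ?T) (tens C D c1 d1) (tens ?T ?T (tens C D c2 d2) (tens C D c3 d3))) d') c') d) c"
      by (simp add: sw_tensor[of C D ?TT])
    also have "\<dots> = sw C (\<lambda>c1 c'. sw D (\<lambda>d1 d'. sw C (\<lambda>c2 c3. sw D (\<lambda>d2 d3.
       tens ?T (tensor_space ?T ?T) (tens C D c1 d1) (tens ?T ?T (tens C D c2 d2) (tens C D c3 d3))) d') c') d) c"
      by (rule sw2_coassoc[of C D ?TT]) auto
    also have "\<dots> = sw C (\<lambda>c1 c'. sw D (\<lambda>d1 d'. tens ?T (tensor_space ?T ?T) (tens C D c1 d1) 
        (comult ?X (tens C D c' d'))) d) c"
      by (simp add: tensor_comult_tens
        lin_sw[of C "tensor_space ?T ?T" _ _ ?TT "tens ?T (tensor_space ?T ?T) a" for a]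
        lin_sw[of D "tensor_space ?T ?T" _ _ ?TT "tens ?T (tensor_space ?T ?T) a" for a])
    also have "\<dots> = sw ?X (\<lambda>c1 c2. tens ?T (tensor_space ?T ?T) c1 (comult ?X c2)) (tens C D c d)"
      by (rule sw_tensor[OF C D _ c d, of ?TT, symmetric]) (auto simp: lc lin_mem[OF lc])
    finally show "sw ?X (\<lambda>d c3. sw ?X (\<lambda>c1 c2. tens ?T (tensor_space ?T ?T) c1 (tens ?T ?T c2 c3)) d) (tens C D c d)
      = sw ?X (\<lambda>c1 c2. tens ?T (tensor_space ?T ?T) c1 (comult ?X c2)) (tens C D c d)" .
  qed (use t in simp_all)
  have lcu: "lin ?T field_space (counit ?X)" by (rule lin_tensor_counit[OF C D])
  have 2: "sw ?X (\<lambda>c1 c2. scale ?T (counit ?X c1) c2) t = t" if t: "t \<in> carrier ?T" for t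
  proof (rule tensor_ext[where t = t and U = ?T and V = C and W = D and f = "sw ?X (\<lambda>c1 c2. scale ?T (counit ?X c1) c2)" and g = "\<lambda>t. t"])
    show "lin ?T ?T (sw ?X (\<lambda>c1 c2. scale ?T (counit ?X c1) c2))"
      by (intro lsw) (auto simp: lcu)
    fix c d assume c: "c \<in> carrier C" and d: "d \<in> carrier D"
    have "sw ?X (\<lambda>c1 c2. scale ?T (counit ?X c1) c2) (tens C D c d) =
      sw C (\<lambda>c1 c2. sw D (\<lambda>d1 d2. scale ?T (counit ?X (tens C D c1 d1)) (tens C D c2 d2)) d) c"
      by (rule sw_tensor[OF C D _ c d, of ?T]) (auto simp: lcu)
    \<comment> \<open>Writing the product of two counits as nested scalars lets the counit law act
      in \<open>D\<close> and then in \<open>C\<close>.\<close>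
    also have "\<dots> = sw C (\<lambda>c1 c2. sw D (\<lambda>d1 d2. scale ?T (counit D d1) (scale ?T (counit C c1) (tens C D c2 d2))) d) c"
      by (simp add: vs_scale_scale mult.commute)
    also have "\<dots> = tens C D c d"
      by (simp add: sw_counit1[of D ?T] sw_counit1[of C ?T] c d)
    finally show "sw ?X (\<lambda>c1 c2. scale ?T (counit ?X c1) c2) (tens C D c d) = tens C D c d" .
  qed (use t in simp_all)
  have 3: "sw ?X (\<lambda>c1 c2. scale ?T (counit ?X c2) c1) t = t" if t: "t \<in> carrier ?T" for t
  proof (rule tensor_ext[where t = t and U = ?T and V = C and W = D and f = "sw ?X (\<lambda>c1 c2. scale ?T (counit ?X c2) c1)" and g = "\<lambda>t. t"])
    show "lin ?T ?T (sw ?X (\<lambda>c1 c2. scale ?T (counit ?X c2) c1))"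
      by (intro lsw) (auto simp: lcu)
    fix c d assume c: "c \<in> carrier C" and d: "d \<in> carrier D"
    have "sw ?X (\<lambda>c1 c2. scale ?T (counit ?X c2) c1) (tens C D c d) =
      sw C (\<lambda>c1 c2. sw D (\<lambda>d1 d2. scale ?T (counit ?X (tens C D c2 d2)) (tens C D c1 d1)) d) c"
      by (rule sw_tensor[OF C D _ c d, of ?T]) (auto simp: lcu)
    also have "\<dots> = sw C (\<lambda>c1 c2. sw D (\<lambda>d1 d2. scale ?T (counit D d2) (scale ?T (counit C c2) (tens C D c1 d1))) d) c"
      by (simp add: vs_scale_scale mult.commute)
    also have "\<dots> = tens C D c d"
      by (simp add: sw_counit2[of D ?T] sw_counit2[of C ?T] c d)
    finally show "sw ?X (\<lambda>c1 c2. scale ?T (counit ?X c2) c1) (tens C D c d) = tens C D c d" .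
  qed (use t in simp_all)
  show ?thesis
    unfolding is_coalgebra_def using lc lcu 1 2 3 by simp
qed

text \<open>
  Instances whose premises already mention the carrier of the tensor space, since premises of
  conditional rewrite rules are not normalised when they become assumptions.
\<close>

lemmas tensor_sw [simp] =
  sw_mem[of "tensor_coalgebra C D" for C D, simplified tensor_coalgebra_sel tensor_coalgebra_struct]
  lin_sw_arg[of "tensor_coalgebra C D" for C D, simplified tensor_coalgebra_sel tensor_coalgebra_struct]
  lin_sw_body[of "tensor_coalgebra C D" for C D, simplified tensor_coalgebra_sel tensor_coalgebra_struct]

section \<open>Convolution and Hopf algebras\<close>

lemma coalgebra_hom_lin: "coalgebra_hom C D f \<Longrightarrow> lin C D f"
  by (simp add: coalgebra_hom_def)

lemma coalgebra_hom_tlift: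
  assumes C: "is_coalgebra C" and D: "is_coalgebra D" and E: "is_coalgebra E"
    and b: "bilin C D E f"
    and m: "\<And>c d. c \<in> carrier C \<Longrightarrow> d \<in> carrier D \<Longrightarrow>
      comult E (f c d) = sw C (\<lambda>c1 c2. sw D (\<lambda>d1 d2. tens E E (f c1 d1) (f c2 d2)) d) c"
    and n: "\<And>c d. c \<in> carrier C \<Longrightarrow> d \<in> carrier D \<Longrightarrow> counit E (f c d) = counit C c * counit D d"
  shows "coalgebra_hom (tensor_coalgebra C D) E (tlift C D f)"
proof -
  let ?X = "tensor_coalgebra C D" and ?T = "tensor_space C D" and ?F = "tlift C D f"
  note [simp] = C D E
  have l: "lin ?T E ?F" by (rule lin_tlift[OF _ _ b]) auto
  note le [simp] = lin_comp[OF _ l]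
  have e [simp]: "?F (tens C D c d) = f c d" if "c \<in> carrier C" "d \<in> carrier D" for c d
    using that by (intro tlift_tens[OF _ b]) auto
  have lc: "lin E (tensor_space E E) (comult E)" by (rule coalg_lin_comult[OF E])
  have [simp]: "?F u \<in> carrier E" if "u \<in> carrier ?T" for u using lin_mem[OF l that] .
  have 1: "comult E (?F t) = sw ?X (\<lambda>u v. tens E E (?F u) (?F v)) t" if t: "t \<in> carrier ?T" for t
  proof (rule tensor_ext[where V = C and W = D and f = "\<lambda>t. comult E (?F t)" and U = "tensor_space E E"
        and g = "sw ?X (\<lambda>u v. tens E E (?F u) (?F v))"])
    show "lin ?T (tensor_space E E) (\<lambda>t. comult E (?F t))" by (rule lin_comp[OF l lc])
    show "lin ?T (tensor_space E E) (sw ?X (\<lambda>u v. tens E E (?F u) (?F v)))"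
      using l by simp
    fix c d assume c: "c \<in> carrier C" and d: "d \<in> carrier D"
    show "comult E (?F (tens C D c d)) = sw ?X (\<lambda>u v. tens E E (?F u) (?F v)) (tens C D c d)"
      using c d l by (simp add: m sw_tensor[of C D "tensor_space E E"])
  qed (use t in simp_all)
  have 2: "counit E (?F t) = counit ?X t" if t: "t \<in> carrier ?T" for t
  proof (rule tensor_ext[where V = C and W = D and f = "\<lambda>t. counit E (?F t)" and U = "field_space"
        and g = "counit ?X"])
    show "lin ?T field_space (\<lambda>t. counit E (?F t))" using l by simp
    show "lin ?T field_space (counit ?X)" by (rule lin_tensor_counit) auto
  qed (use t in \<open>simp_all add: n\<close>)
  show ?thesis unfolding coalgebra_hom_def using l 1 2 by simp
qed

text \<open>
  Convolution products vanish off the carrier, so that the monoid laws are equations between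
  functions; \<open>restr0\<close> is what remains of a map after convolving it with the unit.
\<close>

definition conv :: "('k::field, 'v::ab_group_add, 'm) coalg_scheme \<Rightarrow>
    ('k, 'w::ab_group_add, 'n) halg_scheme \<Rightarrow> ('v \<Rightarrow> 'w) \<Rightarrow> ('v \<Rightarrow> 'w) \<Rightarrow> 'v \<Rightarrow> 'w" where
  "conv C A f g c = (if c \<in> carrier C then sw C (\<lambda>u v. mult A (f u) (g v)) c else 0)"

definition conv_one :: "('k::field, 'v::ab_group_add, 'm) coalg_scheme \<Rightarrow>
    ('k, 'w::ab_group_add, 'n) halg_scheme \<Rightarrow> 'v \<Rightarrow> 'w" where
  "conv_one C A c = (if c \<in> carrier C then scale A (counit C c) (one A) else 0)"

definition restr0 :: "('k, 'v, 'm) vspace_scheme \<Rightarrow> ('v \<Rightarrow> 'w::zero) \<Rightarrow> 'v \<Rightarrow> 'w" where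
  "restr0 V f v = (if v \<in> carrier V then f v else 0)"

lemma restr0_eqI: "(\<And>v. v \<in> carrier V \<Longrightarrow> f v = g v) \<Longrightarrow> restr0 V f = restr0 V g"
  by (auto simp: restr0_def)

lemma restr0_conv [simp]: "restr0 C (conv C A f g) = conv C A f g"
  by (auto simp: restr0_def conv_def)

lemma conv_restr0 [simp]: "conv C A (restr0 C f) g = conv C A f g" "conv C A f (restr0 C g) = conv C A f g"
  by (auto simp: restr0_def conv_def)

lemma lin_conv [simp]:
  assumes "is_coalgebra C" "is_algebra A" "lin C A f" "lin C A g"
  shows "lin C A (conv C A f g)"
proof -
  have "lin C A (sw C (\<lambda>u v. mult A (f u) (g v)))"
    using assms by (simp add: lin_mem[OF assms(3)] lin_mem[OF assms(4)])
  then show ?thesis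
    by (rule iffD1[OF lin_cong, rotated -1]) (use assms in \<open>simp_all add: conv_def\<close>)
qed

lemma conv_assoc:
  assumes "is_coalgebra C" "is_algebra A" "lin C A f" "lin C A g" "lin C A h"
  shows "conv C A (conv C A f g) h = conv C A f (conv C A g h)"
proof
  fix c
  note [simp] = assms lin_mem[OF assms(3)] lin_mem[OF assms(4)] lin_mem[OF assms(5)]
  show "conv C A (conv C A f g) h c = conv C A f (conv C A g h) c"
  proof (cases "c \<in> carrier C")
    case True
    then have "conv C A (conv C A f g) h c =
       sw C (\<lambda>d w. mult A (sw C (\<lambda>u v. mult A (f u) (g v)) d) (h w)) c"
      by (simp add: conv_def)
    also have "\<dots> = sw C (\<lambda>d w. sw C (\<lambda>u v. mult A (mult A (f u) (g v)) (h w)) d) c"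
      by (simp add: lin_sw[of C A _ _ A "\<lambda>z. mult A z (h w)" for w] del: mult_assoc)
    also have "\<dots> = sw C (\<lambda>u d. sw C (\<lambda>v w. mult A (mult A (f u) (g v)) (h w)) d) c"
      using True by (intro sw_coassoc[of C A]) (simp_all del: mult_assoc)
    also have "\<dots> = sw C (\<lambda>u d. mult A (f u) (sw C (\<lambda>v w. mult A (g v) (h w)) d)) c"
      by (simp add: lin_sw[of C A _ _ A "mult A (f w)" for w])
    also have "\<dots> = conv C A f (conv C A g h) c"
      using True by (simp add: conv_def)
    finally show ?thesis .
  qed (simp add: conv_def)
qed

lemma conv_one_left:
  assumes "is_coalgebra C" "is_algebra A" "lin C A f"
  shows "conv C A (conv_one C A) f = restr0 C f"
proof
  fix c
  note [simp] = assms lin_mem[OF assms(3)]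
  show "conv C A (conv_one C A) f c = restr0 C f c"
    by (simp add: conv_def conv_one_def restr0_def sw_counit1[of C A _ f])
qed

lemma conv_one_right:
  assumes "is_coalgebra C" "is_algebra A" "lin C A f"
  shows "conv C A f (conv_one C A) = restr0 C f"
proof
  fix c
  note [simp] = assms lin_mem[OF assms(3)]
  show "conv C A f (conv_one C A) c = restr0 C f c"
    by (simp add: conv_def conv_one_def restr0_def sw_counit2[of C A _ f])
qed

lemma conv_one_conv:
  assumes "is_coalgebra C" "is_algebra A" "lin C A f" "lin C A g"
  shows "conv C A (conv_one C A) (conv C A f g) = conv C A f g"
    "conv C A f (conv C A (conv_one C A) g) = conv C A f g"
  using assms by (simp_all add: conv_one_left)

lemma conv_left_cancel:
  assumes "is_coalgebra C" "is_algebra A" "lin C A q" "lin C A p" "lin C A f" "lin C A g"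
    and "conv C A q p = conv_one C A" "conv C A p f = conv C A p g"
  shows "restr0 C f = restr0 C g"
proof -
  have "restr0 C f = conv C A (conv C A q p) f" using assms by (simp add: conv_one_left)
  also have "\<dots> = conv C A q (conv C A p g)" using assms(8) by (simp add: conv_assoc assms(1-6))
  also have "\<dots> = conv C A (conv C A q p) g" using assms(1-6) by (simp add: conv_assoc)
  also have "\<dots> = restr0 C g" using assms by (simp add: conv_one_left)
  finally show ?thesis .
qed

section \<open>Antipodes and convolution inverses\<close>

lemma hopf_algebra [simp]: "is_hopf_algebra H \<Longrightarrow> is_algebra H"
  unfolding is_hopf_algebra_def is_bialgebra_def by blast

lemma hopf_coalgebra [simp]: "is_hopf_algebra H \<Longrightarrow> is_coalgebra H"
  unfolding is_hopf_algebra_def is_bialgebra_def by blast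

lemma bialg_algebra [simp]: "is_bialgebra H \<Longrightarrow> is_algebra H"
  unfolding is_bialgebra_def by blast

lemma bialg_coalgebra [simp]: "is_bialgebra H \<Longrightarrow> is_coalgebra H"
  unfolding is_bialgebra_def by blast

lemma hopf_bialgebra [simp]: "is_hopf_algebra H \<Longrightarrow> is_bialgebra H"
  unfolding is_hopf_algebra_def by blast

lemma lin_antipode [simp]:
  "is_hopf_algebra H \<Longrightarrow> lin V H g \<Longrightarrow> lin V H (\<lambda>v. antipode H (g v))"
  unfolding is_hopf_algebra_def antipode_law_def by (blast intro: lin_comp)

lemma antipode_mem [simp]:
  "is_hopf_algebra H \<Longrightarrow> x \<in> carrier H \<Longrightarrow> antipode H x \<in> carrier H"
  unfolding is_hopf_algebra_def antipode_law_def by (blast intro: lin_mem)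

lemma counit_one [simp]: "is_bialgebra H \<Longrightarrow> counit H (one H) = 1"
  unfolding is_bialgebra_def counit_alg_map_def by blast

lemma counit_mult [simp]:
  "is_bialgebra H \<Longrightarrow> x \<in> carrier H \<Longrightarrow> y \<in> carrier H \<Longrightarrow>
   counit H (mult H x y) = counit H x * counit H y"
  unfolding is_bialgebra_def counit_alg_map_def by blast

lemma antipode_left:
  "is_hopf_algebra H \<Longrightarrow> x \<in> carrier H \<Longrightarrow>
   sw H (\<lambda>u v. mult H (antipode H u) v) x = scale H (counit H x) (one H)"
  unfolding is_hopf_algebra_def antipode_law_def by blast

lemma antipode_right:
  "is_hopf_algebra H \<Longrightarrow> x \<in> carrier H \<Longrightarrow>
   sw H (\<lambda>u v. mult H u (antipode H v)) x = scale H (counit H x) (one H)"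
  unfolding is_hopf_algebra_def antipode_law_def by blast

lemma coalgebra_hom_mult:
  assumes "is_bialgebra H"
  shows "coalgebra_hom (tensor_coalgebra H H) H (tlift H H (mult H))"
  by (rule coalgebra_hom_tlift)
    (use assms in \<open>simp_all add: bilin_mult\<close>, use assms in \<open>unfold is_bialgebra_def, blast\<close>)

lemma sw_mult:
  assumes H: "is_bialgebra H" and U: "is_vspace U" and x: "x \<in> carrier H" "y \<in> carrier H"
    and f: "\<And>v. v \<in> carrier H \<Longrightarrow> lin H U (\<lambda>u. f u v)" "\<And>u. u \<in> carrier H \<Longrightarrow> lin H U (f u)"
  shows "sw H f (mult H x y) = sw H (\<lambda>x1 x2. sw H (\<lambda>y1 y2. f (mult H x1 y1) (mult H x2 y2)) y) x"
proof -
  have [simp]: "is_algebra H" "is_coalgebra H" using H by auto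
  note [simp] = U x
  have b [simp]: "bilin H H H (mult H)" by (simp add: bilin_mult)
  have e [simp]: "tlift H H (mult H) (tens H H a b) = mult H a b" if "a \<in> carrier H" "b \<in> carrier H" for a b
    using that by (intro tlift_tens[of H]) auto
  have l: "lin (tensor_space H H) H (tlift H H (mult H))" by (rule lin_tlift) auto
  have "sw H f (mult H x y) = sw H f (tlift H H (mult H) (tens H H x y))" by simp
  also have "\<dots> = sw (tensor_coalgebra H H) (\<lambda>s t. f (tlift H H (mult H) s) (tlift H H (mult H) t)) (tens H H x y)"
    by (rule sw_coalgebra_hom[OF coalgebra_hom_mult[OF H] _ _ U _ f]) auto
  also have "\<dots> = sw H (\<lambda>x1 x2. sw H (\<lambda>y1 y2. f (mult H x1 y1) (mult H x2 y2)) y) x"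
    by (subst sw_tensor[OF _ _ U]) (auto intro!: lin_comp[OF l] f simp: lin_mem[OF l])
  finally show ?thesis .
qed

lemma conv_coalgebra_hom:
  assumes "coalgebra_hom C D p" "is_coalgebra C" "is_coalgebra D" "is_algebra A" "lin D A f" "lin D A g"
  shows "conv C A (\<lambda>c. f (p c)) (\<lambda>c. g (p c)) = restr0 C (\<lambda>c. conv D A f g (p c))"
proof
  fix c
  note [simp] = lin_mem[OF coalgebra_hom_lin[OF assms(1)]] lin_mem[OF assms(5)] lin_mem[OF assms(6)]
  show "conv C A (\<lambda>c. f (p c)) (\<lambda>c. g (p c)) c = restr0 C (\<lambda>c. conv D A f g (p c)) c"
    using assms by (simp add: conv_def restr0_def sw_coalgebra_hom[OF assms(1), of A])
qed

lemma conv_one_coalgebra_hom: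
  assumes "coalgebra_hom C D p"
  shows "restr0 C (\<lambda>c. conv_one D A (p c)) = conv_one C A"
  using assms lin_mem[OF coalgebra_hom_lin[OF assms]]
  by (auto simp: restr0_def conv_one_def coalgebra_hom_def)

text \<open>Precomposition with a coalgebra map respects convolution products and the convolution
  unit, so the two antipode laws, which say that S and id are inverse in End(H), pull back along
  \<open>p\<close>.\<close>

lemma antipode_conv:
  assumes "is_hopf_algebra H" "is_coalgebra C" "coalgebra_hom C H p"
  shows "conv C H (\<lambda>c. antipode H (p c)) p = conv_one C H"
    "conv C H p (\<lambda>c. antipode H (p c)) = conv_one C H"
proof -
  have "conv H H (antipode H) (\<lambda>x. x) = conv_one H H" "conv H H (\<lambda>x. x) (antipode H) = conv_one H H"
    using assms(1) by (auto simp: conv_def conv_one_def antipode_left antipode_right)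
  then show "conv C H (\<lambda>c. antipode H (p c)) p = conv_one C H"
    "conv C H p (\<lambda>c. antipode H (p c)) = conv_one C H"
    using conv_coalgebra_hom[OF assms(3,2), of H "antipode H" "\<lambda>x. x"]
       conv_coalgebra_hom[OF assms(3,2), of H "\<lambda>x. x" "antipode H"] assms
      conv_one_coalgebra_hom[OF assms(3), of H]
    by simp_all
qed

text \<open>In Hom(H \<otimes> H, H) the left side is a left convolution inverse of the
  multiplication, because the latter is a coalgebra map, and the right side is a right inverse. The
  two therefore coincide.\<close>

lemma antipode_mult:
  assumes H: "is_hopf_algebra H" and x: "x \<in> carrier H" "y \<in> carrier H"
  shows "antipode H (mult H x y) = mult H (antipode H y) (antipode H x)"
proof -
  let ?X = "tensor_coalgebra H H" and ?T = "tensor_space H H"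
  note [simp] = H
  let ?m = "tlift H H (mult H)" and ?n = "tlift H H (\<lambda>x y. mult H (antipode H y) (antipode H x))"
  have b: "bilin H H H (mult H)" "bilin H H H (\<lambda>x y. mult H (antipode H y) (antipode H x))"
    by (auto intro!: bilinI)
  have l: "lin ?T H ?m" "lin ?T H ?n"
    by (rule lin_tlift; use b in simp)+
  note [simp] = lin_comp[OF _ l(1)] lin_comp[OF _ l(2)] lin_mem[OF l(1)] lin_mem[OF l(2)]
  have e [simp]: "?m (tens H H a b) = mult H a b" "?n (tens H H a b) = mult H (antipode H b) (antipode H a)"
    if "a \<in> carrier H" "b \<in> carrier H" for a b
    using that by (auto intro!: tlift_tens b)
  have m: "coalgebra_hom ?X H ?m" by (rule coalgebra_hom_mult) simp
  have 1: "conv ?X H (\<lambda>t. antipode H (?m t)) ?m = conv_one ?X H"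
    by (rule antipode_conv) (auto simp: m)
  have 2: "conv ?X H ?m ?n = conv_one ?X H"
  proof
    fix t
    show "conv ?X H ?m ?n t = conv_one ?X H t"
    proof (cases "t \<in> carrier ?T")
      case True
      have "sw ?X (\<lambda>u v. mult H (?m u) (?n v)) t = scale H (counit ?X t) (one H)"
      proof (rule tensor_ext[where V = H and W = H and U = H and t = t])
        fix a b assume a [simp]: "a \<in> carrier H" and b [simp]: "b \<in> carrier H"
        have "sw ?X (\<lambda>u v. mult H (?m u) (?n v)) (tens H H a b) =
          sw H (\<lambda>a1 a2. sw H (\<lambda>b1 b2. mult H a1 (mult H b1 (mult H (antipode H b2) (antipode H a2)))) b) a"
          by (subst sw_tensor[of _ _ H]) (simp_all add: l)
        also have "\<dots> = sw H (\<lambda>a1 a2. mult H a1 (mult H (sw H (\<lambda>b1 b2. mult H b1 (antipode H b2)) b) (antipode H a2))) a"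
          by (simp add: lin_sw[of H H _ _ H "\<lambda>z. mult H x (mult H z y)" for x y])
        also have "\<dots> = scale H (counit H a * counit H b) (one H)"
          by (simp add: antipode_right lin_sw[of H H _ _ H "scale H x" for x, symmetric]
             vs_scale_scale mult.commute)
        finally show "sw ?X (\<lambda>u v. mult H (?m u) (?n v)) (tens H H a b) =
             scale H (counit ?X (tens H H a b)) (one H)" by simp
      qed (use True l in simp_all)
      then show ?thesis using True by (simp add: conv_def conv_one_def)
    qed (simp add: conv_def conv_one_def)
  qed
  have "restr0 ?X (\<lambda>t. antipode H (?m t)) = conv ?X H (\<lambda>t. antipode H (?m t)) (conv ?X H ?m ?n)"
    by (simp add: 2 conv_one_right l)
  also have "\<dots> = conv ?X H (conv ?X H (\<lambda>t. antipode H (?m t)) ?m) ?n"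
    by (rule conv_assoc[symmetric]) (simp_all add: l)
  also have "\<dots> = restr0 ?X ?n" by (simp add: 1 conv_one_left l)
  finally have "restr0 ?X (\<lambda>t. antipode H (?m t)) (tens H H x y) = restr0 ?X ?n (tens H H x y)"
    by simp
  then show ?thesis using x by (simp add: restr0_def)
qed

text \<open>The map f \<circ> S is a right convolution inverse of \<open>f\<close> because
  \<open>f\<close> is an algebra map; S \<circ> f is a left inverse because \<open>f\<close> is a
  coalgebra map.\<close>

lemma bialgebra_map_antipode:
  assumes A: "is_hopf_algebra A" and B: "is_hopf_algebra B" and f: "coalgebra_hom A B f"
    and one: "f (one A) = one B"
    and m: "\<And>a b. a \<in> carrier A \<Longrightarrow> b \<in> carrier A \<Longrightarrow> f (mult A a b) = mult B (f a) (f b)"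
    and a: "a \<in> carrier A"
  shows "f (antipode A a) = antipode B (f a)"
proof -
  note [simp] = A B
  have l: "lin A B f" using f by (rule coalgebra_hom_lin)
  note [simp] = lin_mem[OF l] lin_comp[OF _ l]
  have 1: "conv A B f (\<lambda>a. f (antipode A a)) = conv_one A B"
  proof
    fix c
    show "conv A B f (\<lambda>a. f (antipode A a)) c = conv_one A B c"
      using lin_sw[of A A "\<lambda>u v. mult A u (antipode A v)" c B f]
      by (simp add: conv_def conv_one_def m[symmetric] l antipode_right lin_scale[OF l] one)
  qed
  have "restr0 A (\<lambda>a. f (antipode A a)) = restr0 A (\<lambda>a. antipode B (f a))"
    by (rule conv_left_cancel[where A = B and p = f and q = "\<lambda>a. antipode B (f a)"])
       (simp_all add: l antipode_conv[OF B _ f] 1)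
  then show ?thesis using a by (metis restr0_def)
qed

section \<open>Tensor products of algebras\<close>

text \<open>Linearity extends the identity from pure tensors one argument at a time, starting on the
  right. The product \<open>m\<close> is abstract so that the componentwise product and the product
  of a double cross product are both covered.\<close>

lemma tensor_assoc_ext:
  fixes V :: "('k::field, 'v::ab_group_add, 'm) vspace_scheme" and W :: "('k, 'w::ab_group_add, 'n) vspace_scheme"
  defines "T \<equiv> tensor_space V W"
  assumes V: "is_vspace V" and m: "bilin T T T m"
    and pure: "\<And>a b c d e f. a \<in> carrier V \<Longrightarrow> b \<in> carrier W \<Longrightarrow> c \<in> carrier V \<Longrightarrow> d \<in> carrier W \<Longrightarrow>
      e \<in> carrier V \<Longrightarrow> f \<in> carrier W \<Longrightarrow>
      m (m (tens V W a b) (tens V W c d)) (tens V W e f) = m (tens V W a b) (m (tens V W c d) (tens V W e f))"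
    and r: "r \<in> carrier T" "s \<in> carrier T" "t \<in> carrier T"
  shows "m (m r s) t = m r (m s t)"
proof -
  note [simp] = V bilin_mem[OF m] lin_bilin1[OF m] lin_bilin2[OF m]
  have T [simp]: "is_vspace T" by (simp add: T_def)
  have [simp]: "tens V W a b \<in> carrier T" if "a \<in> carrier V" "b \<in> carrier W" for a b
    using that by (simp add: T_def)
  have 1: "m (m (tens V W a b) (tens V W c d)) t = m (tens V W a b) (m (tens V W c d) t)"
    if "a \<in> carrier V" "b \<in> carrier W" "c \<in> carrier V" "d \<in> carrier W" "t \<in> carrier T" for a b c d t
    by (rule tensor_ext[where V = V and W = W and U = T and t = t])
      (use that pure in \<open>simp_all flip: T_def\<close>)
  have 2: "m (m (tens V W a b) s) t = m (tens V W a b) (m s t)"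
    if "a \<in> carrier V" "b \<in> carrier W" "s \<in> carrier T" "t \<in> carrier T" for a b s t
    by (rule tensor_ext[where V = V and W = W and U = T and t = s])
      (use that 1 in \<open>simp_all flip: T_def\<close>)
  show ?thesis
    by (rule tensor_ext[where V = V and W = W and U = T and t = r])
      (use r 2 in \<open>simp_all flip: T_def\<close>)
qed

text \<open>This is the target of the convolution algebras in which maps with values in different
  factors are multiplied: each factor is embedded by tensoring with the unit of the other, and the
  two images commute elementwise.\<close>

definition tensor_algebra :: "('k::field, 'v::ab_group_add, 'm) halg_scheme \<Rightarrow>
    ('k, 'w::ab_group_add, 'n) halg_scheme \<Rightarrow> ('k, ('k, 'v, 'w) tensor) halg" where
  "tensor_algebra A B =
     \<lparr>carrier = carrier (tensor_space A B),
      scale = scale (tensor_space A B),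
      comult = comult (tensor_coalgebra A B),
      counit = counit (tensor_coalgebra A B),
      mult = (\<lambda>s t. tlift A B (\<lambda>a b. tlift A B (\<lambda>a' b'. tens A B (mult A a a') (mult B b b')) t) s),
      one = tens A B (one A) (one B),
      antipode = tlift A B (\<lambda>a b. tens A B (antipode A a) (antipode B b))\<rparr>"

lemma tensor_algebra_sel [simp]:
  "carrier (tensor_algebra C D) = carrier (tensor_space C D)"
  "scale (tensor_algebra C D) = scale (tensor_space C D)"
  "one (tensor_algebra C D) = tens C D (one C) (one D)"
  by (simp_all add: tensor_algebra_def)

lemmas tensor_algebra_struct [simp] = struct[OF tensor_algebra_sel(1,2)]

lemma lin_tlift_arg:
  assumes "is_vspace V" "is_vspace U" "bilin V W U f" "lin Z (tensor_space V W) g"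
  shows "lin Z U (\<lambda>z. tlift V W f (g z))"
  by (rule lin_comp[OF assms(4) lin_tlift[OF assms(1-3)]])

lemma tensor_algebra_bilin:
  assumes A: "is_algebra A" and B: "is_algebra B"
  defines "T \<equiv> tensor_space A B"
  shows "bilin T T T (mult (tensor_algebra A B))"
  unfolding tensor_algebra_def T_def halg.simps
  by (intro bilinI lin_tlift_arg lin_tlift_param lin_tens1 lin_tens2 lin_mult1 lin_mult2 tlift_mem)
     (use A B in simp_all)

lemma tensor_algebra_mult [simp]:
  assumes A: "is_algebra A" and B: "is_algebra B"
    and [simp]: "a \<in> carrier A" "b \<in> carrier B" "a' \<in> carrier A" "b' \<in> carrier B"
  shows "mult (tensor_algebra A B) (tens A B a b) (tens A B a' b') = tens A B (mult A a a') (mult B b b')"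
proof -
  note [simp] = A B
  let ?T = "tensor_space A B"
  have 1: "bilin A B ?T (\<lambda>a' b'. tens A B (mult A a a') (mult B b b'))"
    if "a \<in> carrier A" "b \<in> carrier B" for a b
    by (rule bilinI) (use that in simp_all)
  have 2: "bilin A B ?T (\<lambda>a b. tlift A B (\<lambda>a' b'. tens A B (mult A a a') (mult B b b')) (tens A B a' b'))"
    by (intro bilinI lin_tlift_param lin_tens1 lin_tens2 lin_mult1 lin_mult2) simp_all
  show ?thesis
    by (simp add: tensor_algebra_def tlift_tens[OF _ 2] tlift_tens[OF _ 1])
qed

lemma is_algebra_tensor [simp]:
  assumes A: "is_algebra A" and B: "is_algebra B"
  shows "is_algebra (tensor_algebra A B)"
proof -
  let ?T = "tensor_space A B"
  note [simp] = A B
  note b = tensor_algebra_bilin[OF A B]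
  have "mult (tensor_algebra A B) (mult (tensor_algebra A B) r s) t =
     mult (tensor_algebra A B) r (mult (tensor_algebra A B) s t)"
    if "r \<in> carrier ?T" "s \<in> carrier ?T" "t \<in> carrier ?T" for r s t
    by (rule tensor_assoc_ext[OF _ b _ that]) simp_all
  moreover have "mult (tensor_algebra A B) (tens A B (one A) (one B)) t = t" if "t \<in> carrier ?T" for t
    by (rule tensor_ext[where V = A and W = B and U = ?T and t = t])
      (use that in \<open>simp_all add: lin_bilin2[OF b]\<close>)
  moreover have "mult (tensor_algebra A B) t (tens A B (one A) (one B)) = t" if "t \<in> carrier ?T" for t
    by (rule tensor_ext[where V = A and W = B and U = ?T and t = t])
      (use that in \<open>simp_all add: lin_bilin1[OF b]\<close>)
  moreover have "bilin (tensor_algebra A B) (tensor_algebra A B) (tensor_algebra A B) (mult (tensor_algebra A B))"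
    using b by (simp add: bilin_def)
  moreover have "is_vspace (tensor_algebra A B)" by simp
  moreover have "one (tensor_algebra A B) \<in> carrier (tensor_algebra A B)" by simp
  ultimately show ?thesis unfolding is_algebra_def by simp
qed

lemmas tensor_mult [simp] =
  mult_mem[of "tensor_algebra A B" for A B, simplified tensor_algebra_sel tensor_algebra_struct]
  lin_mult1[of "tensor_algebra A B" for A B, simplified tensor_algebra_sel tensor_algebra_struct]
  lin_mult2[of "tensor_algebra A B" for A B, simplified tensor_algebra_sel tensor_algebra_struct]

lemma conv_algebra_hom:
  assumes "is_coalgebra C" "is_algebra A" "is_algebra B" "lin A B \<phi>" "lin C A f" "lin C A g"
    and "\<And>a b. a \<in> carrier A \<Longrightarrow> b \<in> carrier A \<Longrightarrow> \<phi> (mult A a b) = mult B (\<phi> a) (\<phi> b)"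
  shows "conv C B (\<lambda>c. \<phi> (f c)) (\<lambda>c. \<phi> (g c)) = restr0 C (\<lambda>c. \<phi> (conv C A f g c))"
proof
  fix c
  note [simp] = assms(1-6) lin_mem[OF assms(5)] lin_mem[OF assms(6)]
  show "conv C B (\<lambda>c. \<phi> (f c)) (\<lambda>c. \<phi> (g c)) c = restr0 C (\<lambda>c. \<phi> (conv C A f g c)) c"
    by (simp add: conv_def restr0_def lin_sw[of C A "\<lambda>u v. mult A (f u) (g v)" c B \<phi>] assms(7))
qed

lemma comult_sw: "is_coalgebra C \<Longrightarrow> c \<in> carrier C \<Longrightarrow> comult C c = sw C (tens C C) c"
  unfolding sw_def
  by (rule tlift_unique[where g = "\<lambda>t. t" and U = "tensor_space C C"]) (auto simp: comult_mem bilin_tens)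

text \<open>In this form the coproduct is an algebra map from \<open>H\<close> to H \<otimes> H, so
  that composing with it preserves convolution products by \<open>conv_algebra_hom\<close>.\<close>

lemma comult_mult:
  assumes H: "is_bialgebra H" and x: "x \<in> carrier H" "y \<in> carrier H"
  shows "comult H (mult H x y) = mult (tensor_algebra H H) (comult H x) (comult H y)"
proof -
  note [simp] = x bialg_algebra[OF H] bialg_coalgebra[OF H]
  let ?T = "tensor_space H H" and ?A = "tensor_algebra H H"
  have "mult ?A (comult H x) (comult H y) = mult ?A (sw H (tens H H) x) (sw H (tens H H) y)"
    by (simp add: comult_sw)
  also have "\<dots> = sw H (\<lambda>x1 x2. mult ?A (tens H H x1 x2) (sw H (tens H H) y)) x"
    by (subst lin_sw[where U = ?T and W = ?T and g = "\<lambda>z. mult ?A z (sw H (tens H H) y)"]) simp_all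
  also have "\<dots> = sw H (\<lambda>x1 x2. sw H (\<lambda>y1 y2. mult ?A (tens H H x1 x2) (tens H H y1 y2)) y) x"
    by (simp add: lin_sw[where U = ?T and W = ?T and g = "mult ?A z" for z])
  also have "\<dots> = comult H (mult H x y)"
    using H x unfolding is_bialgebra_def by simp
  finally show ?thesis ..
qed

text \<open>Since the product of h \<otimes> 1 and 1 \<otimes> k is h \<otimes> k, the coproduct of
  \<open>p\<close> factors into the two embeddings of \<open>p\<close>. Comultiplicativity thereby
  becomes an equation in a convolution monoid, where factors can be exchanged and cancelled.\<close>

lemma coalgebra_hom_conv:
  assumes C: "is_coalgebra C" and H: "is_algebra H" "is_coalgebra H" and p: "coalgebra_hom C H p"
  shows "restr0 C (\<lambda>c. comult H (p c)) =
    conv C (tensor_algebra H H) (\<lambda>c. tens H H (p c) (one H)) (\<lambda>c. tens H H (one H) (p c))"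
proof
  fix c
  note [simp] = C H lin_mem[OF coalgebra_hom_lin[OF p]] 
  show "restr0 C (\<lambda>c. comult H (p c)) c =
    conv C (tensor_algebra H H) (\<lambda>c. tens H H (p c) (one H)) (\<lambda>c. tens H H (one H) (p c)) c"
    using p by (simp add: conv_def restr0_def coalgebra_hom_def)
qed

section \<open>Conjugate convolution factors\<close>

text \<open>
  With the images of \<open>P\<close>, \<open>Q\<close>, \<open>A\<close> in \<open>Hom(X, H \<otimes> L)\<close> the hypothesis reads
  \<open>P * A * P\<^sup>-\<^sup>1 = Q * A * Q\<^sup>-\<^sup>1\<close>, hence \<open>A\<close> commutes with \<open>P\<^sup>-\<^sup>1 * Q\<close>.
\<close>

lemma yd_commute:
  assumes X: "is_coalgebra X" and H: "is_hopf_algebra H" and L: "is_algebra L"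
    and P: "coalgebra_hom X H P" and Q: "coalgebra_hom X H Q" and A: "lin X L A"
    and YD: "\<And>s. s \<in> carrier X \<Longrightarrow>
      sw X (\<lambda>s1 s'. sw X (\<lambda>s2 s3. tens H L (mult H (P s1) (antipode H (P s3))) (A s2)) s') s =
      sw X (\<lambda>s1 s'. sw X (\<lambda>s2 s3. tens H L (mult H (Q s1) (antipode H (Q s3))) (A s2)) s') s"
  defines "R \<equiv> conv X H (\<lambda>s. antipode H (P s)) Q"
  assumes U: "is_vspace U" and f: "bilin L H U f" and s: "s \<in> carrier X"
  shows "sw X (\<lambda>s1 s2. f (A s1) (R s2)) s = sw X (\<lambda>s1 s2. f (A s2) (R s1)) s"
proof -
  let ?T = "tensor_algebra H L" and ?V = "tensor_space H L"
  note lP = coalgebra_hom_lin[OF P] and lQ = coalgebra_hom_lin[OF Q]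
  note [simp] = X H L A lP lQ lin_mem[OF lP] lin_mem[OF lQ] lin_mem[OF A] bilin_mem[OF f]
    lin_bilin1[OF f] lin_bilin2[OF f] U
  define p where "p = (\<lambda>s. tens H L (P s) (one L))"
  define sp where "sp = (\<lambda>s. tens H L (antipode H (P s)) (one L))"
  define q where "q = (\<lambda>s. tens H L (Q s) (one L))"
  define sq where "sq = (\<lambda>s. tens H L (antipode H (Q s)) (one L))"
  define a where "a = (\<lambda>s. tens H L (one H) (A s))"
  define r where "r = conv X ?T sp q"
  let ?one = "conv_one X ?T"
  have l [simp]: "lin X ?V p" "lin X ?V sp" "lin X ?V q" "lin X ?V sq" "lin X ?V a" "lin X ?V r"
    unfolding r_def by (simp_all add: p_def sp_def q_def sq_def a_def lin_conv[of X ?T, simplified tensor_algebra_sel tensor_algebra_struct])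
  have lR [simp]: "lin X H R" unfolding R_def by (simp add: lin_conv)
  note [simp] = lin_mem[OF lR]
  have lT [simp]: "lin H ?V (\<lambda>h. tens H L h (one L))" by simp
  have one: "restr0 X (\<lambda>c. tens H L (conv_one X H c) (one L)) = ?one"
    by (auto simp: restr0_def conv_one_def scale_tens1)
  \<comment> \<open>The embedding of \<open>H\<close> by h \<otimes> 1 is an algebra map, so the
    convolution inverses in Hom(X, H) remain inverses in Hom(X, H \<otimes> L).\<close>
  have inv: "conv X ?T sp p = ?one" "conv X ?T sq q = ?one"
    unfolding sp_def p_def sq_def q_def one[symmetric]
    by (subst conv_algebra_hom[where \<phi> = "\<lambda>h. tens H L h (one L)" and A = H];
        simp add: antipode_conv P Q)+
  have r: "restr0 X (\<lambda>s. tens H L (R s) (one L)) = r"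
    unfolding r_def sp_def q_def R_def
    by (subst conv_algebra_hom[where \<phi> = "\<lambda>h. tens H L h (one L)" and A = H]) simp_all
  have three: "conv X ?T (\<lambda>s. tens H L (B s) (one L)) (conv X ?T a (\<lambda>s. tens H L (antipode H (B s)) (one L))) s =
      sw X (\<lambda>s1 s'. sw X (\<lambda>s2 s3. tens H L (mult H (B s1) (antipode H (B s3))) (A s2)) s') s"
    if "lin X H B" "s \<in> carrier X" for B s
    using that by (simp add: conv_def a_def lin_mem[OF that(1)] lin_sw[where U = ?V and W = ?V and g = "mult ?T z" for z])
  have yd: "conv X ?T p (conv X ?T a sp) = conv X ?T q (conv X ?T a sq)"
  proof
    fix s show "conv X ?T p (conv X ?T a sp) s = conv X ?T q (conv X ?T a sq) s"
      unfolding p_def sp_def q_def sq_def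
      by (cases "s \<in> carrier X") (simp_all only: three YD lP lQ, simp add: conv_def)
  qed
  note assoc = conv_assoc[of X ?T, simplified tensor_algebra_sel tensor_algebra_struct]
    and olc = conv_one_conv[of X ?T, simplified tensor_algebra_sel tensor_algebra_struct]
    and lc = lin_conv[of X ?T, simplified tensor_algebra_sel tensor_algebra_struct]
    and orr = conv_one_right[of X ?T, simplified tensor_algebra_sel tensor_algebra_struct]
  \<comment> \<open>Inserting sp * p = 1 on the left and writing r = sp * q exposes p * a * sp;
    after \<open>yd\<close> the factor sq * q drops out on the right.\<close>
  have "conv X ?T a r = conv X ?T (conv X ?T sp p) (conv X ?T a r)"
    by (simp add: inv olc)
  also have "\<dots> = conv X ?T sp (conv X ?T (conv X ?T p (conv X ?T a sp)) q)"
    unfolding r_def by (simp add: assoc lc)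
  also have "\<dots> = conv X ?T sp (conv X ?T (conv X ?T q (conv X ?T a sq)) q)"
    by (simp only: yd)
  also have "\<dots> = conv X ?T r (conv X ?T a (conv X ?T sq q))"
    unfolding r_def by (simp add: assoc lc)
  also have "\<dots> = conv X ?T r a"
    by (simp add: inv orr)
  finally have "conv X ?T a r s = conv X ?T r a s" by simp
  then have e: "sw X (\<lambda>s1 s2. tens H L (R s2) (A s1)) s = sw X (\<lambda>s1 s2. tens H L (R s1) (A s2)) s"
    unfolding r[symmetric] using s by (simp add: conv_def a_def) 
  \<comment> \<open>The identity just obtained in H \<otimes> L is the universal case, through which
    every \<open>f\<close> factors; the arguments are exchanged because \<open>L\<close> is the
    second factor there.\<close>
  have b: "bilin H L U (\<lambda>h l. f l h)" by (auto intro!: bilinI)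
  have lf: "lin ?V U (tlift H L (\<lambda>h l. f l h))" by (rule lin_tlift[OF _ _ b]) simp_all
  have "tlift H L (\<lambda>h l. f l h) (sw X (\<lambda>s1 s2. tens H L (R s2) (A s1)) s) =
      sw X (\<lambda>s1 s2. f (A s1) (R s2)) s"
    using s by (simp add: lin_sw[OF _ _ _ _ _ lf U] tlift_tens[OF _ b])
  moreover have "tlift H L (\<lambda>h l. f l h) (sw X (\<lambda>s1 s2. tens H L (R s1) (A s2)) s) =
      sw X (\<lambda>s1 s2. f (A s2) (R s1)) s"
    using s by (simp add: lin_sw[OF _ _ _ _ _ lf U] tlift_tens[OF _ b])
  ultimately show ?thesis using e by simp
qed

lemma antipode_counit:
  assumes H: "is_hopf_algebra H" and x: "x \<in> carrier H"
  shows "counit H (antipode H x) = counit H x"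
proof -
  note [simp] = H
  have "counit H (antipode H x) = sw H (\<lambda>u v. scale field_space (counit H v) (counit H (antipode H u))) x"
    using x by (subst sw_counit2[where U = field_space]) simp_all
  also have "\<dots> = sw H (\<lambda>u v. counit H (mult H (antipode H u) v)) x"
    by (simp add: mult.commute)
  also have "\<dots> = counit H (sw H (\<lambda>u v. mult H (antipode H u) v) x)"
    using x by (subst lin_sw[where U = H and W = field_space and g = "counit H"]) simp_all
  also have "\<dots> = counit H x"
    using x lin_scale[of H field_space "counit H" "one H" "counit H x"] by (simp add: antipode_left)
  finally show ?thesis .
qed

text \<open>The coproducts of \<open>P\<close> and \<open>Q\<close> factor through the two
  embeddings of \<open>H\<close> in H \<otimes> H, so comparing them with that of \<open>R\<close>
  calls for a single exchange, of \<open>R\<close> in the first factor with \<open>P\<close> in the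
  second. This is what \<open>comm\<close> supplies.\<close>

lemma yd_commute_coalgebra_hom:
  assumes X: "is_coalgebra X" and H: "is_hopf_algebra H"
    and P: "coalgebra_hom X H P" and Q: "coalgebra_hom X H Q"
  defines "R \<equiv> conv X H (\<lambda>s. antipode H (P s)) Q"
  assumes comm: "\<And>s. s \<in> carrier X \<Longrightarrow>
     sw X (\<lambda>s1 s2. tens H H (R s1) (P s2)) s = sw X (\<lambda>s1 s2. tens H H (R s2) (P s1)) s"
  shows "coalgebra_hom X H R"
proof -
  let ?T = "tensor_algebra H H" and ?V = "tensor_space H H"
  note lP = coalgebra_hom_lin[OF P] and lQ = coalgebra_hom_lin[OF Q]
  note [simp] = X H lP lQ lin_mem[OF lP] lin_mem[OF lQ]
  have lR [simp]: "lin X H R" unfolding R_def by (simp add: lin_conv)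
  note [simp] = lin_mem[OF lR]
  let ?i = "\<lambda>h. tens H H h (one H)" and ?j = "\<lambda>h. tens H H (one H) h"
  let ?one = "conv_one X ?T"
  have lc [simp]: "lin H ?V (comult H)" by (rule coalg_lin_comult) simp
  have lcc [simp]: "lin X ?V (\<lambda>s. comult H (f s))" if "lin X H f" for f
    by (rule lin_comp[OF that lc])
  have PR: "conv X H P R = restr0 X Q"
    unfolding R_def by (simp add: conv_assoc[symmetric] antipode_conv P conv_one_left)
  note assoc = conv_assoc[of X ?T, simplified tensor_algebra_sel tensor_algebra_struct]
    and olc = conv_one_conv[of X ?T, simplified tensor_algebra_sel tensor_algebra_struct]
    and lcv = lin_conv[of X ?T, simplified tensor_algebra_sel tensor_algebra_struct]
  have ij: "conv X ?T (\<lambda>s. ?i (f s)) (\<lambda>s. ?i (g s)) = restr0 X (\<lambda>s. ?i (conv X H f g s))"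
     "conv X ?T (\<lambda>s. ?j (f s)) (\<lambda>s. ?j (g s)) = restr0 X (\<lambda>s. ?j (conv X H f g s))"
     "conv X ?T (\<lambda>s. comult H (f s)) (\<lambda>s. comult H (g s)) = restr0 X (\<lambda>s. comult H (conv X H f g s))"
    if "lin X H f" "lin X H g" for f g
    using that conv_algebra_hom[where \<phi> = ?i and A = H and B = ?T and C = X and f = f and g = g]
      conv_algebra_hom[where \<phi> = ?j and A = H and B = ?T and C = X and f = f and g = g]
      conv_algebra_hom[where \<phi> = "comult H" and A = H and B = ?T and C = X and f = f and g = g]
    by (simp_all add: comult_mult)
  have swap: "conv X ?T (\<lambda>s. ?i (R s)) (\<lambda>s. ?j (P s)) = conv X ?T (\<lambda>s. ?j (P s)) (\<lambda>s. ?i (R s))"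
  proof
    fix s show "conv X ?T (\<lambda>s. ?i (R s)) (\<lambda>s. ?j (P s)) s = conv X ?T (\<lambda>s. ?j (P s)) (\<lambda>s. ?i (R s)) s"
      by (simp add: conv_def comm)
  qed
  have q: "restr0 X (\<lambda>s. ?i (Q s)) = conv X ?T (\<lambda>s. ?i (P s)) (\<lambda>s. ?i (R s))"
     "restr0 X (\<lambda>s. ?j (Q s)) = conv X ?T (\<lambda>s. ?j (P s)) (\<lambda>s. ?j (R s))"
     "restr0 X (\<lambda>s. comult H (Q s)) = conv X ?T (\<lambda>s. comult H (P s)) (\<lambda>s. comult H (R s))"
    by (simp_all add: ij PR) (auto intro!: restr0_eqI simp: restr0_def)
  have "conv X ?T (\<lambda>s. comult H (P s)) (\<lambda>s. comult H (R s)) =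
      conv X ?T (\<lambda>s. ?i (Q s)) (\<lambda>s. ?j (Q s))"
    by (simp add: q(3)[symmetric] coalgebra_hom_conv Q)
  also have "\<dots> = conv X ?T (restr0 X (\<lambda>s. ?i (Q s))) (restr0 X (\<lambda>s. ?j (Q s)))" by simp
  also have "\<dots> = conv X ?T (\<lambda>s. ?i (P s)) (conv X ?T (conv X ?T (\<lambda>s. ?i (R s)) (\<lambda>s. ?j (P s))) (\<lambda>s. ?j (R s)))"
    unfolding q by (simp add: assoc lcv)
  also have "\<dots> = conv X ?T (conv X ?T (\<lambda>s. ?i (P s)) (\<lambda>s. ?j (P s))) (conv X ?T (\<lambda>s. ?i (R s)) (\<lambda>s. ?j (R s)))"
    unfolding swap by (simp add: assoc lcv)
  also have "\<dots> = conv X ?T (\<lambda>s. comult H (P s)) (conv X ?T (\<lambda>s. ?i (R s)) (\<lambda>s. ?j (R s)))"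
    by (simp add: coalgebra_hom_conv[symmetric] P)
  finally have e: "conv X ?T (\<lambda>s. comult H (P s)) (\<lambda>s. comult H (R s)) =
      conv X ?T (\<lambda>s. comult H (P s)) (conv X ?T (\<lambda>s. ?i (R s)) (\<lambda>s. ?j (R s)))" .
  have c1: "comult H (one H) = tens H H (one H) (one H)"
    using hopf_bialgebra[OF H] unfolding is_bialgebra_def by blast
  \<comment> \<open>The coproduct is an algebra map, so applied to S \<circ> P it gives an inverse
    of the coproduct of \<open>P\<close>. No rule for the coproduct of an antipode enters.\<close>
  have inv: "conv X ?T (\<lambda>s. comult H (antipode H (P s))) (\<lambda>s. comult H (P s)) = ?one"
    by (simp add: ij antipode_conv P) (auto simp: restr0_def conv_one_def c1 lin_scale[OF lc])
  have D: "restr0 X (\<lambda>s. comult H (R s)) = restr0 X (conv X ?T (\<lambda>s. ?i (R s)) (\<lambda>s. ?j (R s)))"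
    by (rule conv_left_cancel[where A = ?T and p = "\<lambda>s. comult H (P s)" and q = "\<lambda>s. comult H (antipode H (P s))"])
      (use e inv in \<open>simp_all add: lcv\<close>)
  have "comult H (R s) = sw X (\<lambda>s1 s2. tens H H (R s1) (R s2)) s" if "s \<in> carrier X" for s
    using fun_cong[OF D, of s] that by (simp add: restr0_def conv_def)
  moreover have "counit H (R s) = counit X s" if s: "s \<in> carrier X" for s
  proof -
    have "counit H (R s) = sw X (\<lambda>u v. counit H (mult H (antipode H (P u)) (Q v))) s"
      using s unfolding R_def conv_def
      by (simp del: counit_mult, subst lin_sw[where U = H and W = field_space and g = "counit H"]) simp_all
    also have "\<dots> = sw X (\<lambda>u v. scale field_space (counit X u) (counit X v)) s"
      using P Q by (simp add: coalgebra_hom_def antipode_counit)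
    also have "\<dots> = counit X s"
      using s by (rule sw_counit1[rotated 2]) simp_all
    finally show ?thesis .
  qed
  ultimately show ?thesis using lR unfolding coalgebra_hom_def by blast
qed

section \<open>The double cross product of a matched pair\<close>

lemma tensor_ext2:
  fixes V :: "('k::field, 'v::ab_group_add, 'm) vspace_scheme" and W :: "('k, 'w::ab_group_add, 'n) vspace_scheme"
  defines "T \<equiv> tensor_space V W"
  assumes V: "is_vspace V" and U: "is_vspace U"
    and f: "bilin T T U f" and g: "bilin T T U g"
    and pure: "\<And>a b c d. a \<in> carrier V \<Longrightarrow> b \<in> carrier W \<Longrightarrow> c \<in> carrier V \<Longrightarrow> d \<in> carrier W \<Longrightarrow>
      f (tens V W a b) (tens V W c d) = g (tens V W a b) (tens V W c d)"
    and r: "r \<in> carrier T" "s \<in> carrier T"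
  shows "f r s = g r s"
proof -
  note [simp] = V U lin_bilin1[OF f] lin_bilin2[OF f] lin_bilin1[OF g] lin_bilin2[OF g]
  have [simp]: "tens V W a b \<in> carrier T" if "a \<in> carrier V" "b \<in> carrier W" for a b
    using that by (simp add: T_def)
  have 1: "f (tens V W a b) s = g (tens V W a b) s"
    if "a \<in> carrier V" "b \<in> carrier W" "s \<in> carrier T" for a b s
    by (rule tensor_ext[where V = V and W = W and U = U and t = s])
      (use that pure in \<open>simp_all flip: T_def\<close>)
  show ?thesis
    by (rule tensor_ext[where V = V and W = W and U = U and t = r])
      (use r 1 in \<open>simp_all flip: T_def\<close>)
qed

lemmas tensor_lin_sw = lin_sw[of "tensor_coalgebra C D" for C D, simplified tensor_coalgebra_sel tensor_coalgebra_struct]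

lemma sw_struct:
  assumes "carrier C = carrier C'" "scale C = scale C'" "comult C = comult C'"
  shows "sw C = sw C'"
  by (intro ext) (simp add: sw_def tlift_struct[OF assms(1,2)] assms(3))

text \<open>Stated for a group-like element rather than for the unit of a bialgebra: the unit of the
  braided Hopf algebra \<open>L\<close> is group-like as well, while \<open>L\<close> need not be an
  ordinary bialgebra.\<close>

lemma sw_grouplike:
  assumes "comult C g = tens C C g g" and g: "g \<in> carrier C" and U: "is_vspace U"
    and f: "\<And>v. v \<in> carrier C \<Longrightarrow> lin C U (\<lambda>u. f u v)" "\<And>u. u \<in> carrier C \<Longrightarrow> lin C U (f u)"
  shows "sw C f g = f g g"
  unfolding sw_def assms(1) by (rule tlift_tens[OF U _ g g]) (auto intro!: bilinI f)

lemma sw_one: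
  assumes H: "is_bialgebra H" and U: "is_vspace U"
    and f: "\<And>v. v \<in> carrier H \<Longrightarrow> lin H U (\<lambda>u. f u v)" "\<And>u. u \<in> carrier H \<Longrightarrow> lin H U (f u)"
  shows "sw H f (one H) = f (one H) (one H)"
proof (rule sw_grouplike[OF _ _ U f])
  show "comult H (one H) = tens H H (one H) (one H)" using H unfolding is_bialgebra_def by blast
qed (use H in simp)

text \<open>The general form of a cancellation such as S(u) v inside a longer expression:
  reassociation lets \<open>m\<close> collapse the first two legs to a counit, which the remaining
  leg absorbs.\<close>

lemma sw_cancel:
  assumes C: "is_coalgebra C" and A: "is_vspace A" and U: "is_vspace U" and c: "c \<in> carrier C"
    and m: "\<And>v. v \<in> carrier C \<Longrightarrow> lin C A (\<lambda>u. m u v)" "\<And>u. u \<in> carrier C \<Longrightarrow> lin C A (m u)"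
    and e: "e \<in> carrier A" "\<And>c. c \<in> carrier C \<Longrightarrow> sw C m c = scale A (counit C c) e"
    and g: "\<And>h. h \<in> carrier A \<Longrightarrow> lin C U (g h)" "\<And>c. c \<in> carrier C \<Longrightarrow> lin A U (\<lambda>h. g h c)"
  shows "sw C (\<lambda>u d. sw C (\<lambda>v w. g (m u v) w) d) c = g e c"
proof -
  have b: "bilin A C U g" and bm: "bilin C C A m" by (auto intro!: bilinI g m)
  note [simp] = C A U c e lin_bilin1[OF b] lin_bilin2[OF b] bilin_mem[OF b]
    lin_bilin1[OF bm] lin_bilin2[OF bm] bilin_mem[OF bm]
  have "sw C (\<lambda>u d. sw C (\<lambda>v w. g (m u v) w) d) c = sw C (\<lambda>d w. sw C (\<lambda>u v. g (m u v) w) d) c"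
    by (rule sw_coassoc[where U = U, symmetric]) simp_all
  also have "\<dots> = sw C (\<lambda>d w. g (sw C m d) w) c"
    by (rule sw_cong, simp, simp, subst lin_sw[where U = A and W = U and g = "\<lambda>z. g z w" for w]) simp_all
  also have "\<dots> = sw C (\<lambda>d w. scale U (counit C d) (g e w)) c"
    by (simp add: lin_scale[OF bilinD1[OF b]])
  also have "\<dots> = g e c"
    by (rule sw_counit1[where U = U]) simp_all
  finally show ?thesis .
qed

text \<open>Rebracketing four legs from ((1,2),(3,4)) to (1,((2,3),4)) makes the middle two the legs
  of one element, to which an identity about a single coproduct applies.\<close>

lemma sw_middle:
  assumes C: "is_coalgebra C" and U: "is_vspace U" and c: "c \<in> carrier C"
    and f: "\<And>v w z. v \<in> carrier C \<Longrightarrow> w \<in> carrier C \<Longrightarrow> z \<in> carrier C \<Longrightarrow> lin C U (\<lambda>u. f u v w z)"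
      "\<And>u w z. u \<in> carrier C \<Longrightarrow> w \<in> carrier C \<Longrightarrow> z \<in> carrier C \<Longrightarrow> lin C U (\<lambda>v. f u v w z)"
      "\<And>u v z. u \<in> carrier C \<Longrightarrow> v \<in> carrier C \<Longrightarrow> z \<in> carrier C \<Longrightarrow> lin C U (\<lambda>w. f u v w z)"
      "\<And>u v w. u \<in> carrier C \<Longrightarrow> v \<in> carrier C \<Longrightarrow> w \<in> carrier C \<Longrightarrow> lin C U (f u v w)"
  shows "sw C (\<lambda>s1 s2. sw C (\<lambda>u v. sw C (\<lambda>w z. f u v w z) s2) s1) c =
    sw C (\<lambda>u s'. sw C (\<lambda>m z. sw C (\<lambda>v w. f u v w z) m) s') c"
proof -
  note [simp] = C U c f
  have "sw C (\<lambda>s1 s2. sw C (\<lambda>u v. sw C (\<lambda>w z. f u v w z) s2) s1) c =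
     sw C (\<lambda>u s'. sw C (\<lambda>v s2. sw C (\<lambda>w z. f u v w z) s2) s') c"
    by (rule sw_coassoc[where U = U]) simp_all
  also have "\<dots> = sw C (\<lambda>u s'. sw C (\<lambda>m z. sw C (\<lambda>v w. f u v w z) m) s') c"
    by (rule sw_cong, simp, simp, rule sw_coassoc[where U = U, symmetric]) simp_all
  finally show ?thesis .
qed

lemma sw_tlift_hom:
  assumes h: "coalgebra_hom (tensor_coalgebra C D) E (tlift C D m)" and C: "is_coalgebra C" and D: "is_coalgebra D"
    and E: "is_coalgebra E" and m: "bilin C D E m"
    and U: "is_vspace U" and c: "c \<in> carrier C" and d: "d \<in> carrier D"
    and f: "\<And>v. v \<in> carrier E \<Longrightarrow> lin E U (\<lambda>u. f u v)" "\<And>u. u \<in> carrier E \<Longrightarrow> lin E U (f u)"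
  shows "sw E f (m c d) = sw C (\<lambda>c1 c2. sw D (\<lambda>d1 d2. f (m c1 d1) (m c2 d2)) d) c"
proof -
  let ?X = "tensor_coalgebra C D" and ?T = "tensor_space C D"
  note [simp] = C D E U c d
  have e [simp]: "tlift C D m (tens C D x y) = m x y" if "x \<in> carrier C" "y \<in> carrier D" for x y
    using that by (intro tlift_tens[of E] m) simp_all
  have l: "lin ?T E (tlift C D m)" by (rule lin_tlift[OF _ _ m]) simp_all
  have "sw E f (m c d) = sw E f (tlift C D m (tens C D c d))" by simp
  also have "\<dots> = sw ?X (\<lambda>s t. f (tlift C D m s) (tlift C D m t)) (tens C D c d)"
    by (rule sw_coalgebra_hom[OF h _ _ U _ f]) simp_all
  also have "\<dots> = sw C (\<lambda>c1 c2. sw D (\<lambda>d1 d2. f (m c1 d1) (m c2 d2)) d) c"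
    by (subst sw_tensor[OF _ _ U]) (auto intro!: lin_comp[OF l] f simp: lin_mem[OF l])
  finally show ?thesis .
qed

section \<open>The axioms of a matched pair on all of H \<otimes> K\<close>

locale matched =
  fixes H :: "('k::field, 'h::ab_group_add, 'm) halg_scheme"
    and K :: "('k, 'l::ab_group_add, 'n) halg_scheme"
    and la :: "'h \<Rightarrow> 'l \<Rightarrow> 'l" and ra :: "'h \<Rightarrow> 'l \<Rightarrow> 'h"
  assumes matched: "matched_pair H K la ra"
begin

lemma hopf [simp]: "is_hopf_algebra H" "is_hopf_algebra K"
  using matched unfolding matched_pair_def by blast+

abbreviation "X \<equiv> tensor_coalgebra H K"
abbreviation "Y \<equiv> tensor_space H K"
abbreviation "D \<equiv> tensor_space K H"
abbreviation "A \<equiv> tlift H K la"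
abbreviation "R \<equiv> tlift H K ra"
abbreviation "dm \<equiv> dcp_mult H K la ra"

lemma bilin_la: "bilin H K K la" and bilin_ra: "bilin H K H ra"
  using matched unfolding matched_pair_def left_module_def right_module_def by blast+

lemma hom_A: "coalgebra_hom X K A" and hom_R: "coalgebra_hom X H R"
  using matched unfolding matched_pair_def by blast+

lemmas lin_la [simp] = lin_bilin1[OF bilin_la] lin_bilin2[OF bilin_la] bilin_mem[OF bilin_la]
lemmas lin_ra [simp] = lin_bilin1[OF bilin_ra] lin_bilin2[OF bilin_ra] bilin_mem[OF bilin_ra]

lemma lin_A: "lin Y K A" and lin_R: "lin Y H R"
  using coalgebra_hom_lin[OF hom_A] coalgebra_hom_lin[OF hom_R] by simp_all

lemmas lin_AR [simp] = lin_comp[OF _ lin_A] lin_comp[OF _ lin_R] lin_mem[OF lin_A] lin_mem[OF lin_R]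

lemma A_tens [simp]: "x \<in> carrier H \<Longrightarrow> a \<in> carrier K \<Longrightarrow> A (tens H K x a) = la x a"
  by (rule tlift_tens[OF _ bilin_la]) simp_all

lemma R_tens [simp]: "x \<in> carrier H \<Longrightarrow> a \<in> carrier K \<Longrightarrow> R (tens H K x a) = ra x a"
  by (rule tlift_tens[OF _ bilin_ra]) simp_all

lemma la_one [simp]: "a \<in> carrier K \<Longrightarrow> la (one H) a = a"
  and la_mult: "x \<in> carrier H \<Longrightarrow> y \<in> carrier H \<Longrightarrow> a \<in> carrier K \<Longrightarrow> la (mult H x y) a = la x (la y a)"
  and ra_one [simp]: "x \<in> carrier H \<Longrightarrow> ra x (one K) = x"
  and ra_mult: "x \<in> carrier H \<Longrightarrow> a \<in> carrier K \<Longrightarrow> b \<in> carrier K \<Longrightarrow> ra x (mult K a b) = ra (ra x a) b"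
  and la_unit [simp]: "x \<in> carrier H \<Longrightarrow> la x (one K) = scale K (counit H x) (one K)"
  and ra_unit [simp]: "a \<in> carrier K \<Longrightarrow> ra (one H) a = scale H (counit K a) (one H)"
  using matched unfolding matched_pair_def left_module_def right_module_def by blast+

lemma counit_A [simp]: "s \<in> carrier Y \<Longrightarrow> counit K (A s) = counit X s"
  and counit_R [simp]: "s \<in> carrier Y \<Longrightarrow> counit H (R s) = counit X s"
  using hom_A hom_R by (simp_all add: coalgebra_hom_def)

lemma mult_la: "x \<in> carrier H \<Longrightarrow> a \<in> carrier K \<Longrightarrow> b \<in> carrier K \<Longrightarrow>
   la x (mult K a b) = sw X (\<lambda>s1 s2. mult K (A s1) (la (R s2) b)) (tens H K x a)"
  using matched unfolding matched_pair_def
  by (simp add: sw_tensor[where U = K] lin_A lin_R)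

lemma mult_ra: "x \<in> carrier H \<Longrightarrow> y \<in> carrier H \<Longrightarrow> a \<in> carrier K \<Longrightarrow>
   ra (mult H x y) a = sw X (\<lambda>s1 s2. mult H (ra x (A s1)) (R s2)) (tens H K y a)"
  using matched unfolding matched_pair_def
  by (simp add: sw_tensor[where U = H] lin_A lin_R)

text \<open>The axiom speaks of pure tensors x \<otimes> a. Linear extension makes it available for
  the legs of a coproduct in H \<otimes> K, which are arbitrary tensors.\<close>

lemma compat_tens:
  assumes s: "s \<in> carrier Y"
  shows "sw X (\<lambda>s1 s2. tens K H (A s1) (R s2)) s = sw X (\<lambda>s1 s2. tens K H (A s2) (R s1)) s"
proof (rule tensor_ext[where V = H and W = K and U = D and t = s])
  fix x a assume [simp]: "x \<in> carrier H" "a \<in> carrier K"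
  show "sw X (\<lambda>s1 s2. tens K H (A s1) (R s2)) (tens H K x a) = sw X (\<lambda>s1 s2. tens K H (A s2) (R s1)) (tens H K x a)"
    using matched unfolding matched_pair_def
    by (simp add: sw_tensor[where U = D] lin_A lin_R)
qed (use s in \<open>simp_all add: lin_A lin_R\<close>)

lemma compat:
  assumes s: "s \<in> carrier Y" and U: "is_vspace U"
    and f: "\<And>v. v \<in> carrier H \<Longrightarrow> lin K U (\<lambda>u. f u v)" "\<And>u. u \<in> carrier K \<Longrightarrow> lin H U (f u)"
  shows "sw X (\<lambda>s1 s2. f (A s1) (R s2)) s = sw X (\<lambda>s1 s2. f (A s2) (R s1)) s"
proof -
  have b: "bilin K H U f" by (auto intro!: bilinI f)
  have lf: "lin D U (tlift K H f)" by (rule lin_tlift[OF _ U b]) simp_all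
  have "tlift K H f (sw X (\<lambda>s1 s2. tens K H (A s1) (R s2)) s) =
      sw X (\<lambda>s1 s2. f (A s1) (R s2)) s"
    using s by (simp add: tensor_lin_sw[OF _ _ _ _ _ lf U] tlift_tens[OF U b] lin_A lin_R)
  moreover have "tlift K H f (sw X (\<lambda>s1 s2. tens K H (A s2) (R s1)) s) =
      sw X (\<lambda>s1 s2. f (A s2) (R s1)) s"
    using s by (simp add: tensor_lin_sw[OF _ _ _ _ _ lf U] tlift_tens[OF U b] lin_A lin_R)
  ultimately show ?thesis using compat_tens[OF s] by simp
qed

section \<open>The product of the double cross product and its associativity\<close>

lemma bilin_dm: "bilin D D D dm"
  unfolding dcp_mult_def
  by (intro bilinI lin_tlift_arg lin_tlift_param tlift_mem) simp_all

lemmas lin_dm [simp] = lin_bilin1[OF bilin_dm] lin_bilin2[OF bilin_dm] bilin_mem[OF bilin_dm]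

lemma dm_tens:
  assumes [simp]: "a \<in> carrier K" "x \<in> carrier H" "b \<in> carrier K" "y \<in> carrier H"
  shows "dm (tens K H a x) (tens K H b y) =
    sw X (\<lambda>s1 s2. tens K H (mult K a (A s1)) (mult H (R s2) y)) (tens H K x b)"
proof -
  let ?F = "\<lambda>a x b y. sw H (\<lambda>x1 x2. sw K (\<lambda>b1 b2.
         tens K H (mult K a (la x1 b1)) (mult H (ra x2 b2) y)) b) x"
  have 1: "bilin K H D (?F a x)" if "a \<in> carrier K" "x \<in> carrier H" for a x
    by (rule bilinI) (use that in simp_all)
  have 2: "bilin K H D (\<lambda>a x. tlift K H (?F a x) (tens K H b y))"
    by (intro bilinI lin_tlift_param) simp_all
  have "dm (tens K H a x) (tens K H b y) = ?F a x b y"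
    by (simp add: dcp_mult_def tlift_tens[OF _ 2] tlift_tens[OF _ 1])
  also have "\<dots> = sw X (\<lambda>s1 s2. tens K H (mult K a (A s1)) (mult H (R s2) y)) (tens H K x b)"
    by (simp add: sw_tensor[where U = D] lin_A lin_R)
  finally show ?thesis .
qed

lemma dm_K:
  assumes [simp]: "a \<in> carrier K" "b \<in> carrier K" "y \<in> carrier H"
  shows "dm (tens K H a (one H)) (tens K H b y) = tens K H (mult K a b) y"
proof -
  have "dm (tens K H a (one H)) (tens K H b y) =
     sw H (\<lambda>x1 x2. sw K (\<lambda>b1 b2. tens K H (mult K a (la x1 b1)) (mult H (ra x2 b2) y)) b) (one H)"
    by (simp add: dm_tens sw_tensor[where U = D] lin_A lin_R)
  also have "\<dots> = sw K (\<lambda>b1 b2. tens K H (mult K a (la (one H) b1)) (mult H (ra (one H) b2) y)) b"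
    by (rule sw_one[where U = D]) simp_all
  also have "\<dots> = sw K (\<lambda>b1 b2. scale D (counit K b2) (tens K H (mult K a b1) y)) b"
    by (simp add: scale_tens2)
  also have "\<dots> = tens K H (mult K a b) y"
    by (subst sw_counit2[where U = D]) simp_all
  finally show ?thesis .
qed

lemma dm_H:
  assumes [simp]: "a \<in> carrier K" "x \<in> carrier H" "y \<in> carrier H"
  shows "dm (tens K H a x) (tens K H (one K) y) = tens K H a (mult H x y)"
proof -
  have "dm (tens K H a x) (tens K H (one K) y) =
     sw H (\<lambda>x1 x2. sw K (\<lambda>b1 b2. tens K H (mult K a (la x1 b1)) (mult H (ra x2 b2) y)) (one K)) x"
    by (simp add: dm_tens sw_tensor[where U = D] lin_A lin_R)
  also have "\<dots> = sw H (\<lambda>x1 x2. tens K H (mult K a (la x1 (one K))) (mult H (ra x2 (one K)) y)) x"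
    by (simp add: sw_one[where U = D])
  also have "\<dots> = sw H (\<lambda>x1 x2. scale D (counit H x1) (tens K H a (mult H x2 y))) x"
    by (simp add: scale_tens1)
  also have "\<dots> = tens K H a (mult H x y)"
    by (subst sw_counit1[where U = D]) simp_all
  finally show ?thesis .
qed

text \<open>In an iterated product, the element that \<open>dm_tens\<close> splits next has the form
  R(s2) y \<otimes> c or x \<otimes> b A(t1): a tensor acted on from the left by \<open>H\<close>
  or, with \<open>rmulK\<close>, from the right by \<open>K\<close>. The rules below express
  \<open>A\<close>, \<open>R\<close> and the coproduct of such an element through the tensor that is
  acted on.\<close>

definition lmulH :: "'h \<Rightarrow> ('k, 'h, 'l) tensor \<Rightarrow> ('k, 'h, 'l) tensor" where
  "lmulH h = tlift H K (\<lambda>y c. tens H K (mult H h y) c)"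

definition rmulK :: "'l \<Rightarrow> ('k, 'h, 'l) tensor \<Rightarrow> ('k, 'h, 'l) tensor" where
  "rmulK l = tlift H K (\<lambda>x b. tens H K x (mult K b l))"

lemma bilin_lmulH: "bilin H Y Y lmulH"
  unfolding lmulH_def by (intro bilinI lin_tlift_arg lin_tlift_param lin_tlift) simp_all

lemma bilin_rmulK: "bilin K Y Y rmulK"
  unfolding rmulK_def by (intro bilinI lin_tlift_arg lin_tlift_param lin_tlift) simp_all

lemmas lin_mulHK [simp] = lin_bilin1[OF bilin_lmulH] lin_bilin2[OF bilin_lmulH] bilin_mem[OF bilin_lmulH]
  lin_bilin1[OF bilin_rmulK] lin_bilin2[OF bilin_rmulK] bilin_mem[OF bilin_rmulK]

lemma lmulH_tens [simp]: "h \<in> carrier H \<Longrightarrow> y \<in> carrier H \<Longrightarrow> c \<in> carrier K \<Longrightarrow>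
    lmulH h (tens H K y c) = tens H K (mult H h y) c"
  unfolding lmulH_def by (rule tlift_tens[of Y]) (auto intro!: bilinI)

lemma rmulK_tens [simp]: "l \<in> carrier K \<Longrightarrow> y \<in> carrier H \<Longrightarrow> c \<in> carrier K \<Longrightarrow>
    rmulK l (tens H K y c) = tens H K y (mult K c l)"
  unfolding rmulK_def by (rule tlift_tens[of Y]) (auto intro!: bilinI)

lemma A_lmulH: "h \<in> carrier H \<Longrightarrow> t \<in> carrier Y \<Longrightarrow> A (lmulH h t) = la h (A t)"
  by (rule tensor_ext[where V = H and W = K and U = K and t = t]) (simp_all add: lin_A la_mult)

lemma R_lmulH: "h \<in> carrier H \<Longrightarrow> t \<in> carrier Y \<Longrightarrow>
    R (lmulH h t) = sw X (\<lambda>t1 t2. mult H (ra h (A t1)) (R t2)) t"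
  by (rule tensor_ext[where V = H and W = K and U = H and t = t]) (simp_all add: lin_A lin_R mult_ra)

lemma R_rmulK: "l \<in> carrier K \<Longrightarrow> t \<in> carrier Y \<Longrightarrow> R (rmulK l t) = ra (R t) l"
  by (rule tensor_ext[where V = H and W = K and U = H and t = t]) (simp_all add: lin_R ra_mult)

lemma A_rmulK: "l \<in> carrier K \<Longrightarrow> t \<in> carrier Y \<Longrightarrow>
    A (rmulK l t) = sw X (\<lambda>t1 t2. mult K (A t1) (la (R t2) l)) t"
  by (rule tensor_ext[where V = H and W = K and U = K and t = t]) (simp_all add: lin_A lin_R mult_la)

lemma sw_lmulH:
  assumes [simp]: "h \<in> carrier H" and s: "s \<in> carrier Y" and U [simp]: "is_vspace U"
    and f: "\<And>v. v \<in> carrier Y \<Longrightarrow> lin Y U (\<lambda>u. f u v)" "\<And>u. u \<in> carrier Y \<Longrightarrow> lin Y U (f u)"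
  shows "sw X f (lmulH h s) = sw H (\<lambda>h1 h2. sw X (\<lambda>t1 t2. f (lmulH h1 t1) (lmulH h2 t2)) s) h"
proof -
  have [simp]: "lin V U (\<lambda>z. f (g z) v)" "lin V U (\<lambda>z. f v (g z))"
    if "v \<in> carrier Y" "lin V Y g" for v g and V :: "('k, 'z::ab_group_add, 'q) vspace_scheme"
    using lin_comp[OF that(2) f(1)[OF that(1)]] lin_comp[OF that(2) f(2)[OF that(1)]] by simp_all
  show ?thesis
  proof (rule tensor_ext[where V = H and W = K and U = U and t = s])
    fix y c assume [simp]: "y \<in> carrier H" "c \<in> carrier K"
    show "sw X f (lmulH h (tens H K y c)) = sw H (\<lambda>h1 h2. sw X (\<lambda>t1 t2. f (lmulH h1 t1) (lmulH h2 t2)) (tens H K y c)) h"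
      by (simp add: sw_tensor[where U = U] sw_mult[where U = U] f)
  qed (simp_all add: f s)
qed

lemma sw_rmulK:
  assumes [simp]: "h \<in> carrier K" and s: "s \<in> carrier Y" and U [simp]: "is_vspace U"
    and f: "\<And>v. v \<in> carrier Y \<Longrightarrow> lin Y U (\<lambda>u. f u v)" "\<And>u. u \<in> carrier Y \<Longrightarrow> lin Y U (f u)"
  shows "sw X f (rmulK h s) = sw X (\<lambda>t1 t2. sw K (\<lambda>h1 h2. f (rmulK h1 t1) (rmulK h2 t2)) h) s"
proof -
  have [simp]: "lin V U (\<lambda>z. f (g z) v)" "lin V U (\<lambda>z. f v (g z))"
    if "v \<in> carrier Y" "lin V Y g" for v g and V :: "('k, 'z::ab_group_add, 'q) vspace_scheme"
    using lin_comp[OF that(2) f(1)[OF that(1)]] lin_comp[OF that(2) f(2)[OF that(1)]] by simp_all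
  show ?thesis
  proof (rule tensor_ext[where V = H and W = K and U = U and t = s])
    fix y c assume [simp]: "y \<in> carrier H" "c \<in> carrier K"
    show "sw X f (rmulK h (tens H K y c)) = sw X (\<lambda>t1 t2. sw K (\<lambda>h1 h2. f (rmulK h1 t1) (rmulK h2 t2)) h) (tens H K y c)"
      by (simp add: sw_tensor[where U = U] sw_mult[where U = U] f)
  qed (simp_all add: f s)
qed

lemma sw_A:
  assumes s: "s \<in> carrier Y" and U [simp]: "is_vspace U"
    and f: "\<And>v. v \<in> carrier K \<Longrightarrow> lin K U (\<lambda>u. f u v)" "\<And>u. u \<in> carrier K \<Longrightarrow> lin K U (f u)"
  shows "sw K f (A s) = sw X (\<lambda>s1 s2. f (A s1) (A s2)) s"
  by (rule sw_coalgebra_hom[OF hom_A _ _ U _ f]) (simp_all add: s)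

lemma sw_R:
  assumes s: "s \<in> carrier Y" and U [simp]: "is_vspace U"
    and f: "\<And>v. v \<in> carrier H \<Longrightarrow> lin H U (\<lambda>u. f u v)" "\<And>u. u \<in> carrier H \<Longrightarrow> lin H U (f u)"
  shows "sw H f (R s) = sw X (\<lambda>s1 s2. f (R s1) (R s2)) s"
  by (rule sw_coalgebra_hom[OF hom_R _ _ U _ f]) (simp_all add: s)

lemmas [simp] = lin_A lin_R

text \<open>Both bracketings expand to the same summand \<open>?B\<close> in three legs of x
  \<otimes> b and three legs of y \<otimes> c; they differ only in how the coproducts are
  nested.\<close>

lemma dm_assoc_tens:
  assumes [simp]: "a \<in> carrier K" "x \<in> carrier H" "b \<in> carrier K" "y \<in> carrier H" "c \<in> carrier K" "z \<in> carrier H"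
  shows "dm (dm (tens K H a x) (tens K H b y)) (tens K H c z) =
     dm (tens K H a x) (dm (tens K H b y) (tens K H c z))"
proof -
  let ?s = "tens H K x b" and ?t = "tens H K y c"
  let ?B = "\<lambda>s1 s2 s3 t1 t2 t3. tens K H (mult K a (mult K (A s1) (la (R s2) (A t1))))
      (mult H (ra (R s3) (A t2)) (mult H (R t3) z))"
  have "dm (dm (tens K H a x) (tens K H b y)) (tens K H c z) =
    sw X (\<lambda>s1 s2. dm (tens K H (mult K a (A s1)) (mult H (R s2) y)) (tens K H c z)) ?s"
    by (simp add: dm_tens[of a x b y] tensor_lin_sw[where U = D and W = D and g = "\<lambda>u. dm u v" for v])
  also have "\<dots> = sw X (\<lambda>s1 s2. sw X (\<lambda>t1 t2.
      tens K H (mult K (mult K a (A s1)) (A t1)) (mult H (R t2) z)) (lmulH (R s2) ?t)) ?s"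
    by (simp add: dm_tens)
  \<comment> \<open>As \<open>R\<close> is a coalgebra map, R(s2) splits into two legs, one for each
    leg of y \<otimes> c. In the other bracketing A(t1) splits in the same way.\<close>
  also have "\<dots> = sw X (\<lambda>s1 s'. sw X (\<lambda>s2 s3. sw X (\<lambda>t1 t2.
      tens K H (mult K (mult K a (A s1)) (la (R s2) (A t1))) (mult H (R (lmulH (R s3) t2)) z)) ?t) s') ?s"
    by (simp add: sw_lmulH[where U = D] sw_R[where U = D] A_lmulH del: lmulH_tens)
  also have "\<dots> = sw X (\<lambda>s1 s'. sw X (\<lambda>s2 s3. sw X (\<lambda>t1 t'. sw X (\<lambda>t2 t3. ?B s1 s2 s3 t1 t2 t3) t') ?t) s') ?s"
    by (simp add: R_lmulH
      tensor_lin_sw[where U = H and W = D and g = "\<lambda>u. tens K H v (mult H u z)" for v])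
  finally have l: "dm (dm (tens K H a x) (tens K H b y)) (tens K H c z) = \<dots>" .
  have "dm (tens K H a x) (dm (tens K H b y) (tens K H c z)) =
    sw X (\<lambda>t1 t2. dm (tens K H a x) (tens K H (mult K b (A t1)) (mult H (R t2) z))) ?t"
    by (simp add: dm_tens[of b y c z] tensor_lin_sw[where U = D and W = D and g = "\<lambda>u. dm v u" for v])
  also have "\<dots> = sw X (\<lambda>t1 t2. sw X (\<lambda>s1 s2. tens K H (mult K a (A s1)) (mult H (R s2) (mult H (R t2) z)))
      (rmulK (A t1) ?s)) ?t"
    by (simp add: dm_tens)
  also have "\<dots> = sw X (\<lambda>t' t3. sw X (\<lambda>s' s3. sw X (\<lambda>t1 t2. tens K H (mult K a (A (rmulK (A t1) s')))
      (mult H (ra (R s3) (A t2)) (mult H (R t3) z))) t') ?s) ?t"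
    by (simp add: sw_rmulK[where U = D] sw_A[where U = D] R_rmulK del: rmulK_tens)
  also have "\<dots> = sw X (\<lambda>t' t3. sw X (\<lambda>s' s3. sw X (\<lambda>t1 t2. sw X (\<lambda>s1 s2. ?B s1 s2 s3 t1 t2 t3) s') t') ?s) ?t"
    by (simp add: A_rmulK
      tensor_lin_sw[where U = K and W = D and g = "\<lambda>u. tens K H (mult K a u) v" for v])
  \<comment> \<open>Both sides now have the summand \<open>?B\<close>; what remains is reordering
    and rebracketing of coproducts.\<close>
  also have "\<dots> = sw X (\<lambda>t' t3. sw X (\<lambda>s' s3. sw X (\<lambda>s1 s2. sw X (\<lambda>t1 t2. ?B s1 s2 s3 t1 t2 t3) t') s') ?s) ?t"
    by (rule sw_cong, simp, simp, rule sw_cong, simp, simp, rule sw_swap[where U = D]) simp_all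
  also have "\<dots> = sw X (\<lambda>t' t3. sw X (\<lambda>s1 s'. sw X (\<lambda>s2 s3. sw X (\<lambda>t1 t2. ?B s1 s2 s3 t1 t2 t3) t') s') ?s) ?t"
    by (rule sw_cong, simp, simp, rule sw_coassoc[where U = D]) simp_all
  also have "\<dots> = sw X (\<lambda>s1 s'. sw X (\<lambda>t' t3. sw X (\<lambda>s2 s3. sw X (\<lambda>t1 t2. ?B s1 s2 s3 t1 t2 t3) t') s') ?t) ?s"
    by (rule sw_swap[where U = D]) simp_all
  also have "\<dots> = sw X (\<lambda>s1 s'. sw X (\<lambda>s2 s3. sw X (\<lambda>t' t3. sw X (\<lambda>t1 t2. ?B s1 s2 s3 t1 t2 t3) t') ?t) s') ?s"
    by (rule sw_cong, simp, simp, rule sw_swap[where U = D]) simp_all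
  also have "\<dots> = sw X (\<lambda>s1 s'. sw X (\<lambda>s2 s3. sw X (\<lambda>t1 t'. sw X (\<lambda>t2 t3. ?B s1 s2 s3 t1 t2 t3) t') ?t) s') ?s"
    by (rule sw_cong, simp, simp, rule sw_cong, simp, simp, rule sw_coassoc[where U = D]) simp_all
  finally show ?thesis using l by simp
qed

section \<open>The bialgebra structure of the double cross product\<close>

abbreviation "dcp \<equiv> double_cross_product H K la ra"

lemma dcp_sel [simp]:
  "carrier dcp = carrier D" "scale dcp = scale D"
  "comult dcp = comult (tensor_coalgebra K H)" "counit dcp = counit (tensor_coalgebra K H)"
  "mult dcp = dm" "one dcp = tens K H (one K) (one H)"
  by (simp_all add: double_cross_product_def)

lemmas dcp_struct [simp] = struct[OF dcp_sel(1,2)]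

lemma sw_dcp [simp]: "sw dcp = sw (tensor_coalgebra K H)"
  by (rule sw_struct) simp_all

lemma dcp_algebra: "is_algebra dcp"
proof -
  have "dm (dm r s) t = dm r (dm s t)"
    if "r \<in> carrier D" "s \<in> carrier D" "t \<in> carrier D" for r s t
    by (rule tensor_assoc_ext[OF _ bilin_dm dm_assoc_tens that]) simp_all
  moreover have "dm (tens K H (one K) (one H)) t = t" if "t \<in> carrier D" for t
    by (rule tensor_ext[where V = K and W = H and U = D and t = t])
      (use that in \<open>simp_all add: dm_K\<close>)
  moreover have "dm t (tens K H (one K) (one H)) = t" if "t \<in> carrier D" for t
    by (rule tensor_ext[where V = K and W = H and U = D and t = t])
      (use that in \<open>simp_all add: dm_H\<close>)
  moreover have "bilin dcp dcp dcp (mult dcp)"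
    using bilin_dm by (simp add: bilin_def)
  ultimately show ?thesis unfolding is_algebra_def by simp
qed

lemma dcp_coalgebra: "is_coalgebra dcp"
proof -
  have "is_coalgebra (tensor_coalgebra K H)" by simp
  then show ?thesis unfolding is_coalgebra_def sw3_def by simp
qed

lemma counit_dm:
  assumes "p \<in> carrier D" "q \<in> carrier D"
  shows "counit dcp (dm p q) = counit dcp p * counit dcp q"
proof -
  have b: "bilin D D field_space (\<lambda>p q. counit (tensor_coalgebra K H) (dm p q))"
    "bilin D D field_space (\<lambda>p q. counit (tensor_coalgebra K H) p * counit (tensor_coalgebra K H) q)"
    by (auto intro!: bilinI)
  have "counit (tensor_coalgebra K H) (dm p q) = counit (tensor_coalgebra K H) p * counit (tensor_coalgebra K H) q"
  proof (rule tensor_ext2[OF _ _ b])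
    fix a x c y assume [simp]: "a \<in> carrier K" "x \<in> carrier H" "c \<in> carrier K" "y \<in> carrier H"
    have "counit (tensor_coalgebra K H) (dm (tens K H a x) (tens K H c y)) =
      sw X (\<lambda>s1 s2. counit (tensor_coalgebra K H) (tens K H (mult K a (A s1)) (mult H (R s2) y))) (tens H K x c)"
      by (simp add: dm_tens tensor_lin_sw[where U = D and W = field_space and g = "counit (tensor_coalgebra K H)"])
    also have "\<dots> = sw X (\<lambda>s1 s2. scale field_space (counit X s1) (counit X s2 * (counit K a * counit H y))) (tens H K x c)"
      by (simp add: mult_ac)
    also have "\<dots> = counit X (tens H K x c) * (counit K a * counit H y)"
      by (subst sw_counit1[where U = field_space]) simp_all
    finally show "counit (tensor_coalgebra K H) (dm (tens K H a x) (tens K H c y)) =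
      counit (tensor_coalgebra K H) (tens K H a x) * counit (tensor_coalgebra K H) (tens K H c y)"
      by (simp add: mult_ac)
  qed (use assms in simp_all)
  then show ?thesis by simp
qed

text \<open>Splitting A(s1) and R(s2) produces legs in the order A, A, R, R, while a product of
  coproducts has them in the order A, R, A, R. The two differ in legs 2 and 3, which the
  compatibility axiom exchanges.\<close>

lemma compat_middle:
  assumes s [simp]: "s \<in> carrier Y" and U [simp]: "is_vspace U"
    and Z: "\<And>h k' h'. h \<in> carrier H \<Longrightarrow> k' \<in> carrier K \<Longrightarrow> h' \<in> carrier H \<Longrightarrow> lin K U (\<lambda>k. Z k h k' h')"
      "\<And>k k' h'. k \<in> carrier K \<Longrightarrow> k' \<in> carrier K \<Longrightarrow> h' \<in> carrier H \<Longrightarrow> lin H U (\<lambda>h. Z k h k' h')"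
      "\<And>k h h'. k \<in> carrier K \<Longrightarrow> h \<in> carrier H \<Longrightarrow> h' \<in> carrier H \<Longrightarrow> lin K U (\<lambda>k'. Z k h k' h')"
      "\<And>k h k'. k \<in> carrier K \<Longrightarrow> h \<in> carrier H \<Longrightarrow> k' \<in> carrier K \<Longrightarrow> lin H U (\<lambda>h'. Z k h k' h')"
  shows "sw X (\<lambda>s1 s2. sw X (\<lambda>u1 u2. sw X (\<lambda>v1 v2. Z (A u1) (R v1) (A u2) (R v2)) s2) s1) s =
    sw X (\<lambda>s1 s2. sw X (\<lambda>u1 u2. sw X (\<lambda>v1 v2. Z (A u1) (R u2) (A v1) (R v2)) s2) s1) s"
proof -
  note [simp] = lin_comp[OF _ Z(1)] lin_comp[OF _ Z(2)] lin_comp[OF _ Z(3)] lin_comp[OF _ Z(4)]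
  have "sw X (\<lambda>s1 s2. sw X (\<lambda>u1 u2. sw X (\<lambda>v1 v2. Z (A u1) (R v1) (A u2) (R v2)) s2) s1) s =
    sw X (\<lambda>u1 s'. sw X (\<lambda>m v2. sw X (\<lambda>u2 v1. Z (A u1) (R v1) (A u2) (R v2)) m) s') s"
    by (rule sw_middle[where U = U]) simp_all
  also have "\<dots> = sw X (\<lambda>u1 s'. sw X (\<lambda>m v2. sw X (\<lambda>u2 v1. Z (A u1) (R u2) (A v1) (R v2)) m) s') s"
    by (rule sw_cong, simp, simp, rule sw_cong, simp, simp,
        rule compat[where U = U and f = "\<lambda>k h. Z (A u) h k (R v)" for u v])
       (simp_all add: Z)
  also have "\<dots> = sw X (\<lambda>s1 s2. sw X (\<lambda>u1 u2. sw X (\<lambda>v1 v2. Z (A u1) (R u2) (A v1) (R v2)) s2) s1) s"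
    by (rule sw_middle[where U = U, symmetric]) simp_all
  finally show ?thesis .
qed

abbreviation "KH \<equiv> tensor_coalgebra K H"
abbreviation "DD \<equiv> tensor_space D D"

lemma lin_comult_KH: "lin D DD (comult KH)"
  by (rule lin_tensor_comult) simp_all

lemmas lin_comult_KH' [simp] = lin_comp[OF _ lin_comult_KH] lin_mem[OF lin_comult_KH]

text \<open>Both sides reduce to the summand \<open>?Z\<close>: the left one because the products of
  \<open>K\<close> and \<open>H\<close> and the maps \<open>A\<close> and \<open>R\<close> respect
  coproducts, with \<open>compat_middle\<close> correcting the order of the legs. The rest is
  interchange of sums.\<close>

lemma comult_dm_tens:
  assumes [simp]: "a \<in> carrier K" "x \<in> carrier H" "b \<in> carrier K" "y \<in> carrier H"
  shows "comult KH (dm (tens K H a x) (tens K H b y)) =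
    sw KH (\<lambda>p1 p2. sw KH (\<lambda>q1 q2. tens D D (dm p1 q1) (dm p2 q2)) (tens K H b y)) (tens K H a x)"
proof -
  let ?s = "tens H K x b"
  let ?Z = "\<lambda>a1 a2 y1 y2 k1 h1 k2 h2. tens D D (tens K H (mult K a1 k1) (mult H h1 y1)) (tens K H (mult K a2 k2) (mult H h2 y2))"
  have "comult KH (dm (tens K H a x) (tens K H b y)) =
     sw X (\<lambda>s1 s2. sw K (\<lambda>c1 c2. sw H (\<lambda>h1 h2. tens D D (tens K H c1 h1) (tens K H c2 h2)) (mult H (R s2) y)) (mult K a (A s1))) ?s"
    by (simp add: dm_tens tensor_comult_tens lin_comult_KH
      tensor_lin_sw[where U = D and W = DD and g = "comult KH"])
  also have "\<dots> = sw X (\<lambda>s1 s2. sw K (\<lambda>a1 a2. sw X (\<lambda>u1 u2. sw X (\<lambda>v1 v2. sw H (\<lambda>y1 y2.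
      ?Z a1 a2 y1 y2 (A u1) (R v1) (A u2) (R v2)) y) s2) s1) a) ?s"
    by (simp add: sw_mult[where U = DD] sw_A[where U = DD] sw_R[where U = DD])
  also have "\<dots> = sw K (\<lambda>a1 a2. sw X (\<lambda>s1 s2. sw X (\<lambda>u1 u2. sw X (\<lambda>v1 v2. sw H (\<lambda>y1 y2.
      ?Z a1 a2 y1 y2 (A u1) (R v1) (A u2) (R v2)) y) s2) s1) ?s) a"
    by (rule sw_swap[where U = DD]) simp_all
  also have "\<dots> = sw K (\<lambda>a1 a2. sw X (\<lambda>s1 s2. sw X (\<lambda>u1 u2. sw X (\<lambda>v1 v2. sw H (\<lambda>y1 y2.
      ?Z a1 a2 y1 y2 (A u1) (R u2) (A v1) (R v2)) y) s2) s1) ?s) a"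
    by (rule sw_cong, simp, simp,
       rule compat_middle[where U = DD and Z = "\<lambda>k1 h1 k2 h2. sw H (\<lambda>y1 y2. ?Z a1 a2 y1 y2 k1 h1 k2 h2) y" for a1 a2])
      simp_all
  finally have l: "comult KH (dm (tens K H a x) (tens K H b y)) = \<dots>" .
  have "sw KH (\<lambda>p1 p2. sw KH (\<lambda>q1 q2. tens D D (dm p1 q1) (dm p2 q2)) (tens K H b y)) (tens K H a x) =
    sw K (\<lambda>a1 a2. sw H (\<lambda>x1 x2. sw K (\<lambda>b1 b2. sw H (\<lambda>y1 y2.
      tens D D (dm (tens K H a1 x1) (tens K H b1 y1)) (dm (tens K H a2 x2) (tens K H b2 y2))) y) b) x) a"
    by (simp add: sw_tensor[where U = DD])
  also have "\<dots> = sw K (\<lambda>a1 a2. sw H (\<lambda>x1 x2. sw K (\<lambda>b1 b2. sw H (\<lambda>y1 y2.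
      sw X (\<lambda>v1 v2. sw X (\<lambda>u1 u2. ?Z a1 a2 y1 y2 (A u1) (R u2) (A v1) (R v2)) (tens H K x1 b1)) (tens H K x2 b2)) y) b) x) a"
    by (simp add: dm_tens tensor_lin_sw[where U = D and W = DD and g = "\<lambda>z. tens D D z v" for v]
       tensor_lin_sw[where U = D and W = DD and g = "\<lambda>z. tens D D v z" for v])
  also have "\<dots> = sw K (\<lambda>a1 a2. sw X (\<lambda>s1 s2. sw H (\<lambda>y1 y2.
      sw X (\<lambda>v1 v2. sw X (\<lambda>u1 u2. ?Z a1 a2 y1 y2 (A u1) (R u2) (A v1) (R v2)) s1) s2) y) ?s) a"
    by (rule sw_cong, simp, simp, rule sw_tensor[where U = DD, symmetric]) simp_all
  also have "\<dots> = sw K (\<lambda>a1 a2. sw X (\<lambda>s1 s2. sw H (\<lambda>y1 y2.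
      sw X (\<lambda>u1 u2. sw X (\<lambda>v1 v2. ?Z a1 a2 y1 y2 (A u1) (R u2) (A v1) (R v2)) s2) s1) y) ?s) a"
    by (rule sw_cong, simp, simp, rule sw_cong, simp, simp, rule sw_cong, simp, simp,
        rule sw_swap[where U = DD]) simp_all
  also have "\<dots> = sw K (\<lambda>a1 a2. sw X (\<lambda>s1 s2. sw X (\<lambda>u1 u2. sw H (\<lambda>y1 y2. sw X (\<lambda>v1 v2.
      ?Z a1 a2 y1 y2 (A u1) (R u2) (A v1) (R v2)) s2) y) s1) ?s) a"
    by (rule sw_cong, simp, simp, rule sw_cong, simp, simp, rule sw_swap[where U = DD]) simp_all
  also have "\<dots> = sw K (\<lambda>a1 a2. sw X (\<lambda>s1 s2. sw X (\<lambda>u1 u2. sw X (\<lambda>v1 v2. sw H (\<lambda>y1 y2.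
      ?Z a1 a2 y1 y2 (A u1) (R u2) (A v1) (R v2)) y) s2) s1) ?s) a"
    by (rule sw_cong, simp, simp, rule sw_cong, simp, simp, rule sw_cong, simp, simp,
        rule sw_swap[where U = DD]) simp_all
  finally show ?thesis using l by simp
qed

lemma comult_dm:
  assumes "p \<in> carrier D" "q \<in> carrier D"
  shows "comult KH (dm p q) = sw KH (\<lambda>p1 p2. sw KH (\<lambda>q1 q2. tens D D (dm p1 q1) (dm p2 q2)) q) p"
  by (rule tensor_ext2[where U = DD and f = "\<lambda>p q. comult KH (dm p q)"
     and g = "\<lambda>p q. sw KH (\<lambda>p1 p2. sw KH (\<lambda>q1 q2. tens D D (dm p1 q1) (dm p2 q2)) q) p",
     OF _ _ _ _ comult_dm_tens])
    (use assms in \<open>auto intro!: bilinI\<close>)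

lemma dcp_bialgebra: "is_bialgebra dcp"
proof -
  have "comult dcp (one dcp) = tens dcp dcp (one dcp) (one dcp)"
    by (simp add: tensor_comult_tens sw_one[where U = DD])
  moreover have "counit_alg_map dcp"
    using counit_dm unfolding counit_alg_map_def by simp
  ultimately show ?thesis
    unfolding is_bialgebra_def using dcp_algebra dcp_coalgebra comult_dm by simp
qed

section \<open>The antipode of the double cross product\<close>

definition dcp_antipode :: "('k, 'l, 'h) tensor \<Rightarrow> ('k, 'l, 'h) tensor" where
  "dcp_antipode = tlift K H (\<lambda>a x. dm (tens K H (one K) (antipode H x)) (tens K H (antipode K a) (one H)))"

lemma dcp_antipode_bilin: "bilin K H D (\<lambda>a x. dm (tens K H (one K) (antipode H x)) (tens K H (antipode K a) (one H)))"
  by (rule bilinI) simp_all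

lemma lin_dcp_antipode: "lin D D dcp_antipode"
  unfolding dcp_antipode_def by (rule lin_tlift[OF _ _ dcp_antipode_bilin]) simp_all

lemmas lin_dcp_antipode_simps [simp] = lin_dcp_antipode lin_comp[OF _ lin_dcp_antipode] lin_mem[OF lin_dcp_antipode]

lemma dcp_antipode_tens: "a \<in> carrier K \<Longrightarrow> x \<in> carrier H \<Longrightarrow>
   dcp_antipode (tens K H a x) = dm (tens K H (one K) (antipode H x)) (tens K H (antipode K a) (one H))"
  unfolding dcp_antipode_def by (rule tlift_tens[OF _ dcp_antipode_bilin]) simp_all

lemma dm_assoc: "r \<in> carrier D \<Longrightarrow> s \<in> carrier D \<Longrightarrow> t \<in> carrier D \<Longrightarrow> dm (dm r s) t = dm r (dm s t)"
  using mult_assoc[OF dcp_algebra] by simp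

text \<open>After reassociation the product is that of 1 \<otimes> S(x1) and S(a1) a2 \<otimes> x2.
  Collapsing the sum over \<open>a\<close> first turns this mixed product into one within
  \<open>H\<close>. For \<open>dcp_antipode_right\<close> the sum over \<open>x\<close> collapses
  first, and a product within \<open>K\<close> remains.\<close>

lemma dcp_antipode_left:
  assumes "p \<in> carrier D"
  shows "sw KH (\<lambda>p q. dm (dcp_antipode p) q) p = scale D (counit KH p) (tens K H (one K) (one H))"
proof (rule tensor_ext[where V = K and W = H and U = D and t = p])
  fix a x assume [simp]: "a \<in> carrier K" "x \<in> carrier H"
  have "sw KH (\<lambda>p q. dm (dcp_antipode p) q) (tens K H a x) =
     sw K (\<lambda>a1 a2. sw H (\<lambda>x1 x2. dm (tens K H (one K) (antipode H x1)) (tens K H (mult K (antipode K a1) a2) x2)) x) a"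
    by (simp add: sw_tensor[where U = D] dcp_antipode_tens dm_assoc dm_K)
  also have "\<dots> = sw H (\<lambda>x1 x2. sw K (\<lambda>a1 a2. dm (tens K H (one K) (antipode H x1)) (tens K H (mult K (antipode K a1) a2) x2)) a) x"
    by (rule sw_swap[where U = D]) simp_all
  also have "\<dots> = sw H (\<lambda>x1 x2. dm (tens K H (one K) (antipode H x1)) (tens K H (sw K (\<lambda>a1 a2. mult K (antipode K a1) a2) a) x2)) x"
    by (simp add: lin_sw[where U = K and W = D and g = "\<lambda>z. dm u (tens K H z v)" for u v])
  also have "\<dots> = sw H (\<lambda>x1 x2. scale D (counit K a) (tens K H (one K) (mult H (antipode H x1) x2))) x"
    by (simp add: antipode_left scale_tens1 lin_scale[OF bilinD2[OF bilin_dm]] dm_H)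
  also have "\<dots> = scale D (counit K a) (tens K H (one K) (sw H (\<lambda>x1 x2. mult H (antipode H x1) x2) x))"
    by (simp add: lin_sw[where U = H and W = D and g = "\<lambda>z. scale D v (tens K H u z)" for u v])
  also have "\<dots> = scale D (counit KH (tens K H a x)) (tens K H (one K) (one H))"
    by (simp add: antipode_left scale_tens2 vs_scale_scale)
  finally show "sw KH (\<lambda>p q. dm (dcp_antipode p) q) (tens K H a x) = 
    scale D (counit KH (tens K H a x)) (tens K H (one K) (one H))" .
qed (use assms in simp_all)

lemma dcp_antipode_right:
  assumes "p \<in> carrier D"
  shows "sw KH (\<lambda>p q. dm p (dcp_antipode q)) p = scale D (counit KH p) (tens K H (one K) (one H))"
proof (rule tensor_ext[where V = K and W = H and U = D and t = p])
  fix a x assume [simp]: "a \<in> carrier K" "x \<in> carrier H"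
  have "sw KH (\<lambda>p q. dm p (dcp_antipode q)) (tens K H a x) =
     sw K (\<lambda>a1 a2. sw H (\<lambda>x1 x2. dm (tens K H a1 (mult H x1 (antipode H x2))) (tens K H (antipode K a2) (one H))) x) a"
    by (simp add: sw_tensor[where U = D] dcp_antipode_tens dm_assoc[symmetric] dm_H)
  also have "\<dots> = sw K (\<lambda>a1 a2. dm (tens K H a1 (sw H (\<lambda>x1 x2. mult H x1 (antipode H x2)) x)) (tens K H (antipode K a2) (one H))) a"
    by (simp add: lin_sw[where U = H and W = D and g = "\<lambda>z. dm (tens K H u z) v" for u v])
  also have "\<dots> = sw K (\<lambda>a1 a2. scale D (counit H x) (tens K H (mult K a1 (antipode K a2)) (one H))) a"
    by (simp add: antipode_right scale_tens2 lin_scale[OF bilinD1[OF bilin_dm]] dm_K)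
  also have "\<dots> = scale D (counit H x) (tens K H (sw K (\<lambda>x1 x2. mult K x1 (antipode K x2)) a) (one H))"
    by (simp add: lin_sw[where U = K and W = D and g = "\<lambda>z. scale D v (tens K H z u)" for u v])
  also have "\<dots> = scale D (counit KH (tens K H a x)) (tens K H (one K) (one H))"
    by (simp add: antipode_right scale_tens1 vs_scale_scale mult.commute)
  finally show "sw KH (\<lambda>p q. dm p (dcp_antipode q)) (tens K H a x) = 
    scale D (counit KH (tens K H a x)) (tens K H (one K) (one H))" .
qed (use assms in simp_all)

lemma dcp_hopf: "is_hopf_algebra dcp"
proof -
  have [simp]: "antipode dcp = dcp_antipode" by (simp add: double_cross_product_def dcp_antipode_def)
  have "antipode_law dcp"
    unfolding antipode_law_def using dcp_antipode_left dcp_antipode_right by simp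
  then show ?thesis unfolding is_hopf_algebra_def using dcp_bialgebra by simp
qed

text \<open>Multiplicativity within \<open>K\<close> is \<open>m\<close>, and within
  \<open>H\<close> it is immediate; \<open>E\<close> supplies it for the remaining product of 1
  \<otimes> x and a \<otimes> 1. Compatibility with the antipodes is then automatic, by uniqueness
  of convolution inverses.\<close>

lemma projection_hopf_hom:
  assumes p: "coalgebra_hom K H p" and one: "p (one K) = one H"
    and m: "\<And>a b. a \<in> carrier K \<Longrightarrow> b \<in> carrier K \<Longrightarrow> p (mult K a b) = mult H (p a) (p b)"
    and E: "\<And>x a. x \<in> carrier H \<Longrightarrow> a \<in> carrier K \<Longrightarrow>
      sw X (\<lambda>s1 s2. mult H (p (A s1)) (R s2)) (tens H K x a) = mult H x (p a)"
  shows "hopf_hom dcp H (tlift K H (\<lambda>a x. mult H (p a) x))"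
proof -
  note lp = coalgebra_hom_lin[OF p]
  note [simp] = lp lin_comp[OF _ lp] lin_mem[OF lp]
  let ?t = "tlift K H (\<lambda>a x. mult H (p a) x)"
  have b: "bilin K H H (\<lambda>a x. mult H (p a) x)" by (rule bilinI) simp_all
  have lt: "lin D H ?t" by (rule lin_tlift[OF _ _ b]) simp_all
  note [simp] = lt lin_comp[OF _ lt] lin_mem[OF lt]
  have t [simp]: "?t (tens K H a x) = mult H (p a) x" if "a \<in> carrier K" "x \<in> carrier H" for a x
    using that by (intro tlift_tens[OF _ b]) simp_all
  have hom: "coalgebra_hom KH H ?t"
  proof (rule coalgebra_hom_tlift[OF _ _ _ b])
    fix a x assume [simp]: "a \<in> carrier K" "x \<in> carrier H"
    have "comult H (mult H (p a) x) = sw H (\<lambda>a1 a2. sw H (\<lambda>x1 x2. tens H H (mult H a1 x1) (mult H a2 x2)) x) (p a)"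
      using hopf_bialgebra[OF hopf(1)] unfolding is_bialgebra_def by simp
    also have "\<dots> = sw K (\<lambda>a1 a2. sw H (\<lambda>x1 x2. tens H H (mult H (p a1) x1) (mult H (p a2) x2)) x) a"
      by (rule sw_coalgebra_hom[OF p, where U = "tensor_space H H"]) simp_all
    finally show "comult H (mult H (p a) x) = \<dots>" .
    show "counit H (mult H (p a) x) = counit K a * counit H x"
      using p by (simp add: coalgebra_hom_def)
  qed simp_all
  then have hom': "coalgebra_hom dcp H ?t"
    unfolding coalgebra_hom_def by simp
  have mt: "?t (dm r s) = mult H (?t r) (?t s)" if "r \<in> carrier D" "s \<in> carrier D" for r s
  proof (rule tensor_ext2[where U = H and f = "\<lambda>r s. ?t (dm r s)" and g = "\<lambda>r s. mult H (?t r) (?t s)" and V = K and W = H])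
    fix a x c y assume [simp]: "a \<in> carrier K" "x \<in> carrier H" "c \<in> carrier K" "y \<in> carrier H"
    have "?t (dm (tens K H a x) (tens K H c y)) =
      sw X (\<lambda>s1 s2. mult H (p a) (mult H (mult H (p (A s1)) (R s2)) y)) (tens H K x c)"
      by (simp add: dm_tens m tensor_lin_sw[where U = D and W = H and g = ?t])
    also have "\<dots> = mult H (p a) (mult H (sw X (\<lambda>s1 s2. mult H (p (A s1)) (R s2)) (tens H K x c)) y)"
      by (simp add: tensor_lin_sw[where U = H and W = H and g = "\<lambda>z. mult H u (mult H z v)" for u v] del: mult_assoc)
    also have "\<dots> = mult H (?t (tens K H a x)) (?t (tens K H c y))"
      by (simp add: E)
    finally show "?t (dm (tens K H a x) (tens K H c y)) = mult H (?t (tens K H a x)) (?t (tens K H c y))" .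
  qed (use that in \<open>auto intro!: bilinI\<close>)
  have ot: "?t (one dcp) = one H" by (simp add: one)
  have "?t (antipode dcp r) = antipode H (?t r)" if "r \<in> carrier D" for r
    by (rule bialgebra_map_antipode[where A = dcp and B = H and f = "?t"])
      (use that mt dcp_hopf hom' ot in simp_all)
  then show ?thesis
    unfolding hopf_hom_def using dcp_hopf hopf(1) hom' ot mt by simp
qed

end

lemma coalgebra_hom_cong:
  assumes "is_coalgebra C" "\<And>c. c \<in> carrier C \<Longrightarrow> f c = g c"
  shows "coalgebra_hom C D f \<longleftrightarrow> coalgebra_hom C D g"
proof -
  have [simp]: "lin C D f = lin C D g" using lin_cong[of C f g D] assms by simp
  have "sw C (\<lambda>u v. tens D D (f u) (f v)) c = sw C (\<lambda>u v. tens D D (g u) (g v)) c" for c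
    by (rule sw_cong) (simp_all add: assms)
  then show ?thesis unfolding coalgebra_hom_def using assms by simp
qed

lemma tensor_coalgebra_struct2:
  assumes "carrier D = carrier D'" "scale D = scale D'" "comult D = comult D'" "counit D = counit D'"
  shows "tensor_coalgebra C D = tensor_coalgebra C D'"
  unfolding tensor_coalgebra_def
  by (simp add: struct[OF assms(1,2)] sw_struct[OF assms(1-3)] assms(4))

section \<open>The Hopf algebra of a relative Rota-Baxter operator\<close>

lemma yd_of_sel [simp]:
  "carrier (yd_of L a \<rho>) = carrier L" "scale (yd_of L a \<rho>) = scale L"
  "act (yd_of L a \<rho>) = a" "coact (yd_of L a \<rho>) = \<rho>"
  by (simp_all add: yd_of_def)

lemmas yd_of_struct [simp] = struct[OF yd_of_sel(1,2)]

locale rota_baxter =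
  fixes H :: "('k::field, 'h::ab_group_add, 'm) halg_scheme"
    and L :: "('k, 'l::ab_group_add, 'n) halg_scheme"
    and la :: "'h \<Rightarrow> 'l \<Rightarrow> 'l" and \<pi> :: "'l \<Rightarrow> 'h"
  assumes rb: "relative_rota_baxter H L la \<pi>"
begin

section \<open>The braided Hopf algebra structure of L in Sweedler form\<close>

lemma hopf_H [simp]: "is_hopf_algebra H"
  using rb unfolding relative_rota_baxter_def by blast

lemma yd_hopf: "is_yd_hopf_algebra H L la (coad H L \<pi>)"
  using rb unfolding relative_rota_baxter_def by blast

lemma hom_pi: "coalgebra_hom L H \<pi>"
  using rb unfolding relative_rota_baxter_def by blast

lemma alg_L [simp]: "is_algebra L" and coalg_L [simp]: "is_coalgebra L"
  and counit_L: "counit_alg_map L" and comult_one_L: "comult L (one L) = tens L L (one L) (one L)"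
  and antipode_L: "antipode_law L"
  using yd_hopf unfolding is_yd_hopf_algebra_def Let_def by blast+

abbreviation "M \<equiv> yd_of L la (coad H L \<pi>)"

lemma yd: "is_yd H M"
  using yd_hopf unfolding is_yd_hopf_algebra_def Let_def by blast

lemma bilin_la: "bilin H L L la"
  using yd unfolding is_yd_def left_module_def by (simp add: bilin_def)

lemma la_one [simp]: "a \<in> carrier L \<Longrightarrow> la (one H) a = a"
  and la_mult: "x \<in> carrier H \<Longrightarrow> y \<in> carrier H \<Longrightarrow> a \<in> carrier L \<Longrightarrow> la (mult H x y) a = la x (la y a)"
  using yd unfolding is_yd_def left_module_def by simp_all

lemmas lin_la [simp] = lin_bilin1[OF bilin_la] lin_bilin2[OF bilin_la] bilin_mem[OF bilin_la]

lemma lin_pi: "lin L H \<pi>" by (rule coalgebra_hom_lin[OF hom_pi])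

lemmas lin_pi' [simp] = lin_pi lin_comp[OF _ lin_pi] lin_mem[OF lin_pi]

lemma lin_SL: "lin L L (antipode L)"
  using antipode_L unfolding antipode_law_def by blast

lemmas lin_SL' [simp] = lin_SL lin_comp[OF _ lin_SL] lin_mem[OF lin_SL]

lemma counit_pi [simp]: "a \<in> carrier L \<Longrightarrow> counit H (\<pi> a) = counit L a"
  using hom_pi by (simp add: coalgebra_hom_def)

lemma counit_L_one [simp]: "counit L (one L) = 1"
  and counit_L_mult [simp]: "a \<in> carrier L \<Longrightarrow> b \<in> carrier L \<Longrightarrow> counit L (mult L a b) = counit L a * counit L b"
  using counit_L unfolding counit_alg_map_def by blast+

lemma SL_left: "a \<in> carrier L \<Longrightarrow> sw L (\<lambda>u v. mult L (antipode L u) v) a = scale L (counit L a) (one L)"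
  and SL_right: "a \<in> carrier L \<Longrightarrow> sw L (\<lambda>u v. mult L u (antipode L v)) a = scale L (counit L a) (one L)"
  using antipode_L unfolding antipode_law_def by blast+

lemma la_unit [simp]: "x \<in> carrier H \<Longrightarrow> la x (one L) = scale L (counit H x) (one L)"
proof -
  assume x: "x \<in> carrier H"
  have "yd_hom H (yd_unit H) M (\<lambda>c. scale L c (one L))"
    using yd_hopf unfolding is_yd_hopf_algebra_def Let_def by blast
  then have *: "\<And>c. c \<in> carrier (yd_unit H) \<Longrightarrow> scale L (act (yd_unit H) x c) (one L) = act M x (scale L c (one L))"
    using x unfolding yd_hom_def by blast
  have "scale L (act (yd_unit H) x 1) (one L) = act M x (scale L 1 (one L))"
    by (rule *) (simp add: yd_unit_def)
  then show ?thesis by (simp add: yd_unit_def vs_scale_one)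
qed

lemma counit_la [simp]: "x \<in> carrier H \<Longrightarrow> a \<in> carrier L \<Longrightarrow> counit L (la x a) = counit H x * counit L a"
proof -
  assume x: "x \<in> carrier H" "a \<in> carrier L"
  have "yd_hom H M (yd_unit H) (counit L)"
    using yd_hopf unfolding is_yd_hopf_algebra_def Let_def by blast
  then show ?thesis using x unfolding yd_hom_def by (simp add: yd_unit_def)
qed

abbreviation "X \<equiv> tensor_coalgebra H L"
abbreviation "Y \<equiv> tensor_space H L"
abbreviation "LL \<equiv> tensor_space L L"
abbreviation "A \<equiv> tlift H L la"

lemma act_tensor:
  assumes [simp]: "x \<in> carrier H" "a \<in> carrier L" "b \<in> carrier L"
  shows "act (yd_tensor H M M) x (tens L L a b) = sw H (\<lambda>x1 x2. tens L L (la x1 a) (la x2 b)) x"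
proof -
  have "bilin L L LL (\<lambda>m n. sw H (\<lambda>x1 x2. tens L L (la x1 m) (la x2 n)) x)"
    by (rule bilinI) simp_all
  from tlift_tens[OF _ this] show ?thesis by (simp add: yd_tensor_def)
qed

lemma mult_la:
  assumes [simp]: "x \<in> carrier H" "a \<in> carrier L" "b \<in> carrier L"
  shows "la x (mult L a b) = sw H (\<lambda>x1 x2. mult L (la x1 a) (la x2 b)) x"
proof -
  have bm: "bilin L L L (mult L)" by (rule bilin_mult) simp
  have lm: "lin LL L (tlift L L (mult L))" by (rule lin_tlift[OF _ _ bm]) simp_all
  have e [simp]: "tlift L L (mult L) (tens L L c d) = mult L c d" if "c \<in> carrier L" "d \<in> carrier L" for c d
    using that by (intro tlift_tens[OF _ bm]) simp_all
  have "yd_hom H (yd_tensor H M M) M (tlift L L (mult L))"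
    using yd_hopf unfolding is_yd_hopf_algebra_def Let_def by blast
  moreover have "tens L L a b \<in> carrier (yd_tensor H M M)" by (simp add: yd_tensor_def)
  ultimately have "tlift L L (mult L) (act (yd_tensor H M M) x (tens L L a b)) = act M x (tlift L L (mult L) (tens L L a b))"
    using assms(1) unfolding yd_hom_def by blast
  then have "la x (mult L a b) = tlift L L (mult L) (sw H (\<lambda>x1 x2. tens L L (la x1 a) (la x2 b)) x)"
    by (simp add: act_tensor)
  also have "\<dots> = sw H (\<lambda>x1 x2. mult L (la x1 a) (la x2 b)) x"
    by (simp add: lin_sw[where U = LL and W = L and g = "tlift L L (mult L)"] lm)
  finally show ?thesis .
qed

text \<open>Linearity over \<open>H\<close> of the coproduct of \<open>L\<close>, for the diagonal
  action, says that the action respects coproducts, up to the order of the two Sweedler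
  sums.\<close>

lemma hom_A: "coalgebra_hom X L A"
proof (rule coalgebra_hom_tlift[OF _ _ _ bilin_la])
  fix x a assume [simp]: "x \<in> carrier H" "a \<in> carrier L"
  have "yd_hom H M (yd_tensor H M M) (comult L)"
    using yd_hopf unfolding is_yd_hopf_algebra_def Let_def by blast
  then have "comult L (act M x a) = act (yd_tensor H M M) x (comult L a)"
    unfolding yd_hom_def by simp
  also have "\<dots> = sw L (\<lambda>a1 a2. sw H (\<lambda>x1 x2. tens L L (la x1 a1) (la x2 a2)) x) a"
    by (simp add: yd_tensor_def sw_def[of L])
  also have "\<dots> = sw H (\<lambda>x1 x2. sw L (\<lambda>a1 a2. tens L L (la x1 a1) (la x2 a2)) a) x"
    by (rule sw_swap[where U = LL]) simp_all
  finally show "comult L (la x a) = sw H (\<lambda>x1 x2. sw L (\<lambda>a1 a2. tens L L (la x1 a1) (la x2 a2)) a) x"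
    by simp
qed simp_all

lemma lin_A: "lin Y L A"
  using coalgebra_hom_lin[OF hom_A] by simp

lemmas lin_A' [simp] = lin_A lin_comp[OF _ lin_A] lin_mem[OF lin_A]

lemma A_tens [simp]: "x \<in> carrier H \<Longrightarrow> a \<in> carrier L \<Longrightarrow> A (tens H L x a) = la x a"
  by (rule tlift_tens[OF _ bilin_la]) simp_all

lemma sw_pi:
  assumes "a \<in> carrier L" and U: "is_vspace U"
    and f: "\<And>v. v \<in> carrier H \<Longrightarrow> lin H U (\<lambda>u. f u v)" "\<And>u. u \<in> carrier H \<Longrightarrow> lin H U (f u)"
  shows "sw H f (\<pi> a) = sw L (\<lambda>u v. f (\<pi> u) (\<pi> v)) a"
  by (rule sw_coalgebra_hom[OF hom_pi _ _ U _ f]) (simp_all add: assms)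

lemma sw_A:
  assumes s: "s \<in> carrier Y" and U [simp]: "is_vspace U"
    and f: "\<And>v. v \<in> carrier L \<Longrightarrow> lin L U (\<lambda>u. f u v)" "\<And>u. u \<in> carrier L \<Longrightarrow> lin L U (f u)"
  shows "sw L f (A s) = sw X (\<lambda>s1 s2. f (A s1) (A s2)) s"
  by (rule sw_coalgebra_hom[OF hom_A _ _ U _ f]) (simp_all add: s)

lemma sw_la:
  assumes [simp]: "x \<in> carrier H" "a \<in> carrier L" and U [simp]: "is_vspace U"
    and f: "\<And>v. v \<in> carrier L \<Longrightarrow> lin L U (\<lambda>u. f u v)" "\<And>u. u \<in> carrier L \<Longrightarrow> lin L U (f u)"
  shows "sw L f (la x a) = sw H (\<lambda>x1 x2. sw L (\<lambda>a1 a2. f (la x1 a1) (la x2 a2)) a) x"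
  by (rule sw_tlift_hom[OF hom_A _ _ _ bilin_la U _ _ f]) simp_all

lemmas sw_L_one = sw_grouplike[OF comult_one_L one_mem[OF alg_L]]

lemma coad_tlift:
  assumes [simp]: "a \<in> carrier L" and U: "is_vspace U"
    and f: "bilin H L U f"
  shows "tlift H L f (coad H L \<pi> a) =
    sw L (\<lambda>a1 d. sw L (\<lambda>a2 a3. f (mult H (\<pi> a1) (antipode H (\<pi> a3))) a2) d) a"
proof -
  note [simp] = U lin_bilin1[OF f] lin_bilin2[OF f] bilin_mem[OF f]
  have lf: "lin Y U (tlift H L f)" by (rule lin_tlift[OF _ U f]) simp
  have [simp]: "tlift H L f (tens H L h l) = f h l" if "h \<in> carrier H" "l \<in> carrier L" for h l
    by (rule tlift_tens[OF U f that])
  have "tlift H L f (coad H L \<pi> a) = 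
    sw L (\<lambda>d a3. sw L (\<lambda>a1 a2. f (mult H (\<pi> a1) (antipode H (\<pi> a3))) a2) d) a"
    unfolding coad_def sw3_def
    by (simp add: lin_sw[where U = Y and W = U and g = "tlift H L f"] lf)
  also have "\<dots> = sw L (\<lambda>a1 d. sw L (\<lambda>a2 a3. f (mult H (\<pi> a1) (antipode H (\<pi> a3))) a2) d) a"
    by (rule sw_coassoc[where U = U]) simp_all
  finally show ?thesis .
qed

text \<open>The braiding enters through the coaction on the second leg of \<open>p\<close>. This
  accounts for the four legs: p2 and p4 act on q1, while p3 multiplies q2.\<close>

lemma comult_L_mult:
  assumes [simp]: "p \<in> carrier L" "q \<in> carrier L"
  shows "comult L (mult L p q) = sw L (\<lambda>p1 p'. sw L (\<lambda>q1 q2. sw L (\<lambda>p2 d. sw L (\<lambda>p3 p4.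
     tens L L (mult L p1 (la (mult H (\<pi> p2) (antipode H (\<pi> p4))) q1)) (mult L p3 q2)) d) p') q) p"
proof -
  have b: "bilin H L LL (\<lambda>h p20. tens L L (mult L p1 (la h q1)) (mult L p20 q2))"
    if "p1 \<in> carrier L" "q1 \<in> carrier L" "q2 \<in> carrier L" for p1 q1 q2
    by (rule bilinI) (use that in simp_all)
  have "comult L (mult L p q) =
            sw L (\<lambda>p1 p2. sw L (\<lambda>q1 q2. tlift H L (\<lambda>h p20.
              tens L L (mult L p1 (la h q1)) (mult L p20 q2)) (coad H L \<pi> p2)) q) p"
    using yd_hopf assms unfolding is_yd_hopf_algebra_def Let_def by blast
  then show ?thesis by (simp add: coad_tlift[OF _ _ b])
qed

lemma sw_L_mult:
  assumes [simp]: "p \<in> carrier L" "q \<in> carrier L" and U: "is_vspace U"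
    and f: "\<And>v. v \<in> carrier L \<Longrightarrow> lin L U (\<lambda>u. f u v)" "\<And>u. u \<in> carrier L \<Longrightarrow> lin L U (f u)"
  shows "sw L f (mult L p q) = sw L (\<lambda>p1 p'. sw L (\<lambda>q1 q2. sw L (\<lambda>p2 d. sw L (\<lambda>p3 p4.
     f (mult L p1 (la (mult H (\<pi> p2) (antipode H (\<pi> p4))) q1)) (mult L p3 q2)) d) p') q) p"
proof -
  have b: "bilin L L U f" by (auto intro!: bilinI f)
  have lf: "lin LL U (tlift L L f)" by (rule lin_tlift[OF _ U b]) simp
  have [simp]: "tlift L L f (tens L L c d) = f c d" if "c \<in> carrier L" "d \<in> carrier L" for c d
    by (rule tlift_tens[OF U b that])
  show ?thesis
    unfolding sw_def[of L f] 
    by (simp add: comult_L_mult lin_sw[where U = LL and W = U and g = "tlift L L f"] lf U)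
qed

section \<open>The product induced by \<pi>\<close>

abbreviation rbm where "rbm \<equiv> rb_mult L la \<pi>"

lemma bilin_rbm: "bilin L L L rbm"
  unfolding rb_mult_def by (rule bilinI) simp_all

lemmas lin_rbm [simp] = lin_bilin1[OF bilin_rbm] lin_bilin2[OF bilin_rbm] bilin_mem[OF bilin_rbm]

lemma pi_rbm: "a \<in> carrier L \<Longrightarrow> b \<in> carrier L \<Longrightarrow> \<pi> (rbm a b) = mult H (\<pi> a) (\<pi> b)"
  using rb unfolding relative_rota_baxter_def rb_mult_def by simp

lemma pi_cancel_left:
  assumes c: "c \<in> carrier L" and U: "is_vspace U"
    and g: "\<And>h. h \<in> carrier H \<Longrightarrow> lin L U (g h)" "\<And>c. c \<in> carrier L \<Longrightarrow> lin H U (\<lambda>h. g h c)"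
  shows "sw L (\<lambda>u e. sw L (\<lambda>v w. g (mult H (antipode H (\<pi> u)) (\<pi> v)) w) e) c = g (one H) c"
proof (rule sw_cancel[where A = H, OF _ _ U c _ _ _ _ g])
  show "sw L (\<lambda>u v. mult H (antipode H (\<pi> u)) (\<pi> v)) c = scale H (counit L c) (one H)"
    if "c \<in> carrier L" for c
    using that antipode_left[of H "\<pi> c"] by (simp add: sw_pi[where U = H])
qed simp_all

lemma pi_cancel_right:
  assumes c: "c \<in> carrier L" and U: "is_vspace U"
    and g: "\<And>h. h \<in> carrier H \<Longrightarrow> lin L U (g h)" "\<And>c. c \<in> carrier L \<Longrightarrow> lin H U (\<lambda>h. g h c)"
  shows "sw L (\<lambda>u e. sw L (\<lambda>v w. g (mult H (\<pi> u) (antipode H (\<pi> v))) w) e) c = g (one H) c"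
proof (rule sw_cancel[where A = H, OF _ _ U c _ _ _ _ g])
  show "sw L (\<lambda>u v. mult H (\<pi> u) (antipode H (\<pi> v))) c = scale H (counit L c) (one H)"
    if "c \<in> carrier L" for c
    using that antipode_right[of H "\<pi> c"] by (simp add: sw_pi[where U = H])
qed simp_all

lemma SL_cancel_left:
  assumes c: "c \<in> carrier L" and U: "is_vspace U"
    and g: "\<And>h. h \<in> carrier L \<Longrightarrow> lin L U (g h)" "\<And>c. c \<in> carrier L \<Longrightarrow> lin L U (\<lambda>h. g h c)"
  shows "sw L (\<lambda>u e. sw L (\<lambda>v w. g (mult L (antipode L u) v) w) e) c = g (one L) c"
  by (rule sw_cancel[where A = L, OF _ _ U c _ _ _ _ g]) (simp_all add: SL_left)

text \<open>Splitting a1 (\<pi>(a2) \<rightharpoonup> b) takes six legs of \<open>a\<close>: four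
  from the braided coproduct of a product, and p5, p6 acting on the legs of \<open>b\<close>. On b1
  there acts \<pi>(p2) S(\<pi>(p4)) \<pi>(p5); once p4 and p5 have cancelled, the remaining four
  legs are those of the two factors a1 \<circ> b1 and a2 \<circ> b2.\<close>

lemma sw_rbm:
  assumes [simp]: "a \<in> carrier L" "b \<in> carrier L" and U: "is_vspace U"
    and f: "\<And>v. v \<in> carrier L \<Longrightarrow> lin L U (\<lambda>u. f u v)" "\<And>u. u \<in> carrier L \<Longrightarrow> lin L U (f u)"
  shows "sw L f (rbm a b) = sw L (\<lambda>a1 a2. sw L (\<lambda>b1 b2. f (rbm a1 b1) (rbm a2 b2)) b) a"
proof -
  have bf: "bilin L L U f" by (auto intro!: bilinI f)
  note [simp] = U lin_bilin1[OF bf] lin_bilin2[OF bf] bilin_mem[OF bf]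
  let ?Z = "\<lambda>b1 b2 p1 p2 p3 p6 h. f (mult L p1 (la (mult H (\<pi> p2) h) b1)) (mult L p3 (la (\<pi> p6) b2))"
  have e: "f (rbm a b) w = sw L (\<lambda>a1 a2. f (mult L a1 (la (\<pi> a2) b)) w) a"
     "f w (rbm a b) = sw L (\<lambda>a1 a2. f w (mult L a1 (la (\<pi> a2) b))) a"
    if "a \<in> carrier L" "b \<in> carrier L" "w \<in> carrier L" for a b w
    using that unfolding rb_mult_def
    by (simp_all add: lin_sw[where U = L and W = U and g = "\<lambda>z. f z w"] lin_sw[where U = L and W = U and g = "f w"])
  have "sw L f (rbm a b) = sw L (\<lambda>a1 a2. sw L f (mult L a1 (la (\<pi> a2) b))) a"
    unfolding rb_mult_def by (simp add: lin_sw[where U = L and W = U and g = "sw L f"])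
  also have "\<dots> = sw L (\<lambda>a' a5. sw L (\<lambda>p1 p'. sw L (\<lambda>p5 p6. sw L (\<lambda>b1 b2. sw L (\<lambda>p2 d. sw L (\<lambda>p3 p4.
     ?Z b1 b2 p1 p2 p3 p6 (mult H (antipode H (\<pi> p4)) (\<pi> p5))) d) p') b) a5) a') a"
    by (simp add: sw_L_mult[where U = U] sw_la[where U = U] sw_pi[where U = U] la_mult)
  also have "\<dots> = sw L (\<lambda>a' a5. sw L (\<lambda>p1 p'. sw L (\<lambda>b1 b2. sw L (\<lambda>p5 p6. sw L (\<lambda>p2 d. sw L (\<lambda>p3 p4.
     ?Z b1 b2 p1 p2 p3 p6 (mult H (antipode H (\<pi> p4)) (\<pi> p5))) d) p') a5) b) a') a"
    by (rule sw_cong, simp, simp, rule sw_cong, simp, simp, rule sw_swap[where U = U]) simp_all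
  also have "\<dots> = sw L (\<lambda>a' a5. sw L (\<lambda>b1 b2. sw L (\<lambda>p1 p'. sw L (\<lambda>p5 p6. sw L (\<lambda>p2 d. sw L (\<lambda>p3 p4.
     ?Z b1 b2 p1 p2 p3 p6 (mult H (antipode H (\<pi> p4)) (\<pi> p5))) d) p') a5) a') b) a"
    by (rule sw_cong, simp, simp, rule sw_swap[where U = U]) simp_all
  also have "\<dots> = sw L (\<lambda>b1 b2. sw L (\<lambda>a' a5. sw L (\<lambda>p1 p'. sw L (\<lambda>p5 p6. sw L (\<lambda>p2 d. sw L (\<lambda>p3 p4.
     ?Z b1 b2 p1 p2 p3 p6 (mult H (antipode H (\<pi> p4)) (\<pi> p5))) d) p') a5) a') a) b"
    by (rule sw_swap[where U = U]) simp_all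
  also have "\<dots> = sw L (\<lambda>b1 b2. sw L (\<lambda>a' a5. sw L (\<lambda>p1 p'. sw L (\<lambda>p2 d. sw L (\<lambda>p5 p6. sw L (\<lambda>p3 p4.
     ?Z b1 b2 p1 p2 p3 p6 (mult H (antipode H (\<pi> p4)) (\<pi> p5))) d) a5) p') a') a) b"
    by (rule sw_cong, simp, simp, rule sw_cong, simp, simp, rule sw_cong, simp, simp,
        rule sw_swap[where U = U]) simp_all
  also have "\<dots> = sw L (\<lambda>b1 b2. sw L (\<lambda>a' a5. sw L (\<lambda>p1 p'. sw L (\<lambda>p2 d. sw L (\<lambda>p3 p4. sw L (\<lambda>p5 p6.
     ?Z b1 b2 p1 p2 p3 p6 (mult H (antipode H (\<pi> p4)) (\<pi> p5))) a5) d) p') a') a) b"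
    by (rule sw_cong, simp, simp, rule sw_cong, simp, simp, rule sw_cong, simp, simp,
        rule sw_cong, simp, simp, rule sw_swap[where U = U]) simp_all
  \<comment> \<open>The interchanges have brought the coproducts of \<open>a\<close> directly inside
    one another; coassociativity now nests them to the right, with p4 and p5 consecutive.\<close>
  also have "\<dots> = sw L (\<lambda>b1 b2. sw L (\<lambda>p1 c1. sw L (\<lambda>p2 c2. sw L (\<lambda>p3 c3. sw L (\<lambda>p4 c4. sw L (\<lambda>p5 p6.
     ?Z b1 b2 p1 p2 p3 p6 (mult H (antipode H (\<pi> p4)) (\<pi> p5))) c4) c3) c2) c1) a) b"
    by (simp add: sw_coassoc[where U = U])
  also have "\<dots> = sw L (\<lambda>b1 b2. sw L (\<lambda>p1 c1. sw L (\<lambda>p2 c2. sw L (\<lambda>p3 c3. 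
     ?Z b1 b2 p1 p2 p3 c3 (one H)) c2) c1) a) b"
    by (rule sw_cong, simp, simp, rule sw_cong, simp, simp, rule sw_cong, simp, simp, rule sw_cong, simp, simp,
        rule pi_cancel_left[where U = U]) simp_all
  also have "\<dots> = sw L (\<lambda>b1 b2. sw L (\<lambda>a1 a2. sw L (\<lambda>p1 p2. sw L (\<lambda>p3 p4. 
     f (mult L p1 (la (\<pi> p2) b1)) (mult L p3 (la (\<pi> p4) b2))) a2) a1) a) b"
    by (simp add: sw_coassoc[where U = U])
  also have "\<dots> = sw L (\<lambda>b1 b2. sw L (\<lambda>a1 a2. f (rbm a1 b1) (rbm a2 b2)) a) b"
    by (rule sw_cong, simp, simp, rule sw_cong, simp, simp) (simp only: e(1)[OF _ _ lin_rbm(3)], simp add: e(2))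
  also have "\<dots> = sw L (\<lambda>a1 a2. sw L (\<lambda>b1 b2. f (rbm a1 b1) (rbm a2 b2)) b) a"
    by (rule sw_swap[where U = U]) simp_all
  finally show ?thesis .
qed

text \<open>Comultiplicativity of the new product makes \<pi>(a2 \<circ> b2) appear, which the
  Rota-Baxter identity turns into \<pi>(a2) \<pi>(b2). The legs of \<open>a\<close> acting on two
  factors are then collected into one action on a product of \<open>L\<close>, by
  \<open>mult_la\<close>.\<close>

lemma rbm_assoc:
  assumes [simp]: "a \<in> carrier L" "b \<in> carrier L" "c \<in> carrier L"
  shows "rbm (rbm a b) c = rbm a (rbm b c)"
proof -
  have "rbm (rbm a b) c = sw L (\<lambda>u v. mult L u (la (\<pi> v) c)) (rbm a b)"
    by (simp add: rb_mult_def)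
  also have "\<dots> = sw L (\<lambda>a1 a2. sw L (\<lambda>b1 b2. mult L (rbm a1 b1) (la (mult H (\<pi> a2) (\<pi> b2)) c)) b) a"
    by (simp add: sw_rbm[where U = L] pi_rbm)
  also have "\<dots> = sw L (\<lambda>a' w. sw L (\<lambda>b1 b2. sw L (\<lambda>u v. mult L u (mult L (la (\<pi> v) b1) (la (mult H (\<pi> w) (\<pi> b2)) c))) a') b) a"
    by (simp add: rb_mult_def lin_sw[where U = L and W = L and g = "\<lambda>z. mult L z w" for w])
  also have "\<dots> = sw L (\<lambda>b1 b2. sw L (\<lambda>a' w. sw L (\<lambda>u v. mult L u (mult L (la (\<pi> v) b1) (la (mult H (\<pi> w) (\<pi> b2)) c))) a') a) b"
    by (rule sw_swap[where U = L]) simp_all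
  also have "\<dots> = sw L (\<lambda>b1 b2. sw L (\<lambda>u a'. sw L (\<lambda>v w. mult L u (mult L (la (\<pi> v) b1) (la (mult H (\<pi> w) (\<pi> b2)) c))) a') a) b"
    by (rule sw_cong, simp, simp, rule sw_coassoc[where U = L]) simp_all
  also have "\<dots> = sw L (\<lambda>b1 b2. sw L (\<lambda>u a'. mult L u (la (\<pi> a') (mult L b1 (la (\<pi> b2) c)))) a) b"
    by (simp add: mult_la sw_pi[where U = L] la_mult lin_sw[where U = L and W = L and g = "mult L w" for w])
  also have "\<dots> = sw L (\<lambda>u a'. sw L (\<lambda>b1 b2. mult L u (la (\<pi> a') (mult L b1 (la (\<pi> b2) c)))) b) a"
    by (rule sw_swap[where U = L]) simp_all
  also have "\<dots> = rbm a (rbm b c)"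
    by (simp add: rb_mult_def lin_sw[where U = L and W = L and g = "\<lambda>z. mult L w (la w' z)" for w w'])
  finally show ?thesis .
qed

text \<open>The element \<pi>(1) is idempotent, as 1 \<circ> 1 = 1, and it is invertible, being the
  image of a group-like element under a coalgebra map. An invertible idempotent is 1.\<close>

lemma pi_one [simp]: "\<pi> (one L) = one H"
proof -
  let ?p = "\<pi> (one L)"
  have idem: "mult H ?p ?p = ?p"
  proof -
    have "mult H ?p ?p = \<pi> (rbm (one L) (one L))" by (simp add: pi_rbm)
    also have "rbm (one L) (one L) = one L"
      by (simp add: rb_mult_def sw_L_one[where U = L] vs_scale_one)
    finally show ?thesis .
  qed
  have inv: "mult H (antipode H ?p) ?p = one H"
    using antipode_left[of H ?p]
    by (simp add: sw_pi[where U = H] sw_L_one[where U = H] vs_scale_one)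
  have "?p = mult H (mult H (antipode H ?p) ?p) ?p" by (simp add: inv del: mult_assoc)
  also have "\<dots> = mult H (antipode H ?p) (mult H ?p ?p)" by simp
  also have "\<dots> = one H" by (simp only: idem inv)
  finally show ?thesis .
qed

lemma rbm_one [simp]: "a \<in> carrier L \<Longrightarrow> rbm (one L) a = a" "a \<in> carrier L \<Longrightarrow> rbm a (one L) = a"
  by (simp_all add: rb_mult_def sw_L_one[where U = L] sw_counit2[where U = L])

lemma counit_rbm:
  assumes [simp]: "a \<in> carrier L" "b \<in> carrier L"
  shows "counit L (rbm a b) = counit L a * counit L b"
proof -
  have "counit L (rbm a b) = sw L (\<lambda>a1 a2. scale field_space (counit L a1) (counit L a2 * counit L b)) a"
    by (simp add: rb_mult_def lin_sw[where U = L and W = field_space and g = "counit L"])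
  also have "\<dots> = counit L a * counit L b"
    by (rule sw_counit1[where U = field_space]) simp_all
  finally show ?thesis .
qed

section \<open>The antipode of the new product\<close>

abbreviation rbS where "rbS \<equiv> rb_antipode H L la \<pi>"

text \<open>
  The inverse of the Galois map \<open>a \<otimes> b \<mapsto> a\<^sub>1 \<otimes> (a\<^sub>2 \<circ> b)\<close> is \<open>a \<otimes> b \<mapsto> a\<^sub>1 \<otimes> rb_ldiv a\<^sub>2 b\<close>. Its
  right linearity for \<open>\<circ>\<close> makes \<open>rbS\<close> a left antipode without using that \<open>antipode L\<close> is a braided
  anti-coalgebra map.
\<close>

definition rb_ldiv :: "'l \<Rightarrow> 'l \<Rightarrow> 'l" where
  "rb_ldiv a b = sw L (\<lambda>a1 a2. la (antipode H (\<pi> a1)) (mult L (antipode L a2) b)) a"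

lemma bilin_rb_ldiv: "bilin L L L rb_ldiv"
  unfolding rb_ldiv_def by (rule bilinI) simp_all

lemmas lin_rb_ldiv [simp] = lin_bilin1[OF bilin_rb_ldiv] lin_bilin2[OF bilin_rb_ldiv] bilin_mem[OF bilin_rb_ldiv]

lemma rbS_eq: "a \<in> carrier L \<Longrightarrow> rbS a = rb_ldiv a (one L)"
  by (simp add: rb_antipode_def rb_ldiv_def)

lemma lin_rbS: "lin L L rbS"
  unfolding rb_antipode_def by simp

lemmas lin_rbS' [simp] = lin_rbS lin_comp[OF _ lin_rbS] lin_mem[OF lin_rbS]

text \<open>Of four legs of \<open>a\<close>, the middle two meet as \<pi>(v) S(\<pi>(p)) and
  cancel; the outer two then meet as u S(q) and give the counit. In \<open>rb_ldiv_rbm\<close> it is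
  the middle legs that cancel in \<open>L\<close> and the outer ones in \<open>H\<close>.\<close>

lemma rbm_rb_ldiv:
  assumes [simp]: "a \<in> carrier L" "b \<in> carrier L"
  shows "sw L (\<lambda>a1 a2. rbm a1 (rb_ldiv a2 b)) a = scale L (counit L a) b"
proof -
  have "sw L (\<lambda>a1 a2. rbm a1 (rb_ldiv a2 b)) a =
     sw L (\<lambda>a1 a2. sw L (\<lambda>u v. sw L (\<lambda>p q. mult L u (la (mult H (\<pi> v) (antipode H (\<pi> p))) (mult L (antipode L q) b))) a2) a1) a"
    by (simp add: rb_mult_def rb_ldiv_def la_mult lin_sw[where U = L and W = L and g = "\<lambda>z. mult L w (la w' z)" for w w'])
  also have "\<dots> = sw L (\<lambda>u e. sw L (\<lambda>v a2. sw L (\<lambda>p q. mult L u (la (mult H (\<pi> v) (antipode H (\<pi> p))) (mult L (antipode L q) b))) a2) e) a"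
    by (rule sw_coassoc[where U = L]) simp_all
  also have "\<dots> = sw L (\<lambda>u e. mult L u (la (one H) (mult L (antipode L e) b))) a"
    by (rule sw_cong, simp, simp, rule pi_cancel_right[where U = L]) simp_all
  also have "\<dots> = mult L (sw L (\<lambda>u e. mult L u (antipode L e)) a) b"
    by (simp add: lin_sw[where U = L and W = L and g = "\<lambda>z. mult L z b"])
  also have "\<dots> = scale L (counit L a) b" by (simp add: SL_right)
  finally show ?thesis .
qed

lemma rb_ldiv_rbm:
  assumes [simp]: "a \<in> carrier L" "b \<in> carrier L"
  shows "sw L (\<lambda>a1 a2. rb_ldiv a1 (rbm a2 b)) a = scale L (counit L a) b"
proof -
  have "sw L (\<lambda>a1 a2. rb_ldiv a1 (rbm a2 b)) a =
     sw L (\<lambda>a1 a2. sw L (\<lambda>p q. sw L (\<lambda>u v. la (antipode H (\<pi> p)) (mult L (mult L (antipode L q) u) (la (\<pi> v) b))) a2) a1) a"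
    by (simp add: rb_mult_def rb_ldiv_def lin_sw[where U = L and W = L and g = "\<lambda>z. la w' (mult L w z)" for w w'])
  also have "\<dots> = sw L (\<lambda>p e. sw L (\<lambda>q a2. sw L (\<lambda>u v. la (antipode H (\<pi> p)) (mult L (mult L (antipode L q) u) (la (\<pi> v) b))) a2) e) a"
    by (rule sw_coassoc[where U = L]) simp_all
  also have "\<dots> = sw L (\<lambda>p e. la (antipode H (\<pi> p)) (mult L (one L) (la (\<pi> e) b))) a"
    by (rule sw_cong, simp, simp, rule SL_cancel_left[where U = L]) (simp_all del: mult_assoc)
  also have "\<dots> = la (sw H (\<lambda>u v. mult H (antipode H u) v) (\<pi> a)) b"
    by (simp add: la_mult sw_pi[where U = H] lin_sw[where U = H and W = L and g = "\<lambda>z. la z b"])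
  also have "\<dots> = scale L (counit L a) b"
    by (simp add: antipode_left lin_scale[OF bilinD1[OF bilin_la]])
  finally show ?thesis .
qed

lemma rb_ldiv_self:
  assumes [simp]: "a \<in> carrier L"
  shows "sw L (\<lambda>a1 a2. rb_ldiv a1 a2) a = scale L (counit L a) (one L)"
proof -
  have "sw L (\<lambda>a1 a2. rb_ldiv a1 a2) a =
     sw L (\<lambda>p e. sw L (\<lambda>q a2. la (antipode H (\<pi> p)) (mult L (antipode L q) a2)) e) a"
    unfolding rb_ldiv_def by (rule sw_coassoc[where U = L]) simp_all
  also have "\<dots> = sw L (\<lambda>p e. la (antipode H (\<pi> p)) (sw L (\<lambda>q a2. mult L (antipode L q) a2) e)) a"
    by (simp add: lin_sw[where U = L and W = L and g = "la w'" for w'])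
  also have "\<dots> = sw L (\<lambda>p e. scale L (counit L e) (scale L (counit L p) (one L))) a"
    by (simp add: SL_left lin_scale[OF bilinD2[OF bilin_la]] antipode_counit)
  also have "\<dots> = scale L (counit L a) (one L)"
    by (rule sw_counit2[where U = L]) simp_all
  finally show ?thesis .
qed

text \<open>By \<open>rbm_rb_ldiv\<close> at the unit, a2 \<circ> rbS(a3) collapses to a counit and
  so may be inserted in front of \<open>b\<close>. Associativity then presents a2 \<circ> (rbS(a3)
  \<circ> b), from which division by a1 removes a2.\<close>

lemma rb_ldiv_eq:
  assumes [simp]: "a \<in> carrier L" "b \<in> carrier L"
  shows "rb_ldiv a b = rbm (rbS a) b"
proof -
  have "rb_ldiv a b = sw L (\<lambda>a1 e. scale L (counit L e) (rb_ldiv a1 b)) a"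
    by (rule sw_counit2[where U = L, symmetric]) simp_all
  also have "\<dots> = sw L (\<lambda>a1 e. rb_ldiv a1 (rbm (sw L (\<lambda>a2 a3. rbm a2 (rb_ldiv a3 (one L))) e) b)) a"
    by (simp add: rbm_rb_ldiv lin_scale[OF bilinD1[OF bilin_rbm]] lin_scale[OF bilinD2[OF bilin_rb_ldiv]])
  also have "\<dots> = sw L (\<lambda>a1 e. sw L (\<lambda>a2 a3. rb_ldiv a1 (rbm a2 (rbm (rbS a3) b))) e) a"
    by (simp add: rbm_assoc rbS_eq lin_sw[where U = L and W = L and g = "\<lambda>z. rb_ldiv w' (rbm z b)" for w'])
  also have "\<dots> = sw L (\<lambda>d a3. sw L (\<lambda>a1 a2. rb_ldiv a1 (rbm a2 (rbm (rbS a3) b))) d) a"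
    by (rule sw_coassoc[where U = L, symmetric]) simp_all
  also have "\<dots> = sw L (\<lambda>d a3. scale L (counit L d) (rbm (rbS a3) b)) a"
    by (simp add: rb_ldiv_rbm)
  also have "\<dots> = rbm (rbS a) b"
    by (rule sw_counit1[where U = L]) simp_all
  finally show ?thesis .
qed

section \<open>The ordinary Hopf algebra on L\<close>

abbreviation "Lpi \<equiv> rb_hopf H L la \<pi>"

lemma Lpi_sel [simp]:
  "carrier Lpi = carrier L" "scale Lpi = scale L" "comult Lpi = comult L" "counit Lpi = counit L"
  "one Lpi = one L" "mult Lpi = rbm" "antipode Lpi = rbS"
  by (simp_all add: rb_hopf_def)

lemmas Lpi_struct [simp] = struct[OF Lpi_sel(1,2)] sw_struct[OF Lpi_sel(1-3)]

lemma tensor_Lpi [simp]: "tensor_coalgebra C Lpi = tensor_coalgebra C L"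
  by (rule tensor_coalgebra_struct2) simp_all

lemma hopf_Lpi: "is_hopf_algebra Lpi"
proof -
  have "is_algebra Lpi"
    unfolding is_algebra_def using bilin_rbm rbm_assoc by (simp add: bilin_def)
  moreover have "is_coalgebra Lpi"
    using coalg_L unfolding is_coalgebra_def sw3_def by simp
  moreover have "counit_alg_map Lpi"
    unfolding counit_alg_map_def by (simp add: counit_rbm)
  moreover have "comult L (rbm a b) = sw L (\<lambda>a1 a2. sw L (\<lambda>b1 b2. tens L L (rbm a1 b1) (rbm a2 b2)) b) a"
    if "a \<in> carrier L" "b \<in> carrier L" for a b
    using that by (simp add: comult_sw[of L "rbm a b"] sw_rbm[where U = LL])
  ultimately have "is_bialgebra Lpi"
    unfolding is_bialgebra_def using comult_one_L by simp
  \<comment> \<open>Through \<open>rb_ldiv_eq\<close> the left law becomes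
    \<open>rb_ldiv_self\<close>; the right law is \<open>rbm_rb_ldiv\<close> at the unit.\<close>
  moreover have "antipode_law Lpi"
    unfolding antipode_law_def
    by (simp add: rb_ldiv_eq[symmetric] rb_ldiv_self) (simp add: rbS_eq rbm_rb_ldiv)
  ultimately show ?thesis unfolding is_hopf_algebra_def by blast
qed

section \<open>The right action as a convolution quotient\<close>

abbreviation P where "P s \<equiv> \<pi> (A s)"
abbreviation Q where "Q \<equiv> tlift H L (\<lambda>x a. mult H x (\<pi> a))"
abbreviation R where "R \<equiv> conv X H (\<lambda>s. antipode H (P s)) Q"
abbreviation ra where "ra \<equiv> rb_ract H L la \<pi>"

lemma bilin_Q: "bilin H L H (\<lambda>x a. mult H x (\<pi> a))"
  by (rule bilinI) simp_all

lemma lin_Q: "lin Y H Q" by (rule lin_tlift[OF _ _ bilin_Q]) simp_all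

lemmas lin_Q' [simp] = lin_Q lin_comp[OF _ lin_Q] lin_mem[OF lin_Q]

lemma Q_tens [simp]: "x \<in> carrier H \<Longrightarrow> a \<in> carrier L \<Longrightarrow> Q (tens H L x a) = mult H x (\<pi> a)"
  by (rule tlift_tens[OF _ bilin_Q]) simp_all

lemma hom_Q: "coalgebra_hom X H Q"
proof (rule coalgebra_hom_tlift[OF _ _ _ bilin_Q])
  fix x a assume [simp]: "x \<in> carrier H" "a \<in> carrier L"
  have "comult H (mult H x (\<pi> a)) = sw H (tens H H) (mult H x (\<pi> a))" by (rule comult_sw) simp_all
  then show "comult H (mult H x (\<pi> a)) = sw H (\<lambda>x1 x2. sw L (\<lambda>a1 a2. tens H H (mult H x1 (\<pi> a1)) (mult H x2 (\<pi> a2))) a) x"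
    by (simp add: sw_mult[where U = "tensor_space H H"] sw_pi[where U = "tensor_space H H"])
qed simp_all

lemma hom_P: "coalgebra_hom X H P"
proof -
  have "comult H (P s) = sw X (\<lambda>s1 s2. tens H H (P s1) (P s2)) s" if "s \<in> carrier Y" for s
    using that by (simp add: comult_sw[of H "P s"] sw_pi[where U = "tensor_space H H"] sw_A[where U = "tensor_space H H"])
  moreover have "counit H (P s) = counit X s" if "s \<in> carrier Y" for s
    using that hom_A by (simp add: coalgebra_hom_def)
  ultimately show ?thesis unfolding coalgebra_hom_def by simp
qed

lemma lin_R: "lin Y H R"
  using lin_conv[of X H "\<lambda>s. antipode H (P s)" Q] by simp

lemmas lin_R' [simp] = lin_R lin_comp[OF _ lin_R] lin_mem[OF lin_R]

lemma R_sw: "s \<in> carrier Y \<Longrightarrow> R s = sw X (\<lambda>s1 s2. mult H (antipode H (P s1)) (Q s2)) s"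
  by (simp add: conv_def)

lemma bilin_ra: "bilin H L H ra"
  unfolding rb_ract_def by (rule bilinI) simp_all

lemmas lin_ra [simp] = lin_bilin1[OF bilin_ra] lin_bilin2[OF bilin_ra] bilin_mem[OF bilin_ra]

lemma R_tens: "x \<in> carrier H \<Longrightarrow> a \<in> carrier L \<Longrightarrow> R (tens H L x a) = ra x a"
  by (simp add: R_sw sw_tensor[where U = H] rb_ract_def)

lemma R_tlift: "s \<in> carrier Y \<Longrightarrow> tlift H L ra s = R s"
proof (rule tensor_ext[where V = H and W = L and U = H and t = s])
  show "lin Y H (tlift H L ra)" by (rule lin_tlift[OF _ _ bilin_ra]) simp_all
  fix x a assume [simp]: "x \<in> carrier H" "a \<in> carrier L"
  have "tlift H L ra (tens H L x a) = ra x a" by (rule tlift_tens[OF _ bilin_ra]) simp_all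
  then show "tlift H L ra (tens H L x a) = R (tens H L x a)" by (simp add: R_tens)
qed simp_all

lemma PR: "s \<in> carrier Y \<Longrightarrow> sw X (\<lambda>s1 s2. mult H (P s1) (R s2)) s = Q s"
proof -
  assume s: "s \<in> carrier Y"
  have "conv X H P R = conv X H (conv X H P (\<lambda>s. antipode H (P s))) Q"
    by (rule conv_assoc[symmetric]) simp_all
  also have "\<dots> = restr0 X Q"
    by (simp add: antipode_conv hom_P conv_one_left)
  finally have "conv X H P R s = restr0 X Q s" by simp
  then show ?thesis using s by (simp add: conv_def[of X H P] restr0_def)
qed

text \<open>On x \<otimes> m both sides are the coaction of x \<rightharpoonup> m. The left one
  computes it from its definition, as \<open>A\<close> respects coproducts; the right one from the
  Yetter-Drinfeld condition, in which S(\<pi>(m3)) S(x3) is the antipode of Q(x3 \<otimes>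
  m3).\<close>

lemma yd_eq:
  assumes s: "s \<in> carrier Y"
  shows "sw X (\<lambda>s1 s'. sw X (\<lambda>s2 s3. tens H L (mult H (P s1) (antipode H (P s3))) (A s2)) s') s =
      sw X (\<lambda>s1 s'. sw X (\<lambda>s2 s3. tens H L (mult H (Q s1) (antipode H (Q s3))) (A s2)) s') s"
proof (rule tensor_ext[where V = H and W = L and U = Y and t = s])
  fix x m assume [simp]: "x \<in> carrier H" "m \<in> carrier L"
  have id: "coad H L \<pi> a = sw L (\<lambda>a1 d. sw L (\<lambda>a2 a3. tens H L (mult H (\<pi> a1) (antipode H (\<pi> a3))) a2) d) a"
    if "a \<in> carrier L" for a
    unfolding coad_def sw3_def by (rule sw_coassoc[where U = Y]) (use that in simp_all)
  have "coact M (act M x m) =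
          sw3 H (\<lambda>x1 x2 x3. tlift H M (\<lambda>m1 m0.
            tens H M (mult H (mult H x1 m1) (antipode H x3)) (act M x2 m0)) (coact M m)) x"
    using yd unfolding is_yd_def by simp
  then have yd: "coad H L \<pi> (la x m) = sw3 H (\<lambda>x1 x2 x3. tlift H L (\<lambda>m1 m0.
            tens H L (mult H (mult H x1 m1) (antipode H x3)) (la x2 m0)) (coad H L \<pi> m)) x"
    by simp
  have b: "bilin H L Y (\<lambda>m1 m0. tens H L (mult H (mult H x1 m1) (antipode H x3)) (la x2 m0))"
    if "x1 \<in> carrier H" "x2 \<in> carrier H" "x3 \<in> carrier H" for x1 x2 x3
    by (rule bilinI) (use that in simp_all)
  have cA: "sw X (\<lambda>s1 s'. sw X (\<lambda>s2 s3. tens H L (mult H (P s1) (antipode H (P s3))) (A s2)) s') s =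
     sw L (\<lambda>a1 d. sw L (\<lambda>a2 a3. tens H L (mult H (\<pi> a1) (antipode H (\<pi> a3))) a2) d) (A s)"
    if "s \<in> carrier Y" for s
    using that by (simp add: sw_A[where U = Y])
  let ?s = "tens H L x m"
  have "sw X (\<lambda>s1 s'. sw X (\<lambda>s2 s3. tens H L (mult H (P s1) (antipode H (P s3))) (A s2)) s') ?s =
     sw L (\<lambda>a1 d. sw L (\<lambda>a2 a3. tens H L (mult H (\<pi> a1) (antipode H (\<pi> a3))) a2) d) (A ?s)"
    by (rule cA) simp
  also have "\<dots> = sw H (\<lambda>d x3. sw H (\<lambda>x1 x2. sw L (\<lambda>a1 d. sw L (\<lambda>a2 a3. 
       tens H L (mult H x1 (mult H (\<pi> a1) (mult H (antipode H (\<pi> a3)) (antipode H x3)))) (la x2 a2)) d) m) d) x"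
    by (simp add: id[symmetric] yd sw3_def coad_tlift[OF _ _ b])
  also have "\<dots> = sw H (\<lambda>x1 x'. sw H (\<lambda>x2 x3. sw L (\<lambda>a1 d. sw L (\<lambda>a2 a3. 
       tens H L (mult H x1 (mult H (\<pi> a1) (mult H (antipode H (\<pi> a3)) (antipode H x3)))) (la x2 a2)) d) m) x') x"
    by (rule sw_coassoc[where U = Y]) simp_all
  also have "\<dots> = sw H (\<lambda>x1 x'. sw L (\<lambda>a1 d. sw H (\<lambda>x2 x3. sw L (\<lambda>a2 a3. 
       tens H L (mult H x1 (mult H (\<pi> a1) (mult H (antipode H (\<pi> a3)) (antipode H x3)))) (la x2 a2)) d) x') m) x"
    by (rule sw_cong, simp, simp, rule sw_swap[where U = Y]) simp_all
  also have "\<dots> = sw X (\<lambda>s1 s'. sw X (\<lambda>s2 s3. tens H L (mult H (Q s1) (antipode H (Q s3))) (A s2)) s') ?s"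
    by (simp add: sw_tensor[where U = Y] antipode_mult)
  finally show "sw X (\<lambda>s1 s'. sw X (\<lambda>s2 s3. tens H L (mult H (P s1) (antipode H (P s3))) (A s2)) s') ?s =
      sw X (\<lambda>s1 s'. sw X (\<lambda>s2 s3. tens H L (mult H (Q s1) (antipode H (Q s3))) (A s2)) s') ?s" .
qed (use s in simp_all)

lemma compat:
  assumes "s \<in> carrier Y" "is_vspace U" "bilin L H U f"
  shows "sw X (\<lambda>s1 s2. f (A s1) (R s2)) s = sw X (\<lambda>s1 s2. f (A s2) (R s1)) s"
  by (rule yd_commute[where H = H and L = L and U = U])
    (use assms in \<open>simp_all add: hom_P hom_Q yd_eq\<close>)

text \<open>Since P = \<pi> \<circ> A, commutation of \<open>R\<close> with \<open>P\<close> is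
  commutation of \<open>R\<close> with \<open>A\<close> followed by \<pi>.\<close>

lemma hom_R: "coalgebra_hom X H R"
proof (rule yd_commute_coalgebra_hom[OF _ _ hom_P hom_Q])
  fix s assume "s \<in> carrier X"
  then show "sw X (\<lambda>s1 s2. tens H H (R s1) (P s2)) s = sw X (\<lambda>s1 s2. tens H H (R s2) (P s1)) s"
    by (intro compat[where f = "\<lambda>l h. tens H H h (\<pi> l)" and U = "tensor_space H H", symmetric])
      (auto intro!: bilinI)
qed simp_all

lemma sw_R:
  assumes s: "s \<in> carrier Y" and U [simp]: "is_vspace U"
    and f: "\<And>v. v \<in> carrier H \<Longrightarrow> lin H U (\<lambda>u. f u v)" "\<And>u. u \<in> carrier H \<Longrightarrow> lin H U (f u)"
  shows "sw H f (R s) = sw X (\<lambda>s1 s2. f (R s1) (R s2)) s"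
  by (rule sw_coalgebra_hom[OF hom_R _ _ U _ f]) (simp_all add: s)

lemma PR_cancel:
  assumes s [simp]: "s \<in> carrier Y" and U [simp]: "is_vspace U"
    and g: "\<And>t. t \<in> carrier Y \<Longrightarrow> lin H U (g t)" "\<And>h. h \<in> carrier H \<Longrightarrow> lin Y U (\<lambda>t. g t h)"
  shows "sw X (\<lambda>s' s3. sw X (\<lambda>s1 s2. g s1 (mult H (P s2) (R s3))) s') s = sw X (\<lambda>s1 s2. g s1 (Q s2)) s"
proof -
  have b: "bilin Y H U g" by (auto intro!: bilinI g)
  note [simp] = lin_bilin1[OF b] lin_bilin2[OF b] bilin_mem[OF b]
  have "sw X (\<lambda>s' s3. sw X (\<lambda>s1 s2. g s1 (mult H (P s2) (R s3))) s') s =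
     sw X (\<lambda>s1 s'. sw X (\<lambda>s2 s3. g s1 (mult H (P s2) (R s3))) s') s"
    by (rule sw_coassoc[where U = U]) simp_all
  also have "\<dots> = sw X (\<lambda>s1 s'. g s1 (sw X (\<lambda>s2 s3. mult H (P s2) (R s3)) s')) s"
    by (simp add: tensor_lin_sw[where U = H and W = U and g = "g z" for z])
  also have "\<dots> = sw X (\<lambda>s1 s2. g s1 (Q s2)) s" by (simp add: PR)
  finally show ?thesis .
qed

section \<open>The axioms of the matched pair\<close>

lemma la_rbm:
  assumes [simp]: "x \<in> carrier H" "a \<in> carrier L" "b \<in> carrier L"
  shows "la x (rbm a b) = sw X (\<lambda>s1 s2. rbm (A s1) (la (R s2) b)) (tens H L x a)"
proof -
  have "la x (rbm a b) = sw L (\<lambda>a1 a2. sw H (\<lambda>x1 x2. mult L (la x1 a1) (la (mult H x2 (\<pi> a2)) b)) x) a"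
    by (simp add: rb_mult_def lin_sw[where U = L and W = L and g = "la x"] mult_la la_mult)
  also have "\<dots> = sw H (\<lambda>x1 x2. sw L (\<lambda>a1 a2. mult L (la x1 a1) (la (mult H x2 (\<pi> a2)) b)) a) x"
    by (rule sw_swap[where U = L]) simp_all
  also have "\<dots> = sw X (\<lambda>s1 s2. mult L (A s1) (la (Q s2) b)) (tens H L x a)"
    by (simp add: sw_tensor[where U = L])
  \<comment> \<open>Once \<open>Q\<close> is replaced by the convolution of \<open>P\<close> and
    \<open>R\<close>, the factor P(s2) = \<pi>(A(s2)) combines with A(s1) into the new product of
    A(s1) and R(s2) \<rightharpoonup> b.\<close>
  also have "\<dots> = sw X (\<lambda>s' s3. sw X (\<lambda>s1 s2. mult L (A s1) (la (mult H (P s2) (R s3)) b)) s') (tens H L x a)"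
    by (rule PR_cancel[where U = L, symmetric]) simp_all
  also have "\<dots> = sw X (\<lambda>s1 s2. rbm (A s1) (la (R s2) b)) (tens H L x a)"
    by (simp add: rb_mult_def sw_A[where U = L] la_mult)
  finally show ?thesis .
qed

text \<open>The last factor of x \<leftharpoonup> A(s1) is \<pi> of a leg of A(s1), hence a value of
  \<open>P\<close>. With the \<open>R\<close> that follows it makes a value of \<open>Q\<close> by
  \<open>PR_cancel\<close>, and what remains is the defining formula for the product xy.\<close>

lemma ra_mult:
  assumes [simp]: "x \<in> carrier H" "y \<in> carrier H" "a \<in> carrier L"
  shows "ra (mult H x y) a = sw X (\<lambda>s1 s2. mult H (ra x (A s1)) (R s2)) (tens H L y a)"
proof -
  let ?s = "tens H L y a"
  have "sw X (\<lambda>s1 s2. mult H (ra x (A s1)) (R s2)) ?s =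
    sw X (\<lambda>s' s3. sw H (\<lambda>x1 x2. sw X (\<lambda>s1 s2. mult H (antipode H (\<pi> (la x1 (A s1)))) (mult H x2 (mult H (P s2) (R s3)))) s') x) ?s"
    by (simp add: rb_ract_def sw_A[where U = H]
       lin_sw[where U = H and W = H and g = "\<lambda>z. mult H z w" for w]
       tensor_lin_sw[where U = H and W = H and g = "\<lambda>z. mult H z w" for w])
  also have "\<dots> = sw H (\<lambda>x1 x2. sw X (\<lambda>s' s3. sw X (\<lambda>s1 s2. mult H (antipode H (\<pi> (la x1 (A s1)))) (mult H x2 (mult H (P s2) (R s3)))) s') ?s) x"
    by (rule sw_swap[where U = H]) simp_all
  also have "\<dots> = sw H (\<lambda>x1 x2. sw X (\<lambda>s1 s2. mult H (antipode H (\<pi> (la x1 (A s1)))) (mult H x2 (Q s2))) ?s) x"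
    by (rule sw_cong, simp, simp, rule PR_cancel[where U = H]) simp_all
  also have "\<dots> = ra (mult H x y) a"
    by (simp add: rb_ract_def sw_mult[where U = H] sw_tensor[where U = H] la_mult)
  finally show ?thesis ..
qed

lemma antipode_one [simp]: "antipode H (one H) = one H"
  using antipode_left[of H "one H"] by (simp add: sw_one[where U = H] vs_scale_one)

lemma ra_one [simp]: "x \<in> carrier H \<Longrightarrow> ra x (one L) = x"
  by (simp add: rb_ract_def sw_L_one[where U = H] lin_scale[OF lin_pi]
     lin_scale[of H H "antipode H"] sw_counit1[where U = H])

lemma ra_unit [simp]: "a \<in> carrier L \<Longrightarrow> ra (one H) a = scale H (counit L a) (one H)"
  using antipode_left[of H "\<pi> a"]
  by (simp add: rb_ract_def sw_one[where U = H] sw_pi[where U = H])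

text \<open>By \<open>la_rbm\<close> the inverse factor becomes S(\<pi>(R(s2) \<rightharpoonup> b1))
  S(P(s1)), followed by Q(s3). The last two factors would form a value of \<open>R\<close> if their
  legs were consecutive, and \<open>compat\<close> exchanges s1 and s2 to achieve this. The two
  values of \<open>R\<close> then present are the legs of R(x \<otimes> a), as \<open>R\<close> is a
  coalgebra map.\<close>

lemma ra_rbm:
  assumes [simp]: "x \<in> carrier H" "a \<in> carrier L" "b \<in> carrier L"
  shows "ra x (rbm a b) = ra (ra x a) b"
proof -
  let ?s = "tens H L x a"
  let ?f = "\<lambda>b1 b2 l h k. mult H (antipode H (\<pi> (la h b1))) (mult H (antipode H (\<pi> l)) (mult H k (\<pi> b2)))"
  have e: "antipode H (\<pi> (la x (rbm a b))) = 
     sw X (\<lambda>s1 s2. mult H (antipode H (\<pi> (la (R s2) b))) (antipode H (P s1))) (tens H L x a)"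
    if "x \<in> carrier H" "a \<in> carrier L" "b \<in> carrier L" for x a b
    using that by (simp add: la_rbm pi_rbm antipode_mult
       tensor_lin_sw[where U = L and W = H and g = "\<lambda>z. antipode H (\<pi> z)"])
  have "ra x (rbm a b) = sw H (\<lambda>x1 x2. sw L (\<lambda>a1 a2. sw L (\<lambda>b1 b2.
     mult H (antipode H (\<pi> (la x1 (rbm a1 b1)))) (mult H x2 (mult H (\<pi> a2) (\<pi> b2)))) b) a) x"
    by (simp add: rb_ract_def sw_rbm[where U = H] pi_rbm)
  also have "\<dots> = sw H (\<lambda>x1 x2. sw L (\<lambda>a1 a2. sw L (\<lambda>b1 b2. sw X (\<lambda>s1 s2. ?f b1 b2 (A s1) (R s2) (Q (tens H L x2 a2)))
      (tens H L x1 a1)) b) a) x"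
    by (simp add: e tensor_lin_sw[where U = H and W = H and g = "\<lambda>z. mult H z w" for w])
  also have "\<dots> = sw X (\<lambda>s' s3. sw L (\<lambda>b1 b2. sw X (\<lambda>s1 s2. ?f b1 b2 (A s1) (R s2) (Q s3)) s') b) ?s"
    by (rule sw_tensor[where U = H, symmetric]) simp_all
  also have "\<dots> = sw X (\<lambda>s' s3. sw L (\<lambda>b1 b2. sw X (\<lambda>s1 s2. ?f b1 b2 (A s2) (R s1) (Q s3)) s') b) ?s"
    by (rule sw_cong, simp, simp, rule sw_cong, simp, simp, rule compat[where U = H and f = "\<lambda>l h. ?f b1 b2 l h k" for b1 b2 k])
      (auto intro!: bilinI)
  also have "\<dots> = sw L (\<lambda>b1 b2. sw X (\<lambda>s' s3. sw X (\<lambda>s1 s2. ?f b1 b2 (A s2) (R s1) (Q s3)) s') ?s) b"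
    by (rule sw_swap[where U = H]) simp_all
  also have "\<dots> = sw L (\<lambda>b1 b2. sw X (\<lambda>s1 s'. sw X (\<lambda>s2 s3. ?f b1 b2 (A s2) (R s1) (Q s3)) s') ?s) b"
    by (rule sw_cong, simp, simp, rule sw_coassoc[where U = H]) simp_all
  also have "\<dots> = sw L (\<lambda>b1 b2. sw X (\<lambda>s1 s'. mult H (antipode H (\<pi> (la (R s1) b1))) (mult H (R s') (\<pi> b2))) ?s) b"
    by (simp add: R_sw tensor_lin_sw[where U = H and W = H and g = "\<lambda>z. mult H w (mult H z w')" for w w'])
  also have "\<dots> = sw X (\<lambda>s1 s'. sw L (\<lambda>b1 b2. mult H (antipode H (\<pi> (la (R s1) b1))) (mult H (R s') (\<pi> b2))) b) ?s"
    by (rule sw_swap[where U = H]) simp_all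
  also have "\<dots> = sw H (\<lambda>h1 h2. sw L (\<lambda>b1 b2. mult H (antipode H (\<pi> (la h1 b1))) (mult H h2 (\<pi> b2))) b) (R ?s)"
    by (rule sw_R[where U = H, symmetric]) simp_all
  also have "\<dots> = ra (ra x a) b"
    by (simp add: R_tens rb_ract_def[of H L la \<pi> "ra x a"])
  finally show ?thesis .
qed

lemma hom_ra: "coalgebra_hom X H (tlift H L ra)"
  using hom_R by (rule iffD1[OF coalgebra_hom_cong, rotated -1]) (simp_all add: R_tlift)

lemma matched_pair: "matched_pair H Lpi la ra"
proof -
  have "left_module H Lpi la"
    unfolding left_module_def using bilin_la by (simp add: bilin_def la_mult)
  moreover have "right_module Lpi H ra"
    unfolding right_module_def using bilin_ra by (simp add: bilin_def ra_rbm)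
  moreover have "coalgebra_hom X Lpi A"
    using hom_A unfolding coalgebra_hom_def by simp
  moreover have "la x (rbm a b) = sw H (\<lambda>x1 x2. sw L (\<lambda>a1 a2. rbm (la x1 a1) (la (ra x2 a2) b)) a) x"
    if "x \<in> carrier H" "a \<in> carrier L" "b \<in> carrier L" for x a b
    using that by (simp add: la_rbm sw_tensor[where U = L] R_tens)
  moreover have "ra (mult H x y) a = sw H (\<lambda>y1 y2. sw L (\<lambda>a1 a2. mult H (ra x (la y1 a1)) (ra y2 a2)) a) y"
    if "x \<in> carrier H" "y \<in> carrier H" "a \<in> carrier L" for x y a
    using that by (simp add: ra_mult sw_tensor[where U = H] R_tens)
  moreover have "sw H (\<lambda>x1 x2. sw L (\<lambda>a1 a2. tens L H (la x1 a1) (ra x2 a2)) a) x =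
        sw H (\<lambda>x1 x2. sw L (\<lambda>a1 a2. tens L H (la x2 a2) (ra x1 a1)) a) x"
    if "x \<in> carrier H" "a \<in> carrier L" for x a
    using that compat[of "tens H L x a" "tensor_space L H" "tens L H"]
    by (simp add: sw_tensor[where U = "tensor_space L H"] R_tens bilin_tens)
  ultimately show ?thesis
    unfolding matched_pair_def using hopf_Lpi hom_ra by simp
qed

lemma hom_pi_Lpi: "coalgebra_hom Lpi H \<pi>"
  using hom_pi unfolding coalgebra_hom_def by simp

end

theorem theorem4p5:
  fixes H :: "('k::field, 'h::ab_group_add) halg"
    and L :: "('k, 'l::ab_group_add) halg"
    and la :: "'h \<Rightarrow> 'l \<Rightarrow> 'l"
    and \<pi> :: "'l \<Rightarrow> 'h"
  assumes "is_hopf_algebra H"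
    and "relative_rota_baxter H L la \<pi>"
  shows "let L\<pi> = rb_hopf H L la \<pi>;
             ra = rb_ract H L la \<pi>;
             D = double_cross_product H L\<pi> la ra;
             \<theta> = tlift L\<pi> H (\<lambda>a x. mult H (\<pi> a) x)
         in is_hopf_algebra L\<pi> \<and>
            matched_pair H L\<pi> la ra \<and>
            hopf_hom D H \<theta> \<and>
            (\<forall>a\<in>carrier L\<pi>. \<forall>x\<in>carrier H. \<theta> (tens L\<pi> H a x) = mult H (\<pi> a) x) \<and>
            (\<forall>x\<in>carrier H. \<theta> (tens L\<pi> H (one L\<pi>) x) = x)"
proof -
  interpret rota_baxter H L la \<pi> by unfold_locales (rule assms(2))
  interpret m: matched H Lpi la ra by unfold_locales (rule matched_pair)
  have "hopf_hom (double_cross_product H Lpi la ra) H (tlift Lpi H (\<lambda>a x. mult H (\<pi> a) x))"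
  proof (rule m.projection_hopf_hom[OF hom_pi_Lpi])
    \<comment> \<open>The remaining hypothesis of the projection is \<open>PR\<close> at x \<otimes>
      a.\<close>
    fix x a assume "x \<in> carrier H" "a \<in> carrier Lpi"
    then show "sw (tensor_coalgebra H Lpi) (\<lambda>s1 s2. mult H (\<pi> (tlift H Lpi la s1)) (tlift H Lpi ra s2)) (tens H Lpi x a) = mult H x (\<pi> a)"
      using PR[of "tens H L x a"] by (simp add: R_tlift)
  qed (simp_all add: pi_rbm)
  moreover have "bilin L H H (\<lambda>a x. mult H (\<pi> a) x)" by (rule bilinI) simp_all
  then have "tlift L H (\<lambda>a x. mult H (\<pi> a) x) (tens L H a x) = mult H (\<pi> a) x"
    if "a \<in> carrier L" "x \<in> carrier H" for a x
    using that by (intro tlift_tens) simp_all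
  ultimately show ?thesis
    using hopf_Lpi matched_pair by (simp add: Let_def)
qed

end
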